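(* Let $\psi$ be an expansive $C^1$-flow on a three-dimensional smooth and closed Riemannian manifold. Suppose $\psi$ is obtained as a singular suspension of a diffeomorphism $f$. Then $\psi$ has positive topological entropy.
   Context: Closed manifold: compact, smooth, without boundary. Expansive flow. Let $Rep$ be the set of increasing homeomorphisms $h:\mathbb{R}\to\mathbb{R}$ with $h(0)=0$. A flow $\phi$ on a compact manifold $N$ with metric $d$ is expansive if for every $\varepsilon>0$ there is $\delta>0$ such that if $x,y\in N$ and $h\in Rep$ satisfy $d(\phi_t(x),\phi_{h(t)}(y))\le\delta$ for every $t\in\mathbb{R}$, then there is $t_0\in\mathbb{R}$ with $\phi_{h(t_0)}(y)\in\phi_{[t_0-\varepsilon,t_0+\varepsilon]}(x)$. (This is also called $k^*$-expansiveness.) Suspension flow. Let $M$ be a closed manifold, $f:M\to M$ a $C^1$-diffeomorphism and $\rho:M\to(0,\infty)$ a continuous function (the roof function). Let $\overline{M}$ be the closed manifold obtained from $\{(x,s): x\in M,\ 0\le s\le \rho(x)\}$ by identifying $(x,\rho(x))$ with $(f(x),0)$. The suspension flow $\phi$ of $f$ with roof $\rho$ is the flow on $\overline{M}$ that moves points with unit speed along the second coordinate, i.e. $\phi_t(x,s)=(x,s+t)$ as long as $0\le s+t\le\rho(x)$, continued through the identification. Let $X_\phi$ be its velocity vector field. Singular suspension. Let $S\subset\overline{M}$ be compact and let $\alpha:\overline{M}\to[0,\infty)$ be a smooth function with $\alpha(x)=0$ if and only if $x\in S$ (a brake). The singular suspension of $f$ with roof $\rho$ and brake $\alpha$ is the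 flow $\psi$ on $\overline{M}$ induced by the vector field $\alpha X_\phi$. Here the three-dimensional manifold is $\overline{M}$. The topological entropy of a flow $\psi$ is that of its time-one map: $h(\psi)=h(\psi_1)$. *)

theory Defs
  imports "HOL-Analysis.Analysis"
begin

section \<open>Smooth manifolds\<close>

text \<open>Only used on open sets, where \<open>frechet_derivative\<close> is determined by the function.\<close>

primrec Ck_on :: "nat \<Rightarrow> ('a::euclidean_space \<Rightarrow> 'b::euclidean_space) \<Rightarrow> 'a set \<Rightarrow> bool" where
  "Ck_on 0 f S \<longleftrightarrow> continuous_on S f"
| "Ck_on (Suc k) f S \<longleftrightarrow>
     (\<forall>x\<in>S. f differentiable (at x)) \<and>
     (\<forall>v. Ck_on k (\<lambda>x. frechet_derivative f (at x) v) S)"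

type_synonym ('p, 'e) chart = "'p set \<times> ('p \<Rightarrow> 'e)"

definition smooth_atlas :: "'p topology \<Rightarrow> ('p, 'e::euclidean_space) chart set \<Rightarrow> bool" where
  "smooth_atlas X A \<longleftrightarrow>
     (\<forall>(U, c)\<in>A. openin X U \<and> open (c ` U) \<and>
        homeomorphic_map (subtopology X U) (top_of_set (c ` U)) c) \<and>
     \<Union> (fst ` A) = topspace X \<and>
     (\<forall>(U, c)\<in>A. \<forall>(V, e)\<in>A. \<forall>k. Ck_on k (e \<circ> inv_into U c) (c ` (U \<inter> V)))"

text \<open>Manifolds are nonempty; second countability is automatic, since a compact space is covered by
  finitely many charts. The dimension is the dimension of the model space \<open>'e\<close>.\<close>

definition closed_manifold :: "'p topology \<Rightarrow> ('p, 'e::euclidean_space) chart set \<Rightarrow> bool" where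
  "closed_manifold X A \<longleftrightarrow>
     smooth_atlas X A \<and> Hausdorff_space X \<and> compact_space X \<and> topspace X \<noteq> {}"

definition Ck_map :: "nat \<Rightarrow> 'p topology \<Rightarrow> ('p, 'e::euclidean_space) chart set \<Rightarrow>
    'q topology \<Rightarrow> ('q, 'f::euclidean_space) chart set \<Rightarrow> ('p \<Rightarrow> 'q) \<Rightarrow> bool" where
  "Ck_map k X A Y B f \<longleftrightarrow>
     continuous_map X Y f \<and>
     (\<forall>(U, c)\<in>A. \<forall>(V, e)\<in>B. Ck_on k (e \<circ> f \<circ> inv_into U c) (c ` {p \<in> U. f p \<in> V}))"

definition C1_diffeo :: "'p topology \<Rightarrow> ('p, 'e::euclidean_space) chart set \<Rightarrow> ('p \<Rightarrow> 'p) \<Rightarrow> bool" where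
  "C1_diffeo X A f \<longleftrightarrow>
     bij_betw f (topspace X) (topspace X) \<and>
     Ck_map 1 X A X A f \<and> Ck_map 1 X A X A (inv_into (topspace X) f)"

definition std_atlas :: "('e, 'e::euclidean_space) chart set" where
  "std_atlas = {(UNIV, id)}"

definition prod_atlas :: "('p, 'e) chart set \<Rightarrow> ('q, 'f) chart set \<Rightarrow> ('p \<times> 'q, 'e \<times> 'f) chart set" where
  "prod_atlas A B = {(U \<times> V, map_prod c e) | U c V e. (U, c) \<in> A \<and> (V, e) \<in> B}"


section \<open>Riemannian metrics\<close>

text \<open>A Riemannian metric is given by its expression in every chart: \<open>g (U, c) p\<close> is the inner product
  on the tangent space at \<open>p\<close>, carried to the model space by the derivative of \<open>c\<close>.\<close>

definition riemannian_metric ::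
  "('p, 'e::euclidean_space) chart set \<Rightarrow> (('p, 'e) chart \<Rightarrow> 'p \<Rightarrow> 'e \<Rightarrow> 'e \<Rightarrow> real) \<Rightarrow> bool" where
  "riemannian_metric A g \<longleftrightarrow>
     (\<forall>(U, c)\<in>A.
        (\<forall>p\<in>U. bilinear (g (U, c) p) \<and>
               (\<forall>v w. g (U, c) p v w = g (U, c) p w v) \<and>
               (\<forall>v. v \<noteq> 0 \<longrightarrow> 0 < g (U, c) p v v)) \<and>
        (\<forall>v w k. Ck_on k (\<lambda>y. g (U, c) (inv_into U c y) v w) (c ` U)) \<and>
        (\<forall>(V, e)\<in>A. \<forall>p\<in>U \<inter> V. \<forall>v w.
           g (U, c) p v w =
           (let D = frechet_derivative (e \<circ> inv_into U c) (at (c p)) in g (V, e) p (D v) (D w))))"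

text \<open>The speed does not depend on the chart chosen around \<open>\<gamma> t\<close>.\<close>

definition speed ::
  "('p, 'e::euclidean_space) chart set \<Rightarrow> (('p, 'e) chart \<Rightarrow> 'p \<Rightarrow> 'e \<Rightarrow> 'e \<Rightarrow> real) \<Rightarrow>
   (real \<Rightarrow> 'p) \<Rightarrow> real \<Rightarrow> real" where
  "speed A g \<gamma> t =
     (let C = (SOME C. C \<in> A \<and> \<gamma> t \<in> fst C);
          v = vector_derivative (snd C \<circ> \<gamma>) (at t)
      in sqrt (g C (\<gamma> t) v v))"

text \<open>The infimum may be taken over \<open>C\<^sup>1\<close> curves instead of piecewise \<open>C\<^sup>1\<close> ones, because no regularity is
  required: a piecewise \<open>C\<^sup>1\<close> curve becomes \<open>C\<^sup>1\<close> when reparametrised so as to stop at its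
  corners. For the same reason the curves may be taken to be defined on the whole line.\<close>

definition riemannian_distance ::
  "'p topology \<Rightarrow> ('p, 'e::euclidean_space) chart set \<Rightarrow>
   (('p, 'e) chart \<Rightarrow> 'p \<Rightarrow> 'e \<Rightarrow> 'e \<Rightarrow> real) \<Rightarrow> 'p \<Rightarrow> 'p \<Rightarrow> real" where
  "riemannian_distance X A g x y =
     Inf {integral {0..1} (speed A g \<gamma>) | \<gamma>.
            Ck_map 1 euclideanreal std_atlas X A \<gamma> \<and> \<gamma> 0 = x \<and> \<gamma> 1 = y}"

text \<open>\<open>d\<close> is a distance function of the Riemannian manifold. Manifolds are not assumed connected; between
  different components, where the Riemannian distance is infinite, \<open>d\<close> is any compatible choice.\<close>

definition riemannian_distance_function ::
  "'p topology \<Rightarrow> ('p, 'e::euclidean_space) chart set \<Rightarrow>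
   (('p, 'e) chart \<Rightarrow> 'p \<Rightarrow> 'e \<Rightarrow> 'e \<Rightarrow> real) \<Rightarrow> ('p \<Rightarrow> 'p \<Rightarrow> real) \<Rightarrow> bool" where
  "riemannian_distance_function X A g d \<longleftrightarrow>
     Metric_space (topspace X) d \<and>
     Metric_space.mtopology (topspace X) d = X \<and>
     (\<forall>x y. path_component_of X x y \<longrightarrow> d x y = riemannian_distance X A g x y)"


section \<open>Flows, expansiveness and entropy\<close>

definition flow :: "'p topology \<Rightarrow> (real \<Rightarrow> 'p \<Rightarrow> 'p) \<Rightarrow> bool" where
  "flow X \<phi> \<longleftrightarrow>
     continuous_map (prod_topology euclideanreal X) X (\<lambda>(t, p). \<phi> t p) \<and>
     (\<forall>p\<in>topspace X. \<phi> 0 p = p \<and> (\<forall>s t. \<phi> (s + t) p = \<phi> s (\<phi> t p)))"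

definition C1_flow ::
  "'p topology \<Rightarrow> ('p, 'e::euclidean_space) chart set \<Rightarrow> (real \<Rightarrow> 'p \<Rightarrow> 'p) \<Rightarrow> bool" where
  "C1_flow X A \<phi> \<longleftrightarrow>
     flow X \<phi> \<and>
     Ck_map 1 (prod_topology euclideanreal X) (prod_atlas std_atlas A) X A (\<lambda>(t, p). \<phi> t p)"

definition Rep :: "(real \<Rightarrow> real) set" where
  "Rep = {h. strict_mono h \<and> (\<exists>k. homeomorphism UNIV UNIV h k) \<and> h 0 = 0}"

definition expansive_flow :: "'p set \<Rightarrow> ('p \<Rightarrow> 'p \<Rightarrow> real) \<Rightarrow> (real \<Rightarrow> 'p \<Rightarrow> 'p) \<Rightarrow> bool" where
  "expansive_flow N d \<phi> \<longleftrightarrow>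
     (\<forall>\<epsilon>>0. \<exists>\<delta>>0. \<forall>x\<in>N. \<forall>y\<in>N. \<forall>h\<in>Rep.
        (\<forall>t. d (\<phi> t x) (\<phi> (h t) y) \<le> \<delta>) \<longrightarrow>
        (\<exists>t0. \<phi> (h t0) y \<in> (\<lambda>s. \<phi> s x) ` {t0 - \<epsilon>..t0 + \<epsilon>}))"

definition separated_set ::
  "'p set \<Rightarrow> ('p \<Rightarrow> 'p \<Rightarrow> real) \<Rightarrow> ('p \<Rightarrow> 'p) \<Rightarrow> nat \<Rightarrow> real \<Rightarrow> 'p set \<Rightarrow> bool" where
  "separated_set N d T n \<epsilon> E \<longleftrightarrow>
     E \<subseteq> N \<and> (\<forall>x\<in>E. \<forall>y\<in>E. x \<noteq> y \<longrightarrow> (\<exists>i<n. \<epsilon> < d ((T ^^ i) x) ((T ^^ i) y)))"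

text \<open>Bowen's definition, for a continuous self-map of a compact metric space; the limit as \<open>\<epsilon>\<close> tends to
  \<open>0\<close> is a supremum by monotonicity.\<close>

definition topological_entropy :: "'p set \<Rightarrow> ('p \<Rightarrow> 'p \<Rightarrow> real) \<Rightarrow> ('p \<Rightarrow> 'p) \<Rightarrow> ereal" where
  "topological_entropy N d T =
     (SUP \<epsilon>\<in>{0<..}. limsup (\<lambda>n.
        SUP E\<in>{E. finite E \<and> E \<noteq> {} \<and> separated_set N d T n \<epsilon> E}.
          ereal (ln (real (card E)) / real n)))"

definition flow_entropy :: "'p set \<Rightarrow> ('p \<Rightarrow> 'p \<Rightarrow> real) \<Rightarrow> (real \<Rightarrow> 'p \<Rightarrow> 'p) \<Rightarrow> ereal" where
  "flow_entropy N d \<phi> = topological_entropy N d (\<phi> 1)"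


section \<open>Suspensions and singular suspensions\<close>

definition strip :: "'a set \<Rightarrow> ('a \<Rightarrow> real) \<Rightarrow> ('a \<times> real) set" where
  "strip M \<rho> = {(x, s). x \<in> M \<and> 0 \<le> s \<and> s \<le> \<rho> x}"

text \<open>The suspension space is characterised up to homeomorphism: \<open>q\<close> is a quotient map from the strip
  whose fibres are the classes of the identification.\<close>

definition suspension_space ::
  "'a topology \<Rightarrow> ('a \<Rightarrow> 'a) \<Rightarrow> ('a \<Rightarrow> real) \<Rightarrow> 'p topology \<Rightarrow> ('a \<times> real \<Rightarrow> 'p) \<Rightarrow> bool" where
  "suspension_space M f \<rho> N q \<longleftrightarrow>
     quotient_map (subtopology (prod_topology M euclideanreal) (strip (topspace M) \<rho>)) N q \<and>
     (\<forall>a\<in>strip (topspace M) \<rho>. \<forall>b\<in>strip (topspace M) \<rho>.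
        q a = q b \<longleftrightarrow>
        equivclp (\<lambda>a b. \<exists>x\<in>topspace M. a = (x, \<rho> x) \<and> b = (f x, 0)) a b)"

text \<open>The following local condition and the flow law determine the suspension flow.\<close>

definition suspension_flow ::
  "'a set \<Rightarrow> ('a \<Rightarrow> real) \<Rightarrow> 'p topology \<Rightarrow> ('a \<times> real \<Rightarrow> 'p) \<Rightarrow> (real \<Rightarrow> 'p \<Rightarrow> 'p) \<Rightarrow> bool" where
  "suspension_flow M \<rho> N q \<phi> \<longleftrightarrow>
     flow N \<phi> \<and>
     (\<forall>x\<in>M. \<forall>s t. 0 \<le> s \<and> s \<le> \<rho> x \<and> 0 \<le> s + t \<and> s + t \<le> \<rho> x \<longrightarrow> \<phi> t (q (x, s)) = q (x, s + t))"

definition velocity :: "(real \<Rightarrow> 'p \<Rightarrow> 'p) \<Rightarrow> ('p, 'e::euclidean_space) chart \<Rightarrow> 'p \<Rightarrow> 'e" where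
  "velocity \<phi> C p = vector_derivative (\<lambda>t. snd C (\<phi> t p)) (at 0)"

definition has_velocity_field ::
  "'p topology \<Rightarrow> ('p, 'e::euclidean_space) chart set \<Rightarrow> (real \<Rightarrow> 'p \<Rightarrow> 'p) \<Rightarrow> bool" where
  "has_velocity_field N A \<phi> \<longleftrightarrow>
     (\<forall>(U, c)\<in>A.
        (\<forall>p\<in>U. (\<lambda>t. c (\<phi> t p)) differentiable (at 0)) \<and>
        continuous_map (subtopology N U) euclidean (velocity \<phi> (U, c)))"

text \<open>As the roof function is only continuous, the product structure of the strip does not induce a smooth
  structure on the quotient: the change of coordinates across the roof, \<open>(x, s) \<mapsto> (f x, s - \<rho> x)\<close>, is only
  continuous. So the smooth structure of the suspension manifold is part of the data. It induces the
  quotient topology, and it is compatible with the construction in that the suspension flow has a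
  continuous, nowhere vanishing velocity field, to which the base is \<open>C\<^sup>1\<close> embedded
  as a transverse section. (If \<open>\<rho>\<close> is \<open>C\<^sup>1\<close>, any smooth structure that makes
  \<open>(x, s) \<mapsto> \<phi> s (q (x, 0))\<close> a local \<open>C\<^sup>1\<close> diffeomorphism qualifies.)\<close>

definition suspension_manifold ::
  "'a topology \<Rightarrow> ('a, 'm::euclidean_space) chart set \<Rightarrow> ('a \<Rightarrow> 'a) \<Rightarrow> ('a \<Rightarrow> real) \<Rightarrow>
   'p topology \<Rightarrow> ('p, 'e::euclidean_space) chart set \<Rightarrow> ('a \<times> real \<Rightarrow> 'p) \<Rightarrow>
   (real \<Rightarrow> 'p \<Rightarrow> 'p) \<Rightarrow> bool" where
  "suspension_manifold M B f \<rho> N A q \<phi> \<longleftrightarrow>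
     closed_manifold N A \<and>
     suspension_space M f \<rho> N q \<and>
     suspension_flow (topspace M) \<rho> N q \<phi> \<and>
     has_velocity_field N A \<phi> \<and>
     (\<forall>C\<in>A. \<forall>p\<in>fst C. velocity \<phi> C p \<noteq> 0) \<and>
     Ck_map 1 M B N A (\<lambda>x. q (x, 0)) \<and>
     (\<forall>(U, c)\<in>B. \<forall>(V, e)\<in>A. \<forall>x\<in>U. q (x, 0) \<in> V \<longrightarrow>
        (let D = frechet_derivative (\<lambda>y. e (q (inv_into U c y, 0))) (at (c x))
         in inj D \<and> velocity \<phi> (V, e) (q (x, 0)) \<notin> range D))"

definition brake ::
  "'p topology \<Rightarrow> ('p, 'e::euclidean_space) chart set \<Rightarrow> 'p set \<Rightarrow> ('p \<Rightarrow> real) \<Rightarrow> bool" where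
  "brake N A S \<alpha> \<longleftrightarrow>
     (\<forall>k. Ck_map k N A euclideanreal std_atlas \<alpha>) \<and>
     (\<forall>p\<in>topspace N. 0 \<le> \<alpha> p \<and> (\<alpha> p = 0 \<longleftrightarrow> p \<in> S))"

definition singular_suspension ::
  "'a topology \<Rightarrow> ('a, 'm::euclidean_space) chart set \<Rightarrow> ('a \<Rightarrow> 'a) \<Rightarrow>
   'p topology \<Rightarrow> ('p, 'e::euclidean_space) chart set \<Rightarrow> (real \<Rightarrow> 'p \<Rightarrow> 'p) \<Rightarrow> bool" where
  "singular_suspension M B f N A \<psi> \<longleftrightarrow>
     (\<exists>\<rho> q \<phi> S \<alpha>.
        continuous_map M euclideanreal \<rho> \<and> (\<forall>x\<in>topspace M. 0 < \<rho> x) \<and>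
        suspension_manifold M B f \<rho> N A q \<phi> \<and>
        compactin N S \<and> brake N A S \<alpha> \<and>
        flow N \<psi> \<and>
        (\<forall>p\<in>topspace N. \<forall>t. \<forall>(U, c)\<in>A. \<psi> t p \<in> U \<longrightarrow>
           ((\<lambda>s. c (\<psi> s p)) has_vector_derivative
              \<alpha> (\<psi> t p) *\<^sub>R velocity \<phi> (U, c) (\<psi> t p)) (at t)))"

end

theory Submission
  imports Defs "HOL-Probability.Discrete_Topology"
begin

text \<open>Points of \<open>S\<close> are fixed by \<open>\<psi>\<close>, so \<open>S\<close> is finite by expansiveness, and only finitely many points \<open>P\<close> of the
  base lie under \<open>S\<close>. Since \<open>\<psi>\<close> is \<open>C\<^sup>1\<close>, its orbits that avoid \<open>S\<close> are reparametrised orbits of the suspension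
  flow. If two points of the base whose \<open>f\<close>-orbits avoid \<open>P\<close> shadow each other under \<open>f\<close>, then their \<open>\<psi>\<close>-orbits
  shadow each other up to a reparametrisation, so they lie on one orbit; as nondegenerate continua are
  uncountable and the exceptional points countable, \<open>f\<close> is continuum-wise expansive.

  By Kato's argument some nondegenerate continuum then has small diameter in the past (or in the future), and its images
  grow until they contain two disjoint continua of a definite size, which yields a binary tree of
  separated orbits. Travel times are unbounded near \<open>P\<close>, so each continuum is trimmed on the way to stay
  away from \<open>P\<close>: a trimming delays its growth by at most a constant \<open>K0\<close>, and small continua need at
  most one trimming in \<open>K0 + 1\<close> steps. The \<open>2^k\<close> orbits found at depth \<open>k\<close> are therefore separated by \<open>\<psi>\<close> in
  time linear in \<open>k\<close>.\<close>

section \<open>Continuum-wise expansive homeomorphisms\<close>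

text \<open>Shadowing arguments say nothing about a pair that contains a point whose base orbit
  meets \<open>P\<close>, because its \<open>\<psi>\<close>-orbit is not a complete suspension
  orbit. So only a property of continua, which tolerates a countable set of exceptions, can be
  derived for the base map. Positive entropy of the base map would not be enough by itself, since
  \<open>n\<close> base steps may take \<open>\<psi>\<close> arbitrarily long; the tree must carry a
  history, namely a uniform distance from \<open>P\<close> at all steps before the one at which two
  points separate.

  The constants are chosen in an order that avoids circularity. The delay \<open>K0\<close> depends
  on \<open>e\<close> alone. It determines the finite set \<open>Q\<close> of points that reach
  \<open>P\<close> within \<open>K0\<close> steps, and the gaps of \<open>Q\<close> determine the
  working scale \<open>s\<close>. The bound \<open>Tm\<close> for exit times depends on
  \<open>s\<close>, and the radius \<open>r\<close> of the trimmed balls comes after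
  \<open>Tm\<close>.\<close>

text \<open>\<open>thin 0 C\<close> says that \<open>C\<close> has at most one point, so its
  negation is nondegeneracy. Stated by pairs of points, the notion needs neither boundedness nor
  nonemptiness.\<close>

definition thin :: "real \<Rightarrow> 'k::metric_space set \<Rightarrow> bool" where
  "thin e C \<longleftrightarrow> (\<forall>x\<in>C. \<forall>y\<in>C. dist x y \<le> e)"

lemma thin_mono: "thin e C \<Longrightarrow> e \<le> e' \<Longrightarrow> thin e' C"
  by (force simp: thin_def)

lemma not_thinE:
  assumes "\<not> thin e C"
  obtains x y where "x \<in> C" "y \<in> C" "dist x y > e"
  using assms unfolding thin_def not_le[symmetric] by blast

lemma not_thinI: "x \<in> C \<Longrightarrow> y \<in> C \<Longrightarrow> dist x y > e \<Longrightarrow> \<not> thin e C"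
  unfolding thin_def not_le[symmetric] by blast

lemma thin_subset: "thin e C \<Longrightarrow> C' \<subseteq> C \<Longrightarrow> thin e C'"
  by (auto simp: thin_def)

section \<open>Boundary bumping and limits of continua\<close>

text \<open>The witness is the component of \<open>x\<close> in \<open>C - V\<close>. A component of
  a proper closed subset of a continuum meets the frontier of that subset, and the frontier of
  \<open>C - V\<close> lies in the closure of \<open>C \<inter> V\<close>. So a continuum can be
  trimmed and still touch the part that was removed.\<close>

lemma boundary_bump:
  fixes C :: "'k::metric_space set"
  assumes C: "compact C" "connected C" and V: "open V" "C \<inter> V \<noteq> {}" and x: "x \<in> C" "x \<notin> V"
  obtains C' where "compact C'" "connected C'" "C' \<subseteq> C - V" "x \<in> C'" "C' \<inter> closure (C \<inter> V) \<noteq> {}"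
proof -
  let ?X = "top_of_set C" and ?S = "C - V"
  let ?C' = "connected_component_of_set (subtopology ?X ?S) x"
  have xS: "x \<in> ?S" using x by auto
  have sub: "subtopology ?X ?S = top_of_set ?S"
    by (simp add: subtopology_subtopology Int_absorb1)
  have comp: "?C' \<in> connected_components_of (subtopology ?X ?S)"
    using xS by (simp add: connected_component_in_connected_components_of)
  have cl: "closedin ?X ?S"
    using V(1) by (metis closedin_closed_Int Diff_eq open_closed)
  have ne: "?S \<noteq> topspace ?X" using V(2) by auto
  have "?C' \<inter> ?X frontier_of ?S \<noteq> {}"
    by (rule boundary_bumping_theorem_closed[OF _ _ _ cl ne comp])
       (use C in \<open>auto simp: connected_space_subtopology compact_space_subtopology Hausdorff_space_subtopology\<close>)
  moreover have "?X frontier_of ?S \<subseteq> closure (C \<inter> V)"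
  proof -
    have "?X frontier_of ?S \<subseteq> ?X closure_of (topspace ?X - ?S)"
      by (simp add: frontier_of_closures)
    also have "topspace ?X - ?S = C \<inter> V" by auto
    also have "?X closure_of (C \<inter> V) \<subseteq> closure (C \<inter> V)"
      by (metis euclidean_closure_of closure_of_subtopology_subset)
    finally show ?thesis .
  qed
  ultimately have 1: "?C' \<inter> closure (C \<inter> V) \<noteq> {}" by blast
  have 2: "?C' \<subseteq> ?S"
    using connected_component_of_subset_topspace[of "subtopology ?X ?S" x] by auto
  have "connectedin (subtopology ?X ?S) ?C'"
    by (rule connectedin_connected_component_of)
  then have 3: "connected ?C'" by (simp add: sub connectedin_subtopology)
  have "closedin (subtopology ?X ?S) ?C'"
    by (rule closedin_connected_component_of)
  then have "closedin (top_of_set ?S) ?C'" by (simp add: sub)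
  moreover have "compact ?S" using C V by (simp add: compact_diff)
  ultimately have 4: "compact ?C'" using closedin_compact by blast
  have 5: "x \<in> ?C'" using xS by (simp add: connected_component_of_refl)
  show ?thesis using that[OF 4 3 2 5 1] .
qed

text \<open>Boundary bumping with the outside of the closed ball as the removed set: the component
  of \<open>x\<close> in the ball has to reach distance \<open>\<rho>\<close>, so the piece is small
  and yet has a definite size.\<close>

lemma small_subcontinuum:
  fixes C :: "'k::metric_space set"
  assumes C: "compact C" "connected C" and xy: "x \<in> C" "y \<in> C" "dist x y > \<rho>" and \<rho>: "\<rho> > 0"
  obtains C' w where "compact C'" "connected C'" "C' \<subseteq> C" "x \<in> C'" "C' \<subseteq> cball x \<rho>" "w \<in> C'" "dist x w \<ge> \<rho>"
proof -
  obtain C' where C': "compact C'" "connected C'" "C' \<subseteq> C - (- cball x \<rho>)" "x \<in> C'"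
      "C' \<inter> closure (C \<inter> - cball x \<rho>) \<noteq> {}"
    by (rule boundary_bump[OF C, of "- cball x \<rho>" x]) (use xy \<rho> in auto)
  then obtain w where w: "w \<in> C'" "w \<in> closure (C \<inter> - cball x \<rho>)" by blast
  have "closure (C \<inter> - cball x \<rho>) \<subseteq> - ball x \<rho>"
    by (rule closure_minimal) (auto simp: closed_def)
  then have "dist x w \<ge> \<rho>" using w by auto
  with C' w show ?thesis by (intro that[of C' w]) auto
qed

text \<open>\<open>D\<close> is the topological upper limit of the sequence. Such a limit may be
  disconnected in general; the convergence of \<open>a\<close> prevents this. If closed sets split
  \<open>D\<close>, disjoint neighbourhoods of the two parts contain almost all \<open>C n\<close>,
  and connectedness puts each \<open>C n\<close> on the side of \<open>a n\<close>, hence of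
  \<open>x\<close>; but points of \<open>D\<close> on the other side are approached by infinitely
  many \<open>C n\<close>.\<close>

lemma compact_limit_continuum:
  fixes C :: "nat \<Rightarrow> 'k::metric_space set"
  assumes K: "compact K" and C: "\<And>n. connected (C n)" "\<And>n. C n \<subseteq> K"
    and ab: "\<And>n. a n \<in> C n" "\<And>n. b n \<in> C n" "a \<longlonglongrightarrow> x" "b \<longlonglongrightarrow> y"
  obtains D where "compact D" "connected D" "D \<subseteq> K" "x \<in> D" "y \<in> D"
    "\<And>d. d \<in> D \<Longrightarrow> (\<forall>\<epsilon>>0. \<exists>\<^sub>F n in sequentially. \<exists>c\<in>C n. dist c d < \<epsilon>)"
proof -
  define D where "D = (\<Inter>m. closure (\<Union>n\<in>{m..}. C n))"
  have Dcl: "closed D" by (auto simp: D_def)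
  have DK: "D \<subseteq> K"
  proof -
    have "closure (\<Union>n\<in>{0..}. C n) \<subseteq> K"
      by (rule closure_minimal) (use C K compact_imp_closed in auto)
    then show ?thesis unfolding D_def by blast
  qed
  then have Dc: "compact D" using Dcl K by (metis compact_Int_closed inf.absorb_iff2)
  have lim: "z \<in> D" if "c \<longlonglongrightarrow> z" "\<And>n. c n \<in> C n" for c z
  proof -
    have "z \<in> closure (\<Union>n\<in>{m..}. C n)" for m
    proof (rule Lim_in_closed_set[OF closed_closure _ _ that(1)])
      show "\<forall>\<^sub>F n in sequentially. c n \<in> closure (\<Union>n\<in>{m..}. C n)"
        using eventually_ge_at_top[of m] by eventually_elim (use that(2) closure_subset in force)
    qed auto
    then show ?thesis by (auto simp: D_def)
  qed
  have freq: "\<exists>\<^sub>F n in sequentially. \<exists>c\<in>C n. dist c d < \<epsilon>" if "d \<in> D" "\<epsilon> > 0" for d \<epsilon>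
    unfolding frequently_sequentially
  proof
    fix m
    have "d \<in> closure (\<Union>n\<in>{m..}. C n)" using that by (auto simp: D_def)
    then show "\<exists>n\<ge>m. \<exists>c\<in>C n. dist c d < \<epsilon>"
      using that(2) unfolding closure_approachable by fastforce
  qed
  have "connected D"
  proof (rule ccontr)
    assume "\<not> connected D"
    then obtain A B where AB: "closed A" "closed B" "D \<subseteq> A \<union> B" "A \<inter> B \<inter> D = {}"
       "A \<inter> D \<noteq> {}" "B \<inter> D \<noteq> {}"
      unfolding connected_closed by blast
    have cAB: "compact (A \<inter> D)" "compact (B \<inter> D)" using AB Dc by (auto intro: closed_Int_compact)
    define U where "U = {z. infdist z (A \<inter> D) < infdist z (B \<inter> D)}"
    define V where "V = {z. infdist z (B \<inter> D) < infdist z (A \<inter> D)}"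
    have UV: "open U" "open V" unfolding U_def V_def
      by (intro open_Collect_less continuous_intros)+
    have dj: "U \<inter> V = {}" by (auto simp: U_def V_def)
    have clAB: "closed (A \<inter> D)" "closed (B \<inter> D)" using AB Dcl by auto
    have AU: "A \<inter> D \<subseteq> U"
    proof
      fix z assume z: "z \<in> A \<inter> D"
      then have "z \<notin> B \<inter> D" using AB by auto
      then have "infdist z (B \<inter> D) > 0" using clAB AB(6)
        by (simp add: infdist_pos_not_in_closed)
      then show "z \<in> U" using z by (simp add: U_def)
    qed
    have BV: "B \<inter> D \<subseteq> V"
    proof
      fix z assume z: "z \<in> B \<inter> D"
      then have "z \<notin> A \<inter> D" using AB by auto
      then have "infdist z (A \<inter> D) > 0" using clAB AB(5)
        by (simp add: infdist_pos_not_in_closed)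
      then show "z \<in> V" using z by (simp add: V_def)
    qed
    have DUV: "D \<subseteq> U \<union> V" using AU BV AB(3) by auto
    \<comment> \<open>Otherwise points of infinitely many \<open>C n\<close> outside
      \<open>U \<union> V\<close> would accumulate, by compactness of \<open>K\<close>, at a point
      of \<open>D\<close> outside \<open>U \<union> V\<close>.\<close>
    have ev: "\<forall>\<^sub>F n in sequentially. C n \<subseteq> U \<union> V"
    proof (rule ccontr)
      assume "\<not> ?thesis"
      then have "\<exists>\<^sub>F n in sequentially. \<exists>c\<in>C n. c \<notin> U \<union> V"
        by (auto simp: not_eventually subset_iff elim!: frequently_mono[rotated])
      then have "\<forall>m. \<exists>n>m. \<exists>c\<in>C n. c \<notin> U \<union> V"
        unfolding frequently_sequentially by (meson Suc_le_lessD)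
      then obtain c where c: "\<And>m. \<exists>n>m. c m \<in> C n \<and> c m \<notin> U \<union> V" by metis
      then have "\<And>m. c m \<in> K" using C by blast
      then obtain l r where l: "l \<in> K" "strict_mono r" "(c \<circ> r) \<longlonglongrightarrow> l"
        using K unfolding compact_def by meson
      have "l \<in> D" unfolding D_def
      proof
        fix m
        show "l \<in> closure (\<Union>n\<in>{m..}. C n)"
        proof (rule Lim_in_closed_set[OF closed_closure _ _ l(3)])
          show "\<forall>\<^sub>F n in sequentially. (c \<circ> r) n \<in> closure (\<Union>n\<in>{m..}. C n)"
            using eventually_ge_at_top[of m]
          proof eventually_elim
            case (elim n)
            obtain n' where "n' > r n" "c (r n) \<in> C n'" using c by blast
            moreover have "r n \<ge> n" using l(2) by (rule strict_mono_imp_increasing)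
            ultimately have "c (r n) \<in> (\<Union>n\<in>{m..}. C n)" using elim by auto
            then show ?case using closure_subset by (metis comp_apply subsetD)
          qed
        qed auto
      qed
      moreover have "l \<in> - (U \<union> V)"
        by (rule Lim_in_closed_set[OF _ _ _ l(3)]) (use UV c in \<open>auto simp: closed_def intro!: always_eventually\<close>)
      ultimately show False using DUV by auto
    qed
    have xD: "x \<in> D" using lim ab by blast
    have side: False if side_hyps: "x \<in> U'" "V' \<inter> D \<noteq> {}" "open U'" "open V'" "U' \<inter> V' = {}"
       "\<forall>\<^sub>F n in sequentially. C n \<subseteq> U' \<union> V'" for U' V'
    proof -
      have "\<forall>\<^sub>F n in sequentially. a n \<in> U'"
        using topological_tendstoD[OF ab(3) side_hyps(3,1)] .
      with side_hyps(6) have *: "\<forall>\<^sub>F n in sequentially. C n \<inter> V' = {}"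
      proof eventually_elim
        case (elim n)
        show ?case
        proof (rule ccontr)
          assume "C n \<inter> V' \<noteq> {}"
          moreover have "C n \<inter> U' \<noteq> {}" using elim ab(1) by blast
          ultimately show False
            using C(1)[of n] side_hyps(3-5) elim unfolding connected_def by blast
        qed
      qed
      obtain d where d: "d \<in> V'" "d \<in> D" using side_hyps(2) by blast
      then obtain \<epsilon> where \<epsilon>: "\<epsilon> > 0" "ball d \<epsilon> \<subseteq> V'" using side_hyps(4) openE by blast
      have "\<exists>\<^sub>F n in sequentially. (\<exists>c\<in>C n. dist c d < \<epsilon>) \<and> C n \<inter> V' = {}"
        using freq[OF d(2) \<epsilon>(1)]
        by (rule frequently_rev_mp) (use * in eventually_elim, auto)
      then obtain n c where "c \<in> C n" "dist c d < \<epsilon>" "C n \<inter> V' = {}"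
        by (auto dest!: frequently_ex)
      then show False using \<epsilon>(2) by (auto simp: dist_commute subset_iff)
    qed
    show False
    proof (cases "x \<in> U")
      case True
      then show ?thesis using side[OF True _ UV dj ev] BV AB(6) by blast
    next
      case False
      then have "x \<in> V" using xD DUV by auto
      moreover have "\<forall>\<^sub>F n in sequentially. C n \<subseteq> V \<union> U" using ev by (simp add: Un_commute)
      ultimately show ?thesis using side[of V U] UV dj AU AB(5) by blast
    qed
  qed
  then show ?thesis
    using that[OF Dc _ DK] lim ab freq by blast
qed

section \<open>Iterates of a homeomorphism of a compact set\<close>

locale compact_homeo =
  fixes K :: "'k::metric_space set" and F G :: "'k \<Rightarrow> 'k"
  assumes compact_K: "compact K" and homeo: "homeomorphism K K F G"
begin

lemma F_in: "x \<in> K \<Longrightarrow> F x \<in> K" and G_in: "x \<in> K \<Longrightarrow> G x \<in> K"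
  and GF: "x \<in> K \<Longrightarrow> G (F x) = x" and FG: "x \<in> K \<Longrightarrow> F (G x) = x"
  using homeo by (auto simp: homeomorphism_def)

lemma Fn_in: "x \<in> K \<Longrightarrow> (F ^^ n) x \<in> K" and Gn_in: "x \<in> K \<Longrightarrow> (G ^^ n) x \<in> K"
  by (induction n) (auto simp: F_in G_in)

lemma cont_Fn: "continuous_on K (F ^^ n)"
proof (induction n)
  case (Suc n)
  have "continuous_on K (F \<circ> (F ^^ n))"
    by (rule continuous_on_compose[OF Suc continuous_on_subset])
       (use homeo Fn_in in \<open>auto simp: homeomorphism_def\<close>)
  then show ?case by simp
qed auto

lemma GnFn: "x \<in> K \<Longrightarrow> (G ^^ n) ((F ^^ n) x) = x"
proof (induction n arbitrary: x)
  case (Suc n)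
  then show ?case by (simp add: funpow_swap1 [of F] F_in GF)
qed auto

lemma swap: "compact_homeo K G F"
  using compact_K homeo by (simp add: compact_homeo_def homeomorphism_symD)

lemma FnGn: "x \<in> K \<Longrightarrow> (F ^^ n) ((G ^^ n) x) = x"
  by (rule compact_homeo.GnFn[OF swap])

lemma cont_Gn: "continuous_on K (G ^^ n)"
  by (rule compact_homeo.cont_Fn[OF swap])

lemma GmFn: "x \<in> K \<Longrightarrow> (G ^^ m) ((F ^^ n) x) = (if m \<le> n then (F ^^ (n - m)) x else (G ^^ (m - n)) x)"
proof (cases "m \<le> n")
  case True
  assume x: "x \<in> K"
  have "(F ^^ n) x = (F ^^ m) ((F ^^ (n - m)) x)"
    using True by (metis comp_apply funpow_add le_add_diff_inverse)
  then show ?thesis using True x by (simp add: GnFn Fn_in)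
next
  case False
  assume x: "x \<in> K"
  have "(G ^^ m) y = (G ^^ (m - n)) ((G ^^ n) y)" for y
    using False by (metis comp_apply funpow_add le_add_diff_inverse2 nat_le_linear)
  then show ?thesis using False x by (simp add: GnFn)
qed

definition continuum :: "'k set \<Rightarrow> bool" where
  "continuum C \<longleftrightarrow> compact C \<and> connected C \<and> C \<subseteq> K"

lemma continuum_Fn: "continuum C \<Longrightarrow> continuum ((F ^^ n) ` C)"
  using cont_Fn Fn_in unfolding continuum_def
  by (metis (no_types, lifting) compact_continuous_image connected_continuous_image
      continuous_on_subset image_subset_iff subsetD)

lemma continuum_Gn: "continuum C \<Longrightarrow> continuum ((G ^^ n) ` C)"
  using compact_homeo.continuum_Fn[OF swap] compact_homeo.continuum_def[OF swap] continuum_def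
  by blast

text \<open>The sets come near \<open>d\<close> for infinitely many \<open>n\<close> only, but
  \<open>a n\<close> is near \<open>x\<close> for almost all \<open>n\<close>. So some
  \<open>n\<close> serves both purposes, and by continuity of \<open>g\<close> the error is as small
  as desired.\<close>

lemma thin_limit:
  assumes D: "d \<in> K" "x \<in> K" and C: "\<And>n. C n \<subseteq> K" and g: "continuous_on K g"
    and lim: "\<forall>\<epsilon>>0. \<exists>\<^sub>F n in sequentially. \<exists>c\<in>C n. dist c d < \<epsilon>"
    and a: "\<And>n. a n \<in> C n" "a \<longlonglongrightarrow> x"
    and thin: "\<forall>\<^sub>F n in sequentially. thin e (g ` C n)"
  shows "dist (g d) (g x) \<le> e"
proof (rule field_le_epsilon)
  fix \<epsilon> :: real assume "\<epsilon> > 0"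
  then have "\<epsilon> / 2 > 0" by simp
  then obtain \<delta> where \<delta>: "\<delta> > 0" "\<And>c. c \<in> K \<Longrightarrow> dist c d < \<delta> \<Longrightarrow> dist (g c) (g d) < \<epsilon> / 2"
    using g D unfolding continuous_on_iff by metis
  have "(\<lambda>n. g (a n)) \<longlonglongrightarrow> g x"
    using g D a C unfolding continuous_on_sequentially comp_def by blast
  then have ev: "\<forall>\<^sub>F n in sequentially. dist (g (a n)) (g x) < \<epsilon> / 2"
    using \<open>\<epsilon> / 2 > 0\<close> by (rule tendstoD)
  from lim \<delta>(1) have "\<exists>\<^sub>F n in sequentially. \<exists>c\<in>C n. dist c d < \<delta>" by blast
  from frequently_eventually_conj[OF this eventually_conj[OF ev thin]]
  obtain n c where n: "c \<in> C n" "dist c d < \<delta>" "dist (g (a n)) (g x) < \<epsilon> / 2" "thin e (g ` C n)"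
    by (auto dest!: frequently_ex)
  have "dist (g c) (g d) < \<epsilon> / 2" using \<delta>(2) n C by blast
  moreover have "dist (g c) (g (a n)) \<le> e" using n a(1)[of n] unfolding thin_def by blast
  ultimately show "dist (g d) (g x) \<le> e + \<epsilon>"
    using n(3) dist_triangle[of "g d" "g x" "g (a n)"] dist_triangle[of "g d" "g (a n)" "g c"]
    by (simp add: dist_commute)
qed

text \<open>Only the limit of the base points \<open>a n\<close> is attained along the whole sequence, hence the factor 2.\<close>

lemma compact_limit_thin:
  assumes C: "\<And>n. continuum (C n)" "\<And>n. \<not> thin \<eta> (C n)" and \<eta>: "\<eta> > 0"
  obtains D where "continuum D" "\<not> thin 0 D"
    "\<And>(g :: 'k \<Rightarrow> 'k) e. continuous_on K g \<Longrightarrow> \<forall>\<^sub>F n in sequentially. thin e (g ` C n) \<Longrightarrow> thin (2 * e) (g ` D)"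
proof -
  have "\<forall>n. \<exists>a b. a \<in> C n \<and> b \<in> C n \<and> dist a b > \<eta>"
    by (meson C(2) not_thinE)
  then obtain a b where ab: "\<And>n. a n \<in> C n" "\<And>n. b n \<in> C n" "\<And>n. dist (a n) (b n) > \<eta>"
    by metis
  have CK: "C n \<subseteq> K" for n using C(1) by (auto simp: continuum_def)
  have "a n \<in> K" "b n \<in> K" for n using ab CK by blast+
  then have "\<And>n. (a n, b n) \<in> K \<times> K" by auto
  moreover have "compact (K \<times> K)" by (intro compact_Times compact_K)
  ultimately obtain l r where l: "l \<in> K \<times> K" "strict_mono (r :: nat \<Rightarrow> nat)" "((\<lambda>n. (a n, b n)) \<circ> r) \<longlonglongrightarrow> l"
    using seq_compactE[of "K \<times> K" "\<lambda>n. (a n, b n)"] compact_imp_seq_compact by metis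
  obtain x y where xy: "l = (x, y)" by fastforce
  have lim: "(a \<circ> r) \<longlonglongrightarrow> x" "(b \<circ> r) \<longlonglongrightarrow> y"
    using tendsto_fst[OF l(3)] tendsto_snd[OF l(3)] by (simp_all add: xy comp_def)
  obtain D where D: "compact D" "connected D" "D \<subseteq> K" "x \<in> D" "y \<in> D"
    "\<And>d. d \<in> D \<Longrightarrow> (\<forall>\<epsilon>>0. \<exists>\<^sub>F n in sequentially. \<exists>c\<in>(C \<circ> r) n. dist c d < \<epsilon>)"
    by (rule compact_limit_continuum[OF compact_K, of "C \<circ> r" "a \<circ> r" "b \<circ> r" x y])
       (use C CK ab lim in \<open>auto simp: continuum_def\<close>)
  have "(\<lambda>n. dist ((a \<circ> r) n) ((b \<circ> r) n)) \<longlonglongrightarrow> dist x y"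
    by (rule tendsto_dist[OF lim])
  then have "dist x y \<ge> \<eta>"
    by (rule Lim_bounded2[where N = 0]) (use ab in \<open>auto intro: less_imp_le\<close>)
  then have ne: "\<not> thin 0 D" using not_thinI[of x D y 0] D(4,5) \<eta> by linarith
  show ?thesis
  proof (rule that[OF _ ne])
    show "continuum D" using D by (simp add: continuum_def)
    fix g :: "'k \<Rightarrow> 'k" and e
    assume g: "continuous_on K g" and ev: "\<forall>\<^sub>F n in sequentially. thin e (g ` C n)"
    have "\<forall>\<^sub>F n in sequentially. thin e (g ` (C \<circ> r) n)"
      using eventually_subseq[OF l(2) ev] by simp
    then have *: "dist (g d) (g x) \<le> e" if "d \<in> D" for d
      using thin_limit[of d x "C \<circ> r" g "a \<circ> r" e] that D CK g ab lim by auto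
    show "thin (2 * e) (g ` D)"
      unfolding thin_def
    proof (intro ballI, elim imageE, simp)
      fix u v assume "u \<in> D" "v \<in> D"
      then show "dist (g u) (g v) \<le> 2 * e"
        using *[of u] *[of v] dist_triangle2[of "g u" "g v" "g x"] by simp
    qed
  qed
qed

section \<open>Continua that are small in the past\<close>

text \<open>The counterpart of a piece of a local unstable manifold. The case \<open>n = 0\<close>
  makes \<open>C\<close> itself \<open>e\<close>-thin.\<close>

definition unstable :: "real \<Rightarrow> 'k set \<Rightarrow> bool" where
  "unstable e C \<longleftrightarrow> continuum C \<and> (\<forall>n. thin e ((G ^^ n) ` C))"

lemma unstable_subset:
  "unstable e C \<Longrightarrow> compact C' \<Longrightarrow> connected C' \<Longrightarrow> C' \<subseteq> C \<Longrightarrow> unstable e C'"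
  unfolding unstable_def continuum_def by (meson image_mono subset_trans thin_subset)

lemma unstable_Fn:
  assumes "unstable e C" "\<And>j. j \<le> t \<Longrightarrow> thin e ((F ^^ j) ` C)"
  shows "unstable e ((F ^^ t) ` C)"
proof -
  have CK: "C \<subseteq> K" using assms by (auto simp: unstable_def continuum_def)
  have "thin e ((G ^^ n) ` (F ^^ t) ` C)" for n
  proof -
    have "(G ^^ n) ` (F ^^ t) ` C = (if n \<le> t then F ^^ (t - n) else G ^^ (n - t)) ` C"
      unfolding image_image using CK by (intro image_cong refl) (simp add: GmFn subset_iff)
    then show ?thesis using assms by (simp add: unstable_def)
  qed
  then show ?thesis using assms by (simp add: unstable_def continuum_Fn)
qed

text \<open>Compactness: continua that are not \<open>\<eta>\<close>-thin but stay
  \<open>e\<close>-thin for longer and longer times would accumulate on a nondegenerate continuum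
  whose whole two-sided orbit is \<open>2 * e\<close>-thin, against \<open>cw\<close>. The doubling
  is the loss in \<open>compact_limit_thin\<close>; it is the reason for taking \<open>e\<close> as
  half of an expansivity constant later.\<close>

lemma exit_time_uniform:
  assumes cw: "\<And>C. continuum C \<Longrightarrow> (\<And>n. thin (2 * e) ((F ^^ n) ` C)) \<Longrightarrow>
      (\<And>n. thin (2 * e) ((G ^^ n) ` C)) \<Longrightarrow> thin 0 C"
    and \<eta>: "\<eta> > 0"
  shows "\<exists>N. \<forall>C. unstable e C \<longrightarrow> \<not> thin \<eta> C \<longrightarrow> (\<exists>n\<le>N. \<not> thin e ((F ^^ n) ` C))"
proof (rule ccontr)
  assume "\<not> ?thesis"
  then have "\<forall>N. \<exists>C. unstable e C \<and> \<not> thin \<eta> C \<and> (\<forall>n\<le>N. thin e ((F ^^ n) ` C))" by blast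
  then obtain C where C: "\<And>N. unstable e (C N)" "\<And>N. \<not> thin \<eta> (C N)"
      "\<And>N n. n \<le> N \<Longrightarrow> thin e ((F ^^ n) ` C N)" by metis
  obtain D where D: "continuum D" "\<not> thin 0 D"
    "\<And>(g :: 'k \<Rightarrow> 'k) e. continuous_on K g \<Longrightarrow> \<forall>\<^sub>F n in sequentially. thin e (g ` C n) \<Longrightarrow> thin (2 * e) (g ` D)"
    by (rule compact_limit_thin[of C \<eta>]) (use C \<eta> in \<open>auto simp: unstable_def\<close>)
  have "thin (2 * e) ((F ^^ n) ` D)" for n
    by (rule D(3)[OF cont_Fn], rule eventually_sequentiallyI[of n], rule C)
  moreover have "thin (2 * e) ((G ^^ n) ` D)" for n
    by (rule D(3)[OF cont_Gn]) (use C(1) in \<open>auto simp: unstable_def intro: always_eventually\<close>)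
  ultimately show False using cw D by blast
qed

text \<open>If no continuum is thin in its whole future, smaller and smaller pieces
  \<open>A k\<close> of \<open>C0\<close> around \<open>x\<close> all outgrow the size
  \<open>e/2\<close>, at times \<open>\<tau> k\<close> that tend to infinity. Their images at these
  times have a definite size and a thin past of growing length, so they accumulate on a
  nondegenerate continuum with a thin past.\<close>

lemma unstable_or_stable_exists:
  assumes e: "e > 0" and C0: "continuum C0" "\<not> thin 0 C0"
  shows "(\<exists>C. unstable e C \<and> \<not> thin 0 C) \<or> (\<exists>C. continuum C \<and> \<not> thin 0 C \<and> (\<forall>n. thin e ((F ^^ n) ` C)))"
proof (rule disjCI)
  assume ns: "\<not> (\<exists>C. continuum C \<and> \<not> thin 0 C \<and> (\<forall>n. thin e ((F ^^ n) ` C)))"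
  obtain x y where xy: "x \<in> C0" "y \<in> C0" "dist x y > 0" 
    using C0(2) unfolding thin_def not_le[symmetric] by blast
  have xK: "x \<in> K" using xy C0 by (auto simp: continuum_def)
  have "\<exists>A. continuum A \<and> \<not> thin 0 A \<and> (\<forall>i\<le>k. thin (e/2) ((F ^^ i) ` A))" for k
  proof -
    have "\<forall>i. \<exists>\<delta>>0. \<forall>y\<in>K. dist y x < \<delta> \<longrightarrow> dist ((F ^^ i) y) ((F ^^ i) x) < e / 4"
    proof
      fix i
      have "e / 4 > 0" using e by simp
      then show "\<exists>\<delta>>0. \<forall>y\<in>K. dist y x < \<delta> \<longrightarrow> dist ((F ^^ i) y) ((F ^^ i) x) < e / 4"
        using cont_Fn[of i] xK unfolding continuous_on_iff by blast
    qed
    then obtain \<delta> where \<delta>: "\<And>i. \<delta> i > 0"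
      "\<And>i y. y \<in> K \<Longrightarrow> dist y x < \<delta> i \<Longrightarrow> dist ((F ^^ i) y) ((F ^^ i) x) < e / 4"
      by metis
    define m where "m = Min (insert (dist x y) (\<delta> ` {..k}))"
    have m: "m > 0" "m \<le> dist x y" "i \<le> k \<Longrightarrow> m \<le> \<delta> i" for i
    proof -
      show "m > 0" unfolding m_def using \<delta>(1) xy(3) by (subst Min_gr_iff) auto
      show "m \<le> dist x y" unfolding m_def by (rule Min_le) auto
      show "m \<le> \<delta> i" if "i \<le> k" unfolding m_def using that by (intro Min_le) auto
    qed
    obtain A w where A: "compact A" "connected A" "A \<subseteq> C0" "x \<in> A" "A \<subseteq> cball x (m/2)" "w \<in> A" "dist x w \<ge> m/2"
      by (rule small_subcontinuum[of C0 x y "m/2"]) (use C0 xy m in \<open>auto simp: continuum_def\<close>)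
    have AK: "A \<subseteq> K" using A C0 by (auto simp: continuum_def)
    have "thin (e/2) ((F ^^ i) ` A)" if "i \<le> k" for i
    proof -
      have *: "dist ((F ^^ i) u) ((F ^^ i) x) < e / 4" if "u \<in> A" for u
      proof -
        have "dist u x \<le> m / 2" using that A(5) by (auto simp: dist_commute)
        also have "... < \<delta> i" using m(1) m(3)[OF \<open>i \<le> k\<close>] by simp
        finally show ?thesis using \<delta>(2) that AK by blast
      qed
      show ?thesis unfolding thin_def
      proof (intro ballI, elim imageE, simp)
        fix u v assume "u \<in> A" "v \<in> A"
        then show "dist ((F ^^ i) u) ((F ^^ i) v) * 2 \<le> e"
          using *[of u] *[of v] dist_triangle2[of "(F ^^ i) u" "(F ^^ i) v" "(F ^^ i) x"] by simp
      qed
    qed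
    moreover have "\<not> thin 0 A"
    proof
      assume "thin 0 A"
      then have "dist x w \<le> 0" using A(4,6) unfolding thin_def by blast
      then show False using A(7) m(1) by simp
    qed
    ultimately show ?thesis using A AK by (auto simp: continuum_def)
  qed
  then obtain A where A: "\<And>k. continuum (A k)" "\<And>k. \<not> thin 0 (A k)"
      "\<And>k i. i \<le> k \<Longrightarrow> thin (e/2) ((F ^^ i) ` A k)"
    using choice[of "\<lambda>k A. continuum A \<and> \<not> thin 0 A \<and> (\<forall>i\<le>k. thin (e/2) ((F ^^ i) ` A))"] by blast
  have exit: "\<exists>i. \<not> thin (e/2) ((F ^^ i) ` A k)" for k
  proof (rule ccontr)
    assume "\<not> ?thesis"
    then have "thin e ((F ^^ i) ` A k)" for i using thin_mono[of "e/2" "(F ^^ i) ` A k" e] e by simp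
    then show False using ns A(1,2)[of k] by blast
  qed
  define \<tau> where "\<tau> k = (LEAST i. \<not> thin (e/2) ((F ^^ i) ` A k))" for k
  have \<tau>: "\<not> thin (e/2) ((F ^^ \<tau> k) ` A k)" for k
    unfolding \<tau>_def using exit by (rule LeastI_ex)
  have \<tau>_less: "i < \<tau> k \<Longrightarrow> thin (e/2) ((F ^^ i) ` A k)" for i k
    unfolding \<tau>_def using not_less_Least by blast
  have \<tau>k: "\<tau> k > k" for k using A(3)[of "\<tau> k" k] \<tau>[of k] by (meson linorder_not_le)
  define B where "B k = (F ^^ \<tau> k) ` A k" for k
  obtain D where D: "continuum D" "\<not> thin 0 D"
    "\<And>(g :: 'k \<Rightarrow> 'k) e. continuous_on K g \<Longrightarrow> \<forall>\<^sub>F n in sequentially. thin e (g ` B n) \<Longrightarrow> thin (2 * e) (g ` D)"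
    by (rule compact_limit_thin[of B "e/2"]) (use A \<tau> e in \<open>auto simp: B_def continuum_Fn\<close>)
  have DK: "D \<subseteq> K" using D by (auto simp: continuum_def)
  have th: "thin e ((G ^^ Suc n) ` D)" for n
  proof -
    have "thin (e/2) ((G ^^ Suc n) ` B k)" if "k \<ge> Suc n" for k
    proof -
      have "A k \<subseteq> K" using A by (auto simp: continuum_def)
      moreover have "Suc n \<le> \<tau> k" using that \<tau>k[of k] by simp
      ultimately have "(G ^^ Suc n) ` B k = (F ^^ (\<tau> k - Suc n)) ` A k"
        unfolding B_def image_image by (intro image_cong refl) (auto simp: GmFn simp del: funpow.simps)
      then show ?thesis using \<tau>_less[of "\<tau> k - Suc n" k] \<tau>k[of k] by simp
    qed
    then have "thin (2 * (e/2)) ((G ^^ Suc n) ` D)"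
      by (intro D(3)[OF cont_Gn] eventually_sequentiallyI[of "Suc n"])
    then show ?thesis by simp
  qed
  \<comment> \<open>The sets \<open>B k\<close> are not \<open>e/2\<close>-thin themselves, so
    \<open>D\<close> need not be \<open>e\<close>-thin. Only its proper preimages are controlled,
    whence the passage to the image of \<open>D\<close> under \<open>G\<close>.\<close>
  have "unstable e (G ` D)"
    unfolding unstable_def
  proof (intro conjI allI)
    show "continuum (G ` D)" using continuum_Gn[OF D(1), of 1] by simp
    show "thin e ((G ^^ n) ` G ` D)" for n
      using th[of n] by (simp add: image_image funpow_swap1)
  qed
  moreover have "\<not> thin 0 (G ` D)"
  proof
    assume "thin 0 (G ` D)"
    then have eq: "G u = G v" if "u \<in> D" "v \<in> D" for u v
    proof -
      have "dist (G u) (G v) \<le> 0" using \<open>thin 0 (G ` D)\<close> that unfolding thin_def by blast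
      then show ?thesis by simp
    qed
    have inj: "u = v" if "u \<in> D" "v \<in> D" for u v
    proof -
      have "u \<in> K" "v \<in> K" using that DK by blast+
      then have "F (G u) = u" "F (G v) = v" by (simp_all add: FG)
      then show ?thesis using eq[OF that] by metis
    qed
    have "thin 0 D" unfolding thin_def
    proof (intro ballI)
      fix u v assume "u \<in> D" "v \<in> D"
      then have "u = v" by (rule inj)
      then show "dist u v \<le> 0" by simp
    qed
    then show False using D(2) by blast
  qed
  ultimately show "\<exists>C. unstable e C \<and> \<not> thin 0 C" by (intro exI[of _ "G ` D"] conjI)
qed

section \<open>Trimming continua away from a finite set\<close>

text \<open>Trimming costs at most a factor 4 of the size at time \<open>t\<close>. Some
  \<open>z\<close> has its image farther than \<open>e/2\<close> from that of a point
  \<open>b\<close> in the ball. The trimmed piece that contains \<open>z\<close> touches the closure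
  of the removed part at some \<open>w\<close>, and the image of that closure stays within
  \<open>e/8\<close> of the image of \<open>b\<close>. So the images of \<open>z\<close> and
  \<open>w\<close> are more than \<open>3 * e / 8\<close> apart.\<close>

lemma cut:
  assumes C: "continuum C" "\<not> thin e ((F ^^ t) ` C)"
    and e: "e > 0" and q: "thin (e/8) ((F ^^ t) ` (ball q r \<inter> K))"
  obtains C' where "continuum C'" "C' \<subseteq> C" "C' \<inter> ball q r = {}" "\<not> thin (e/4) ((F ^^ t) ` C')"
proof (cases "C \<inter> ball q r = {}")
  case True
  have "\<not> thin (e/4) ((F ^^ t) ` C)" using C(2) thin_mono[of "e/4" _ e] e by auto
  then show ?thesis using that C True by blast
next
  case False
  have CK: "C \<subseteq> K" "compact C" "connected C" using C by (auto simp: continuum_def)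
  from False obtain b where b: "b \<in> C" "b \<in> ball q r" by blast
  let ?f = "F ^^ t"
  have "\<exists>z\<in>C. dist (?f z) (?f b) > e/2"
  proof (rule ccontr)
    assume "\<not> ?thesis"
    then have *: "dist (?f z) (?f b) \<le> e/2" if "z \<in> C" for z using that by force
    have "thin e (?f ` C)" unfolding thin_def
    proof (intro ballI, elim imageE, simp)
      fix u v assume "u \<in> C" "v \<in> C"
      then show "dist (?f u) (?f v) \<le> e"
        using *[of u] *[of v] dist_triangle2[of "?f u" "?f v" "?f b"] by simp
    qed
    then show False using C by blast
  qed
  then obtain z where z: "z \<in> C" "dist (?f z) (?f b) > e/2" by blast
  have near: "dist (?f u) (?f b) \<le> e/8" if "u \<in> C \<inter> ball q r" for u
    using q that b CK unfolding thin_def by blast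
  then have "z \<notin> ball q r" using z e by force
  then obtain C' where C': "compact C'" "connected C'" "C' \<subseteq> C - ball q r" "z \<in> C'"
      "C' \<inter> closure (C \<inter> ball q r) \<noteq> {}"
    using boundary_bump[OF CK(2,3) _ False z(1)] by auto
  then obtain w where w: "w \<in> C'" "w \<in> closure (C \<inter> ball q r)" by blast
  have "closure (C \<inter> ball q r) \<subseteq> {u \<in> C. dist (?f u) (?f b) \<le> e/8}"
  proof (rule closure_minimal)
    show "C \<inter> ball q r \<subseteq> {u \<in> C. dist (?f u) (?f b) \<le> e/8}" using near by auto
    show "closed {u \<in> C. dist (?f u) (?f b) \<le> e/8}"
      by (rule continuous_on_closed_Collect_le)
         (use CK in \<open>auto intro!: continuous_intros continuous_on_subset[OF cont_Fn] compact_imp_closed\<close>)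
  qed
  then have "dist (?f w) (?f b) \<le> e/8" using w by blast
  then have "dist (?f z) (?f w) > e/4"
    using z(2) e dist_triangle[of "?f z" "?f b" "?f w"] by simp
  then have "\<not> thin (e/4) (?f ` C')" using w(1) C'(4) by (intro not_thinI[of "?f z" _ "?f w"]) auto
  then show ?thesis using C' CK by (intro that[of C']) (auto simp: continuum_def)
qed

text \<open>A set of diameter at most \<open>s\<close> is near at most one of the \<open>4 s\<close>-separated points of \<open>Q\<close>,
  so a single cut suffices.\<close>

lemma cut_separated:
  assumes C: "continuum C" "thin s C" "\<not> thin e ((F ^^ t) ` C)"
    and e: "e > 0" and r: "r \<le> s"
    and Q: "\<And>q q'. q \<in> Q \<Longrightarrow> q' \<in> Q \<Longrightarrow> q \<noteq> q' \<Longrightarrow> dist q q' \<ge> 4 * s"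
      "\<And>q. q \<in> Q \<Longrightarrow> thin (e/8) ((F ^^ t) ` (ball q r \<inter> K))"
  obtains C' where "continuum C'" "C' \<subseteq> C" "\<And>x q. x \<in> C' \<Longrightarrow> q \<in> Q \<Longrightarrow> dist q x \<ge> r"
    "\<not> thin (e/4) ((F ^^ t) ` C')"
proof (cases "\<exists>q\<in>Q. C \<inter> ball q r \<noteq> {}")
  case False
  have "\<not> thin (e/4) ((F ^^ t) ` C)" using C(3) thin_mono[of "e/4" _ e] e by auto
  then show ?thesis using that[of C] C False by force
next
  case True
  then obtain q y where q: "q \<in> Q" and y: "y \<in> C" "dist q y < r" by auto
  obtain C' where C': "continuum C'" "C' \<subseteq> C" "C' \<inter> ball q r = {}" "\<not> thin (e/4) ((F ^^ t) ` C')"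
    using cut[OF C(1,3) e Q(2)[OF q]] by blast
  have "dist q' x \<ge> r" if "x \<in> C'" "q' \<in> Q" for x q'
  proof (cases "q' = q")
    case True
    then show ?thesis using C'(3) that by force
  next
    case False
    have "dist x y \<le> s" using C(2) C'(2) that y unfolding thin_def by blast
    moreover have "4 * s \<le> dist q' q" using Q(1) False that q by blast
    ultimately show ?thesis
      using y r dist_triangle[of q' q x] dist_triangle[of x q y] zero_le_dist[of x y]
        dist_commute[of x q] dist_commute[of y q]
      by linarith
  qed
  then show ?thesis using that C' by blast
qed

lemma first_exit:
  assumes "\<exists>n\<le>N. \<not> thin e ((F ^^ n) ` C)"
  obtains t where "t \<le> N" "\<not> thin e ((F ^^ t) ` C)" "\<And>j. j < t \<Longrightarrow> thin e ((F ^^ j) ` C)"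
proof -
  let ?P = "\<lambda>n. \<not> thin e ((F ^^ n) ` C)"
  from assms obtain n where n: "n \<le> N" "?P n" by blast
  show ?thesis
  proof (rule that[of "LEAST n. ?P n"])
    show "(LEAST n. ?P n) \<le> N" using Least_le[of ?P, OF n(2)] n(1) by linarith
    show "?P (LEAST n. ?P n)" using n(2) by (rule LeastI)
  qed (use not_less_Least in blast)
qed

text \<open>A cut delays the exit time of a continuum by at most \<open>K0\<close>, and no further cut is needed
  during the next \<open>Suc K0\<close> steps, so the remaining exit time decreases.\<close>

lemma progress:
  assumes e: "e > 0" and s: "s \<le> e" and r: "r \<le> s"
    and K0: "\<And>C. unstable e C \<Longrightarrow> \<not> thin (e/4) C \<Longrightarrow> \<exists>n\<le>K0. \<not> thin e ((F ^^ n) ` C)"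
    and Q: "\<And>q q'. q \<in> Q \<Longrightarrow> q' \<in> Q \<Longrightarrow> q \<noteq> q' \<Longrightarrow> dist q q' \<ge> 4 * s"
      "\<And>q t. q \<in> Q \<Longrightarrow> t \<le> Tm \<Longrightarrow> thin (e/8) ((F ^^ t) ` (ball q r \<inter> K))"
    and P: "\<And>x j p. x \<in> K \<Longrightarrow> (\<And>q. q \<in> Q \<Longrightarrow> dist q x \<ge> r) \<Longrightarrow> j \<le> K0 \<Longrightarrow> p \<in> P \<Longrightarrow> dist ((F ^^ j) x) p \<ge> r'"
    and C: "unstable e C" "thin s C" "\<exists>t\<le>n. \<not> thin e ((F ^^ t) ` C)" and n: "n \<le> Tm"
  shows "\<exists>C' m. m \<le> n * Suc K0 \<and> continuum C' \<and> C' \<subseteq> C \<and> \<not> thin s ((F ^^ m) ` C') \<and>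
    (\<forall>j<m. thin e ((F ^^ j) ` C')) \<and> (\<forall>j<m. \<forall>x\<in>C'. \<forall>p\<in>P. dist ((F ^^ j) x) p \<ge> r')"
  using C n
proof (induction n arbitrary: C)
  case 0
  then show ?case using thin_mono[of s C e] s by simp
next
  case (Suc n)
  obtain t where t: "t \<le> Suc n" "\<not> thin e ((F ^^ t) ` C)" "\<And>j. j < t \<Longrightarrow> thin e ((F ^^ j) ` C)"
    using first_exit[OF Suc.prems(3)] by blast
  have cC: "continuum C" using Suc.prems by (simp add: unstable_def)
  obtain C' where C': "continuum C'" "C' \<subseteq> C" "\<And>x q. x \<in> C' \<Longrightarrow> q \<in> Q \<Longrightarrow> dist q x \<ge> r"
    "\<not> thin (e/4) ((F ^^ t) ` C')"
  proof (rule cut_separated[OF cC Suc.prems(2) t(2) e r, of Q])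
    show "thin (e/8) ((F ^^ t) ` (ball q r \<inter> K))" if "q \<in> Q" for q
      using Q(2)[OF that] t(1) Suc.prems(4) by simp
  qed (use Q(1) in blast)+
  have C'K: "C' \<subseteq> K" using C' by (auto simp: continuum_def)
  have UC': "unstable e C'" using unstable_subset[OF Suc.prems(1)] C' by (auto simp: continuum_def)
  have thin': "thin e ((F ^^ j) ` C')" if "j < t" for j
    using t(3)[OF that] C'(2) by (meson image_mono thin_subset)
  \<comment> \<open>If the trimmed piece is still \<open>e\<close>-thin at time \<open>t\<close>,
    its image there is unstable and not \<open>e/4\<close>-thin, so \<open>K0\<close> bounds the
    additional delay.\<close>
  have "\<exists>u\<le>t + K0. \<not> thin e ((F ^^ u) ` C')"
  proof (cases "thin e ((F ^^ t) ` C')")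
    case True
    then have "unstable e ((F ^^ t) ` C')"
      using UC' thin' by (intro unstable_Fn) (auto simp: le_less)
    from K0[OF this C'(4)] obtain k where "k \<le> K0" "\<not> thin e ((F ^^ k) ` (F ^^ t) ` C')" by blast
    then show ?thesis
      by (intro exI[of _ "t + k"]) (simp add: image_image funpow_add add.commute[of t k])
  next
    case False
    then show ?thesis by (intro exI[of _ t]) simp
  qed
  then obtain u where u: "u \<le> t + K0" "\<not> thin e ((F ^^ u) ` C')" "\<And>j. j < u \<Longrightarrow> thin e ((F ^^ j) ` C')"
    using first_exit by blast
  have av: "dist ((F ^^ j) x) p \<ge> r'" if "j < Suc K0" "x \<in> C'" "p \<in> P" for j x p
    using P[of x j p] C'(3) C'K that by auto
  show ?case
  proof (cases "u \<le> Suc K0")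
    case True
    have "\<not> thin s ((F ^^ u) ` C')" using u(2) thin_mono s by blast
    then show ?thesis
      using True C'(1,2) u(3) av by (intro exI[of _ C'] exI[of _ u]) auto
  next
    case False
    \<comment> \<open>The trimming protects the times \<open>0\<close> to \<open>K0\<close>, which
      are \<open>Suc K0\<close> steps. From \<open>u \<le> t + K0\<close> and
      \<open>t \<le> Suc n\<close>, at most \<open>n\<close> steps to the exit remain after them, as
      the induction hypothesis requires.\<close>
    let ?L = "Suc K0"
    let ?D = "(F ^^ ?L) ` C'"
    have L: "\<And>j. j \<le> ?L \<Longrightarrow> thin e ((F ^^ j) ` C')" using False u(3) by simp
    show ?thesis
    proof (cases "thin s ?D")
      case False
      then show ?thesis
        using C'(1,2) L av by (intro exI[of _ C'] exI[of _ ?L]) (auto simp del: funpow.simps)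
    next
      case True
      have UD: "unstable e ?D" using unstable_Fn[OF UC' L] .
      have "(F ^^ (u - ?L)) ` ?D = (F ^^ u) ` C'"
        using False funpow_add[of "u - ?L" ?L F] by (simp add: image_comp del: funpow.simps)
      then have "\<exists>t\<le>n. \<not> thin e ((F ^^ t) ` ?D)"
        using u(1,2) t(1) by (intro exI[of _ "u - ?L"]) (simp del: funpow.simps)
      from Suc.IH[OF UD True this] Suc.prems(4)
      obtain E m where E: "m \<le> n * ?L" "continuum E" "E \<subseteq> ?D" "\<not> thin s ((F ^^ m) ` E)"
        "\<And>j. j < m \<Longrightarrow> thin e ((F ^^ j) ` E)" "\<And>j x p. j < m \<Longrightarrow> x \<in> E \<Longrightarrow> p \<in> P \<Longrightarrow> dist ((F ^^ j) x) p \<ge> r'"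
        by auto
      let ?E = "(G ^^ ?L) ` E"
      have EK: "E \<subseteq> K" using E by (auto simp: continuum_def)
      have *: "(F ^^ (?L + j)) ((G ^^ ?L) x) = (F ^^ j) x" if "x \<in> E" for j x
      proof -
        have "(F ^^ (?L + j)) y = (F ^^ j) ((F ^^ ?L) y)" for y
          by (metis add.commute comp_apply funpow_add)
        then show ?thesis using that EK FnGn[of x ?L] by (simp only: subset_iff)
      qed
      have EC: "?E \<subseteq> C'"
      proof
        fix y assume "y \<in> ?E"
        then obtain c where c: "c \<in> C'" "y = (G ^^ ?L) ((F ^^ ?L) c)" using E(3) by blast
        then have "y = c" using GnFn[of c ?L] C'K by (simp only: subset_iff)
        then show "y \<in> C'" using c(1) by simp
      qed
      have im: "(F ^^ (?L + j)) ` ?E = (F ^^ j) ` E" for j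
        unfolding image_image using * by (intro image_cong) auto
      show ?thesis
      proof (intro exI[of _ ?E] exI[of _ "?L + m"] conjI allI impI ballI)
        show "?L + m \<le> Suc n * ?L" using E(1) by simp
        show "continuum ?E" by (rule continuum_Gn[OF E(2)])
        show "?E \<subseteq> C" using EC C' by blast
        show "\<not> thin s ((F ^^ (?L + m)) ` ?E)" using E(4) im by simp
        fix j assume j: "j < ?L + m"
        show "thin e ((F ^^ j) ` ?E)"
        proof (cases "j \<le> ?L")
          case True
          then show ?thesis using L[OF True] EC by (meson image_mono thin_subset)
        next
          case False
          then show ?thesis using E(5)[of "j - ?L"] im[of "j - ?L"] j by simp
        qed
        fix x p assume x: "x \<in> ?E" "p \<in> P"
        show "r' \<le> dist ((F ^^ j) x) p"
        proof (cases "j < ?L")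
          case True
          then show ?thesis using av x EC by blast
        next
          case False
          from x obtain y where y: "y \<in> E" "x = (G ^^ ?L) y" by blast
          have "(F ^^ j) x = (F ^^ (j - ?L)) y"
            using *[OF y(1), of "j - ?L"] y(2) False by simp
          then show ?thesis using E(6)[of "j - ?L" y p] y x False j by simp
        qed
      qed
    qed
  qed
qed

lemma unif_Fn:
  assumes "\<epsilon> > 0"
  shows "\<exists>\<delta>>0. \<forall>j\<le>n. \<forall>x\<in>K. \<forall>y\<in>K. dist x y < \<delta> \<longrightarrow> dist ((F ^^ j) x) ((F ^^ j) y) < \<epsilon>"
proof (induction n)
  case 0
  show ?case using assms by auto
next
  case (Suc n)
  then obtain \<delta> where \<delta>: "\<delta> > 0" "\<And>j x y. j \<le> n \<Longrightarrow> x \<in> K \<Longrightarrow> y \<in> K \<Longrightarrow> dist x y < \<delta> \<Longrightarrow> dist ((F ^^ j) x) ((F ^^ j) y) < \<epsilon>"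
    by blast
  have "uniformly_continuous_on K (F ^^ Suc n)"
    by (rule compact_uniformly_continuous[OF cont_Fn compact_K])
  then obtain \<delta>' where \<delta>': "\<delta>' > 0" "\<And>x y. x \<in> K \<Longrightarrow> y \<in> K \<Longrightarrow> dist x y < \<delta>' \<Longrightarrow> dist ((F ^^ Suc n) x) ((F ^^ Suc n) y) < \<epsilon>"
    using assms unfolding uniformly_continuous_on_def by (metis dist_commute)
  show ?case
    by (rule exI[of _ "min \<delta> \<delta>'"]) (use \<delta> \<delta>' in \<open>auto simp: le_Suc_eq simp del: funpow.simps\<close>)
qed

section \<open>Branching and the binary tree\<close>

text \<open>Pieces of radius \<open>s/4\<close> are taken around two points of the image that are
  more than \<open>s\<close> apart. This leaves a distance of at least \<open>s - 2 * (s/4)\<close>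
  between them, and each piece reaches distance \<open>s/4\<close> from its centre, so it is not
  \<open>s/8\<close>-thin. The image itself may fail to be \<open>e\<close>-thin, but its proper
  preimages are, so its small pieces are unstable again.\<close>

lemma unstable_branch:
  assumes s: "0 < s" "s \<le> e" and C: "unstable e C" "\<And>j. j < m \<Longrightarrow> thin e ((F ^^ j) ` C)" "\<not> thin s ((F ^^ m) ` C)"
  shows "\<exists>A B. A \<subseteq> (F ^^ m) ` C \<and> B \<subseteq> (F ^^ m) ` C \<and> (unstable e A \<and> thin s A \<and> \<not> thin (s/8) A) \<and>
    (unstable e B \<and> thin s B \<and> \<not> thin (s/8) B) \<and> (\<forall>x\<in>A. \<forall>y\<in>B. dist x y \<ge> s/2)"
proof -
  let ?C = "(F ^^ m) ` C"
  have CK: "C \<subseteq> K" using C by (auto simp: unstable_def continuum_def)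
  have cC: "continuum ?C" using C by (auto simp: unstable_def continuum_Fn)
  have G: "thin e ((G ^^ n) ` ?C)" if "n > 0" for n
  proof -
    have "(G ^^ n) ` ?C = (if n \<le> m then F ^^ (m - n) else G ^^ (n - m)) ` C"
      unfolding image_image using CK by (intro image_cong refl) (simp add: GmFn subset_iff)
    then show ?thesis using C that by (cases "n \<le> m") (auto simp: unstable_def)
  qed
  have ex: "\<exists>A. A \<subseteq> ?C \<and> unstable e A \<and> thin s A \<and> \<not> thin (s/8) A \<and> A \<subseteq> cball a (s/4)"
    if ab: "a \<in> ?C" "b \<in> ?C" "dist a b > s" for a b
  proof -
    obtain A w where A: "compact A" "connected A" "A \<subseteq> ?C" "a \<in> A" "A \<subseteq> cball a (s/4)" "w \<in> A" "dist a w \<ge> s/4"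
      by (rule small_subcontinuum[of ?C a b "s/4"]) (use cC ab s in \<open>auto simp: continuum_def\<close>)
    have thin: "thin s A" unfolding thin_def
    proof (intro ballI)
      fix u v assume "u \<in> A" "v \<in> A"
      then have "dist a u \<le> s/4" "dist a v \<le> s/4" using A(5) by auto
      then show "dist u v \<le> s" using dist_triangle3[of u v a] s by simp
    qed
    have nt: "\<not> thin (s/8) A" using A(4,6,7) s by (intro not_thinI[of a A w]) auto
    have "thin e ((G ^^ n) ` A)" for n
    proof (cases "n > 0")
      case True
      then show ?thesis using thin_subset[OF G[OF True] image_mono[OF A(3)]] by simp
    qed (use thin thin_mono s in auto)
    then have "unstable e A" using A cC by (auto simp: unstable_def continuum_def)
    then show ?thesis using thin nt A by blast
  qed
  obtain a b where ab: "a \<in> ?C" "b \<in> ?C" "dist a b > s" using not_thinE[OF C(3)] by blast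
  obtain A where A: "A \<subseteq> ?C" "unstable e A" "thin s A" "\<not> thin (s/8) A" "A \<subseteq> cball a (s/4)"
    using ex[OF ab] by blast
  obtain B where B: "B \<subseteq> ?C" "unstable e B" "thin s B" "\<not> thin (s/8) B" "B \<subseteq> cball b (s/4)"
    using ex[OF ab(2,1)] ab(3) by (auto simp: dist_commute)
  have "dist x y \<ge> s/2" if "x \<in> A" "y \<in> B" for x y
  proof -
    have "dist a x \<le> s/4" "dist b y \<le> s/4" using A(5) B(5) that by auto
    then show ?thesis
      using ab(3) dist_triangle[of a b x] dist_triangle[of x b y] dist_commute[of b y] by linarith
  qed
  with A B show ?thesis by (intro exI[of _ A] exI[of _ B] conjI ballI)
qed

lemma finite_separation:
  assumes "finite (Q :: 'k set)"
  shows "\<exists>\<delta>>0. \<forall>q\<in>Q. \<forall>q'\<in>Q. q \<noteq> q' \<longrightarrow> dist q q' \<ge> \<delta>"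
  using assms
proof (induction Q)
  case (insert a Q)
  then obtain \<delta> where \<delta>: "\<delta> > 0" "\<forall>q\<in>Q. \<forall>q'\<in>Q. q \<noteq> q' \<longrightarrow> dist q q' \<ge> \<delta>" by blast
  obtain \<delta>' where \<delta>': "\<delta>' > 0" "\<forall>q\<in>Q. q \<noteq> a \<longrightarrow> dist a q \<ge> \<delta>'"
    using finite_set_avoid[OF insert(1), of a] by blast
  show ?case
    by (rule exI[of _ "min \<delta> \<delta>'"]) (use \<delta> \<delta>' insert in \<open>auto simp: dist_commute min_le_iff_disj\<close>)
qed (auto intro: exI[of _ 1])

text \<open>One level of the tree costs at most \<open>N\<close> steps: an \<open>s\<close>-thin
  unstable continuum that is not \<open>s/8\<close>-thin exits within \<open>Tm\<close> steps,
  trimming stretches this by a factor of at most \<open>Suc K0\<close>, and the result branches into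
  two continua of the same kind. The points are picked at the leaves, where a nondegenerate
  continuum cannot be covered by the countable \<open>D\<close>, and pulled back to the root; so the
  complement of \<open>D\<close> has to be invariant under \<open>G\<close>.\<close>

lemma unstable_tree:
  assumes cw: "\<And>C. continuum C \<Longrightarrow> (\<And>n. thin (2 * e) ((F ^^ n) ` C)) \<Longrightarrow>
      (\<And>n. thin (2 * e) ((G ^^ n) ` C)) \<Longrightarrow> thin 0 C"
    and e: "e > 0" and P: "finite P" "P \<subseteq> K"
    and C0: "unstable e C0" "\<not> thin 0 C0"
    and D: "countable D" "\<And>x. x \<in> K \<Longrightarrow> x \<notin> D \<Longrightarrow> G x \<notin> D"
  shows "\<exists>s>0. \<exists>r>0. \<exists>N. \<forall>k. \<exists>E\<subseteq>K - D. finite E \<and> card E = 2 ^ k \<and>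
    (\<forall>x\<in>E. \<forall>y\<in>E. x \<noteq> y \<longrightarrow> (\<exists>i\<le>k * N. dist ((F ^^ i) x) ((F ^^ i) y) \<ge> s \<and>
       (\<forall>j<i. \<forall>p\<in>P. dist ((F ^^ j) x) p \<ge> r \<and> dist ((F ^^ j) y) p \<ge> r)))"
proof -
  have exit: "\<exists>N. \<forall>C. unstable e C \<longrightarrow> \<not> thin \<eta> C \<longrightarrow> (\<exists>n\<le>N. \<not> thin e ((F ^^ n) ` C))"
    if "\<eta> > 0" for \<eta>
    by (rule exit_time_uniform[OF _ that]) (rule cw)
  have "e / 4 > 0" using e by simp
  then obtain K0 where K0: "\<And>C. unstable e C \<Longrightarrow> \<not> thin (e/4) C \<Longrightarrow> \<exists>n\<le>K0. \<not> thin e ((F ^^ n) ` C)"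
    using exit by blast
  define Q where "Q = (\<Union>j\<le>K0. (G ^^ j) ` P)"
  have Q: "finite Q" "Q \<subseteq> K" using P Gn_in by (auto simp: Q_def)
  obtain \<delta> where \<delta>: "\<delta> > 0" "\<And>q q'. q \<in> Q \<Longrightarrow> q' \<in> Q \<Longrightarrow> q \<noteq> q' \<Longrightarrow> dist q q' \<ge> \<delta>"
    using finite_separation[OF Q(1)] by blast
  define s where "s = min (\<delta>/4) e"
  have s: "s > 0" "s \<le> e" "4 * s \<le> \<delta>" using \<delta>(1) e by (auto simp: s_def)
  have Q4: "dist q q' \<ge> 4 * s" if "q \<in> Q" "q' \<in> Q" "q \<noteq> q'" for q q'
    using \<delta>(2)[OF that] s(3) by linarith
  have "s / 8 > 0" using s by simp
  then obtain Tm where Tm: "\<And>C. unstable e C \<Longrightarrow> \<not> thin (s/8) C \<Longrightarrow> \<exists>n\<le>Tm. \<not> thin e ((F ^^ n) ` C)"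
    using exit by blast
  have "e/8 > 0" using e by simp
  then obtain \<delta>1 where \<delta>1: "\<delta>1 > 0" "\<And>j x y. j \<le> Tm \<Longrightarrow> x \<in> K \<Longrightarrow> y \<in> K \<Longrightarrow> dist x y < \<delta>1 \<Longrightarrow>
      dist ((F ^^ j) x) ((F ^^ j) y) < e/8"
    using unif_Fn[of "e/8" Tm] by blast
  \<comment> \<open>A ball of radius \<open>r\<close> around a point of \<open>Q\<close> must stay
    \<open>e/8\<close>-thin up to every possible exit time, as \<open>cut\<close> demands; this is
    why \<open>r\<close> depends on \<open>Tm\<close>.\<close>
  define r where "r = min s (\<delta>1/2)"
  have r: "r > 0" "r \<le> s" "2 * r \<le> \<delta>1" using s \<delta>1 by (auto simp: r_def)
  have Qr: "thin (e/8) ((F ^^ t) ` (ball q r \<inter> K))" if "q \<in> Q" "t \<le> Tm" for q t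
    unfolding thin_def
  proof (intro ballI, elim imageE IntE, simp only:)
    fix u v assume "u \<in> ball q r" "v \<in> ball q r" "u \<in> K" "v \<in> K"
    moreover from this have "dist u v < \<delta>1" using dist_triangle3[of u v q] r(3) by simp
    ultimately show "dist ((F ^^ t) u) ((F ^^ t) v) \<le> e/8" using \<delta>1(2) that by (simp add: less_imp_le)
  qed
  obtain r' where r': "r' > 0" "\<And>j x y. j \<le> K0 \<Longrightarrow> x \<in> K \<Longrightarrow> y \<in> K \<Longrightarrow> dist x y < r' \<Longrightarrow>
      dist ((G ^^ j) x) ((G ^^ j) y) < r"
    using compact_homeo.unif_Fn[OF swap r(1), of K0] by blast
  have avoid: "dist ((F ^^ j) x) p \<ge> r'"
    if "x \<in> K" "\<And>q. q \<in> Q \<Longrightarrow> dist q x \<ge> r" "j \<le> K0" "p \<in> P" for x j p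
  proof (rule ccontr)
    assume "\<not> ?thesis"
    then have "dist ((G ^^ j) ((F ^^ j) x)) ((G ^^ j) p) < r"
      using that P by (intro r'(2)) (auto simp: Fn_in)
    then have "dist x ((G ^^ j) p) < r" using that GnFn by simp
    moreover have "(G ^^ j) p \<in> Q" using that by (auto simp: Q_def)
    ultimately show False using that(2)[of "(G ^^ j) p"] by (simp add: dist_commute)
  qed
  define N where "N = Tm * Suc K0"
  define good where "good C \<longleftrightarrow> unstable e C \<and> thin s C \<and> \<not> thin (s/8) C" for C
  define R where "R n x y \<longleftrightarrow> (\<exists>i\<le>n. dist ((F ^^ i) x) ((F ^^ i) y) \<ge> s/2 \<and>
     (\<forall>j<i. \<forall>p\<in>P. dist ((F ^^ j) x) p \<ge> r' \<and> dist ((F ^^ j) y) p \<ge> r'))" for n x y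
  have tree: "\<exists>E\<subseteq>C - D. finite E \<and> card E = 2 ^ k \<and>
    (\<forall>x\<in>E. \<forall>y\<in>E. x \<noteq> y \<longrightarrow> R (k * N) x y)"
    if "good C" for k C
    using that
  proof (induction k arbitrary: C)
    case 0
    then obtain x y where xy: "x \<in> C" "y \<in> C" "dist x y > s/8" by (auto simp: good_def elim: not_thinE)
    moreover have conn: "connected C" using 0 by (auto simp: good_def unstable_def continuum_def)
    moreover have "x \<noteq> y" using xy(3) s(1) by auto
    ultimately have "uncountable C" using connected_uncountable by blast
    then have "\<not> C \<subseteq> D" using D(1) countable_subset by blast
    then obtain z where "z \<in> C - D" by blast
    then show ?case by (intro exI[of _ "{z}"]) auto
  next
    case (Suc k)
    have C: "unstable e C" "thin s C" "\<exists>t\<le>Tm. \<not> thin e ((F ^^ t) ` C)"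
      using Suc.prems Tm by (auto simp: good_def)
    have "\<exists>C' m. m \<le> Tm * Suc K0 \<and> continuum C' \<and> C' \<subseteq> C \<and> \<not> thin s ((F ^^ m) ` C') \<and>
      (\<forall>j<m. thin e ((F ^^ j) ` C')) \<and> (\<forall>j<m. \<forall>x\<in>C'. \<forall>p\<in>P. dist ((F ^^ j) x) p \<ge> r')"
      by (rule progress[OF e s(2) r(2) K0 Q4 Qr avoid C order_refl])
    then obtain C' m where m: "m \<le> N" "continuum C'" "C' \<subseteq> C" "\<not> thin s ((F ^^ m) ` C')"
      "\<And>j. j < m \<Longrightarrow> thin e ((F ^^ j) ` C')" "\<And>j x p. j < m \<Longrightarrow> x \<in> C' \<Longrightarrow> p \<in> P \<Longrightarrow> dist ((F ^^ j) x) p \<ge> r'"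
      unfolding N_def by blast
    have UC': "unstable e C'" using unstable_subset[OF C(1)] m by (auto simp: continuum_def)
    obtain A B where AB: "A \<subseteq> (F ^^ m) ` C'" "B \<subseteq> (F ^^ m) ` C'" "good A" "good B"
      "\<And>x y. x \<in> A \<Longrightarrow> y \<in> B \<Longrightarrow> dist x y \<ge> s/2"
      using unstable_branch[OF s(1,2) UC' m(5,4)] unfolding good_def[symmetric] by blast
    obtain E1 where E1: "E1 \<subseteq> A - D" "finite E1" "card E1 = 2 ^ k"
      "\<And>x y. x \<in> E1 \<Longrightarrow> y \<in> E1 \<Longrightarrow> x \<noteq> y \<Longrightarrow> R (k * N) x y"
      using Suc.IH[OF AB(3)] by blast
    obtain E2 where E2: "E2 \<subseteq> B - D" "finite E2" "card E2 = 2 ^ k"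
      "\<And>x y. x \<in> E2 \<Longrightarrow> y \<in> E2 \<Longrightarrow> x \<noteq> y \<Longrightarrow> R (k * N) x y"
      using Suc.IH[OF AB(4)] by blast
    have C'K: "C' \<subseteq> K" using m by (auto simp: continuum_def)
    have dj: "E1 \<inter> E2 = {}"
    proof (rule ccontr)
      assume "E1 \<inter> E2 \<noteq> {}"
      then obtain x where "x \<in> E1" "x \<in> E2" by blast
      then have "dist x x \<ge> s/2" using AB(5) E1(1) E2(1) by blast
      then show False using s(1) by simp
    qed
    let ?E = "E1 \<union> E2"
    have E_sub: "?E \<subseteq> (F ^^ m) ` C'" using AB(1,2) E1(1) E2(1) by blast
    then have EK: "?E \<subseteq> K" using C'K Fn_in by blast
    have inj: "inj_on (G ^^ m) ?E" by (rule inj_on_inverseI[of _ "F ^^ m"]) (use EK FnGn in blast)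
    have shift: "(F ^^ (m + i)) ((G ^^ m) x) = (F ^^ i) x" if "x \<in> ?E" for x i
    proof -
      have "(F ^^ (m + i)) y = (F ^^ i) ((F ^^ m) y)" for y
        by (metis add.commute comp_apply funpow_add)
      then show ?thesis using that EK FnGn[of x m] by (simp only: subset_iff)
    qed
    have GC: "(G ^^ m) x \<in> C'" if x: "x \<in> ?E" for x
    proof -
      obtain c where c: "c \<in> C'" "x = (F ^^ m) c" using x E_sub by blast
      then show ?thesis using GnFn[of c m] C'K by (simp add: subset_iff)
    qed
    have notD: "(G ^^ n) x \<notin> D" if "x \<in> K" "x \<notin> D" for x n
      using that by (induction n) (auto simp: D Gn_in)
    have extend: "R (Suc k * N) ((G ^^ m) x) ((G ^^ m) y)" if xy: "x \<in> ?E" "y \<in> ?E" and R: "R (k * N) x y" for x y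
    proof -
      obtain i where i: "i \<le> k * N" "dist ((F ^^ i) x) ((F ^^ i) y) \<ge> s/2"
         "\<forall>j<i. \<forall>p\<in>P. dist ((F ^^ j) x) p \<ge> r' \<and> dist ((F ^^ j) y) p \<ge> r'"
        using R unfolding R_def by blast
      show ?thesis unfolding R_def
      proof (intro exI[of _ "m + i"] conjI allI impI ballI)
        show "m + i \<le> Suc k * N" using m(1) i(1) by simp
        show "s/2 \<le> dist ((F ^^ (m + i)) ((G ^^ m) x)) ((F ^^ (m + i)) ((G ^^ m) y))"
          using i(2) shift xy by simp
        fix j p assume j: "j < m + i" and p: "p \<in> P"
        have *: "r' \<le> dist ((F ^^ j) ((G ^^ m) z)) p" if z: "z \<in> ?E" "\<forall>j<i. r' \<le> dist ((F ^^ j) z) p" for z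
        proof (cases "j < m")
          case True
          then show ?thesis using m(6) GC z p by blast
        next
          case False
          then have "(F ^^ j) ((G ^^ m) z) = (F ^^ (j - m)) z" using shift[OF z(1), of "j - m"] by simp
          then show ?thesis using z False j by simp
        qed
        show "r' \<le> dist ((F ^^ j) ((G ^^ m) x)) p" using * xy i(3) p by blast
        show "r' \<le> dist ((F ^^ j) ((G ^^ m) y)) p" using * xy i(3) p by blast
      qed
    qed
    show ?case
    proof (intro exI[of _ "(G ^^ m) ` ?E"] conjI ballI impI)
      show "(G ^^ m) ` ?E \<subseteq> C - D"
      proof
        fix u assume "u \<in> (G ^^ m) ` ?E"
        then obtain x where x: "x \<in> ?E" "u = (G ^^ m) x" by blast
        then have "x \<in> K" "x \<notin> D" using EK E1(1) E2(1) by blast+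
        then show "u \<in> C - D" using x GC m(3) notD by blast
      qed
      show "finite ((G ^^ m) ` ?E)" using E1 E2 by simp
      show "card ((G ^^ m) ` ?E) = 2 ^ Suc k"
        using inj dj E1 E2 by (simp add: card_image card_Un_disjoint)
      fix x' y' assume "x' \<in> (G ^^ m) ` ?E" "y' \<in> (G ^^ m) ` ?E" and ne: "x' \<noteq> y'"
      then obtain x y where xy: "x \<in> ?E" "y \<in> ?E" "x' = (G ^^ m) x" "y' = (G ^^ m) y" by blast
      have xy_ne: "x \<noteq> y" using ne xy by auto
      have "R (k * N) x y"
      proof -
        \<comment> \<open>Points of different branches are at distance at least \<open>s/2\<close>
          as soon as the branches are formed, so \<open>i = 0\<close> works for them, with no
          earlier step at which \<open>P\<close> has to be avoided.\<close>
        consider "x \<in> E1" "y \<in> E1" | "x \<in> E2" "y \<in> E2" | "dist x y \<ge> s/2"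
          using xy(1,2) AB(5)[of x y] AB(5)[of y x] E1(1) E2(1) dist_commute[of x y] by auto
        then show ?thesis
        proof cases
          case 3
          then show ?thesis unfolding R_def by (intro exI[of _ 0]) auto
        qed (use E1(4) E2(4) xy_ne in blast)+
      qed
      then show "R (Suc k * N) x' y'"
        unfolding xy(3,4) by (rule extend[OF xy(1,2)])
    qed
  qed
  \<comment> \<open>\<open>C0\<close> may be much smaller than \<open>s/8\<close>. An exit bound for
    its own size leads to a first branching, and the tree is grown in one of the branches, so this
    initial delay does not enter \<open>N\<close>.\<close>
  obtain a b where ab: "a \<in> C0" "b \<in> C0" "dist a b > 0" using not_thinE[OF C0(2)] by blast
  then have "\<not> thin (dist a b / 2) C0" by (intro not_thinI[of a _ b]) auto
  moreover obtain N0 where "\<And>C. unstable e C \<Longrightarrow> \<not> thin (dist a b / 2) C \<Longrightarrow> \<exists>n\<le>N0. \<not> thin e ((F ^^ n) ` C)"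
    using exit[of "dist a b / 2"] ab(3) by auto
  ultimately have "\<exists>n\<le>N0. \<not> thin e ((F ^^ n) ` C0)" using C0(1) by blast
  then obtain t where t: "t \<le> N0" "\<not> thin e ((F ^^ t) ` C0)" "\<And>j. j < t \<Longrightarrow> thin e ((F ^^ j) ` C0)"
    using first_exit by blast
  have "\<not> thin s ((F ^^ t) ` C0)" using t(2) thin_mono s by blast
  then obtain A where A: "good A"
    using unstable_branch[OF s(1,2) C0(1) t(3)] unfolding good_def[symmetric] by blast
  have AK: "A \<subseteq> K" using A by (auto simp: good_def unstable_def continuum_def)
  have main: "\<exists>E\<subseteq>K - D. finite E \<and> card E = 2 ^ k \<and>
      (\<forall>x\<in>E. \<forall>y\<in>E. x \<noteq> y \<longrightarrow> (\<exists>i\<le>k * N. dist ((F ^^ i) x) ((F ^^ i) y) \<ge> s/2 \<and>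
         (\<forall>j<i. \<forall>p\<in>P. dist ((F ^^ j) x) p \<ge> r' \<and> dist ((F ^^ j) y) p \<ge> r')))" for k
  proof -
    obtain E where E: "E \<subseteq> A - D" "finite E" "card E = 2 ^ k" "\<forall>x\<in>E. \<forall>y\<in>E. x \<noteq> y \<longrightarrow> R (k * N) x y"
      using tree[OF A, of k] by blast
    moreover have "E \<subseteq> K - D" using E(1) AK by blast
    ultimately show "\<exists>E\<subseteq>K - D. finite E \<and> card E = 2 ^ k \<and>
      (\<forall>x\<in>E. \<forall>y\<in>E. x \<noteq> y \<longrightarrow> (\<exists>i\<le>k * N. dist ((F ^^ i) x) ((F ^^ i) y) \<ge> s/2 \<and>
         (\<forall>j<i. \<forall>p\<in>P. dist ((F ^^ j) x) p \<ge> r' \<and> dist ((F ^^ j) y) p \<ge> r')))"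
      unfolding R_def[symmetric] by (intro exI[of _ E] conjI)
  qed
  have half: "s/2 > 0" using s by simp
  show ?thesis
    by (rule exI[of _ "s/2"], rule conjI[OF half], rule exI[of _ r'], rule conjI[OF r'(1)],
        rule exI[of _ N], rule allI, rule main)
qed

text \<open>Bowen separation up to step \<open>n\<close>, inclusive, together with the history that
  bounds travel times: the distance from \<open>P\<close> matters only at the steps strictly before
  the separation.\<close>

definition avoiding_separated :: "('k \<Rightarrow> 'k) \<Rightarrow> 'k set \<Rightarrow> real \<Rightarrow> real \<Rightarrow> nat \<Rightarrow> 'k set \<Rightarrow> bool" where
  "avoiding_separated f P s r n E \<longleftrightarrow>
    (\<forall>x\<in>E. \<forall>y\<in>E. x \<noteq> y \<longrightarrow> (\<exists>i\<le>n. dist ((f ^^ i) x) ((f ^^ i) y) \<ge> s \<and>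
       (\<forall>j<i. \<forall>p\<in>P. dist ((f ^^ j) x) p \<ge> r \<and> dist ((f ^^ j) y) p \<ge> r)))"

text \<open>A continuum that is thin in the future is unstable for the inverse homeomorphism, so in
  that case the tree is grown for \<open>G\<close>. As the direction is not known in advance, the
  complement of \<open>D\<close> has to be invariant under both maps.\<close>

theorem cw_expansive_tree:
  assumes cw: "\<And>C. continuum C \<Longrightarrow> (\<And>n. thin c ((F ^^ n) ` C)) \<Longrightarrow>
      (\<And>n. thin c ((G ^^ n) ` C)) \<Longrightarrow> thin 0 C"
    and c: "c > 0" and P: "finite P" "P \<subseteq> K"
    and C0: "continuum C0" "\<not> thin 0 C0"
    and D: "countable D" "\<And>x. x \<in> K \<Longrightarrow> x \<notin> D \<Longrightarrow> G x \<notin> D" "\<And>x. x \<in> K \<Longrightarrow> x \<notin> D \<Longrightarrow> F x \<notin> D"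
  shows "\<exists>f\<in>{F, G}. \<exists>s>0. \<exists>r>0. \<exists>N. \<forall>k. \<exists>E\<subseteq>K - D.
    finite E \<and> card E = 2 ^ k \<and> avoiding_separated f P s r (k * N) E"
proof -
  have e: "c/2 > 0" using c by simp
  have cw1: "thin 0 C" if "continuum C" "\<And>n. thin (2 * (c/2)) ((F ^^ n) ` C)" "\<And>n. thin (2 * (c/2)) ((G ^^ n) ` C)" for C
    by (rule cw[OF that(1)]) (use that(2,3) in simp_all)
  consider C where "unstable (c/2) C" "\<not> thin 0 C"
    | C where "continuum C" "\<not> thin 0 C" "\<forall>n. thin (c/2) ((F ^^ n) ` C)"
    using unstable_or_stable_exists[OF e C0] by blast
  then show ?thesis
  proof cases
    case 1
    have "\<exists>s>0. \<exists>r>0. \<exists>N. \<forall>k. \<exists>E\<subseteq>K - D. finite E \<and> card E = 2 ^ k \<and> avoiding_separated F P s r (k * N) E"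
      unfolding avoiding_separated_def by (rule unstable_tree[OF cw1 e P 1 D(1,2)])
    then show ?thesis by - (rule bexI[of _ F], assumption, simp)
  next
    case 2
    interpret inv: compact_homeo K G F by (rule swap)
    have U: "inv.unstable (c/2) C" using 2 by (simp add: inv.unstable_def)
    have cw2: "thin 0 C" if "continuum C" "\<And>n. thin (2 * (c/2)) ((G ^^ n) ` C)" "\<And>n. thin (2 * (c/2)) ((F ^^ n) ` C)" for C
      by (rule cw1[OF that(1,3,2)])
    have "\<exists>s>0. \<exists>r>0. \<exists>N. \<forall>k. \<exists>E\<subseteq>K - D. finite E \<and> card E = 2 ^ k \<and> avoiding_separated G P s r (k * N) E"
      unfolding avoiding_separated_def by (rule inv.unstable_tree[OF cw2 e P U 2(2) D(1,3)])
    then show ?thesis by - (rule bexI[of _ G], assumption, simp)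
  qed
qed

end

section \<open>Flows with a braked velocity field\<close>

lemma has_vector_derivative_chain:
  assumes "(g has_derivative D) (at (\<gamma> u))" "(\<gamma> has_vector_derivative w) (at u)"
  shows "((\<lambda>s. g (\<gamma> s)) has_vector_derivative D w) (at u)"
proof -
  have "(g \<circ> \<gamma> has_derivative D \<circ> (\<lambda>h. h *\<^sub>R w)) (at u)"
    by (rule diff_chain_at[OF assms(2)[unfolded has_vector_derivative_def] assms(1)])
  moreover have "D \<circ> (\<lambda>h. h *\<^sub>R w) = (\<lambda>h. h *\<^sub>R D w)"
    using linear_cmul[OF has_derivative_linear[OF assms(1)]] by (simp add: fun_eq_iff)
  ultimately show ?thesis by (simp add: has_vector_derivative_def comp_def)
qed

lemma flow_continuous_compose:
  assumes "flow X \<psi>" "continuous_map Z euclideanreal \<theta>" "continuous_map Z X \<gamma>"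
  shows "continuous_map Z X (\<lambda>z. \<psi> (\<theta> z) (\<gamma> z))"
proof -
  have "continuous_map Z (prod_topology euclideanreal X) (\<lambda>z. (\<theta> z, \<gamma> z))"
    using assms by (simp add: continuous_map_pairwise comp_def)
  then have "continuous_map Z X ((\<lambda>(t, p). \<psi> t p) \<circ> (\<lambda>z. (\<theta> z, \<gamma> z)))"
    by (rule continuous_map_compose) (use assms(1) in \<open>simp add: flow_def\<close>)
  then show ?thesis by (simp add: comp_def)
qed

lemma flow_in:
  assumes "flow X \<psi>" "p \<in> topspace X"
  shows "\<psi> t p \<in> topspace X"
proof -
  have "continuous_map euclideanreal X (\<lambda>t. \<psi> t p)"
    by (rule flow_continuous_compose[OF assms(1)]) (use assms(2) in auto)
  from continuous_map_image_subset_topspace[OF this] show ?thesis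
    unfolding topspace_euclidean by blast
qed

lemma flow_add: "flow X \<psi> \<Longrightarrow> p \<in> topspace X \<Longrightarrow> \<psi> (s + t) p = \<psi> s (\<psi> t p)"
  by (simp add: flow_def)

lemma flow_zero: "flow X \<psi> \<Longrightarrow> p \<in> topspace X \<Longrightarrow> \<psi> 0 p = p"
  by (simp add: flow_def)

lemma open_preimage_curve:
  assumes "continuous_map euclideanreal X \<gamma>" "openin X U"
  shows "open {u. \<gamma> u \<in> U}"
  using openin_continuous_map_preimage[OF assms] by simp

text \<open>For a \<open>C\<^sup>1\<close> flow the curve \<open>u \<mapsto> \<psi> (-\<theta> u) (\<gamma> u)\<close> has velocity \<open>l u * D (-1, v (\<gamma> u))\<close>, where \<open>D\<close> is the
  derivative of the flow in charts, and \<open>D (-1, v (\<gamma> u))\<close> vanishes because \<open>s \<mapsto> \<psi> (-\<theta> u - s) (\<psi> s (\<gamma> u))\<close>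
  is constant. The velocity field itself is merely continuous, so its integral curves need not be unique a priori.\<close>

lemma C1_flow_pullback_derivative:
  assumes atlas: "smooth_atlas N A" and \<psi>: "C1_flow N A \<psi>"
    and \<gamma>: "continuous_map euclideanreal N \<gamma>" and \<theta>: "(\<theta> has_real_derivative l) (at u)"
    and C: "(U, c) \<in> A" "\<gamma> u \<in> U" "((\<lambda>s. c (\<gamma> s)) has_vector_derivative l *\<^sub>R v) (at u)"
    and v: "((\<lambda>s. c (\<psi> s (\<gamma> u))) has_vector_derivative v) (at 0)"
    and E: "(V, e) \<in> A" "\<psi> (- \<theta> u) (\<gamma> u) \<in> V"
  shows "((\<lambda>s. e (\<psi> (- \<theta> s) (\<gamma> s))) has_vector_derivative 0) (at u)"
proof -
  have fl: "flow N \<psi>" using \<psi> by (simp add: C1_flow_def)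
  have oU: "openin N U" and hom: "homeomorphic_map (subtopology N U) (top_of_set (c ` U)) c"
    using atlas C(1) unfolding smooth_atlas_def by auto
  have UN: "U \<subseteq> topspace N" using oU openin_subset by blast
  have inj: "inj_on c U"
    using homeomorphic_imp_injective_map[OF hom] UN by (simp add: Int_absorb1)
  define z where "z = \<gamma> u"
  have z: "z \<in> U" "z \<in> topspace N" using C UN by (auto simp: z_def)
  define g where "g = e \<circ> (\<lambda>(t, p). \<psi> t p) \<circ> inv_into (UNIV \<times> U) (map_prod id c)"
  have ginv: "g (t, c p) = e (\<psi> t p)" if "p \<in> U" for t p
  proof -
    have "inj_on (map_prod id c) (UNIV \<times> U)" using inj by (auto simp: inj_on_def)
    then have "inv_into (UNIV \<times> U) (map_prod id c) (map_prod id c (t, p)) = (t, p)"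
      by (rule inv_into_f_f) (use that in auto)
    then show ?thesis by (simp add: g_def)
  qed
  have chart: "(UNIV \<times> U, map_prod id c) \<in> prod_atlas std_atlas A"
    using C(1) by (auto simp: prod_atlas_def std_atlas_def)
  have "Ck_map (Suc 0) (prod_topology euclideanreal N) (prod_atlas std_atlas A) N A (\<lambda>(t, p). \<psi> t p)"
    using \<psi> by (simp add: C1_flow_def)
  from bspec[OF conjunct2[OF this[unfolded Ck_map_def]] chart, unfolded split_conv]
  have "\<forall>(V, e)\<in>A. Ck_on (Suc 0) (e \<circ> (\<lambda>(t, p). \<psi> t p) \<circ> inv_into (UNIV \<times> U) (map_prod id c))
     (map_prod id c ` {p \<in> UNIV \<times> U. (case p of (t, p) \<Rightarrow> \<psi> t p) \<in> V})" .
  from bspec[OF this E(1), unfolded split_conv]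
  have ck: "Ck_on (Suc 0) g (map_prod id c ` {p \<in> UNIV \<times> U. (case p of (t, p) \<Rightarrow> \<psi> t p) \<in> V})"
    unfolding g_def .
  have mem: "(- \<theta> u, c z) \<in> map_prod id c ` {p \<in> UNIV \<times> U. (case p of (t, p) \<Rightarrow> \<psi> t p) \<in> V}"
    using z E(2) by (intro image_eqI[of _ _ "(- \<theta> u, z)"]) (auto simp: z_def)
  have "g differentiable at (- \<theta> u, c z)"
    by (rule bspec[OF conjunct1[OF ck[unfolded Ck_on.simps]] mem])
  then obtain D where D: "(g has_derivative D) (at (- \<theta> u, c z))"
    by (auto simp: differentiable_def)
  have c1: "((\<lambda>s. (- \<theta> s, c (\<gamma> s))) has_vector_derivative (- l, l *\<^sub>R v)) (at u)"
    using \<theta> C(3) by (intro has_vector_derivative_Pair has_vector_derivative_minus)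
      (simp add: has_real_derivative_iff_has_vector_derivative)
  have 1: "((\<lambda>s. g (- \<theta> s, c (\<gamma> s))) has_vector_derivative D (- l, l *\<^sub>R v)) (at u)"
    by (rule has_vector_derivative_chain[OF _ c1]) (use D in \<open>simp add: z_def\<close>)
  have \<psi>z: "continuous_map euclideanreal N (\<lambda>s. \<psi> s z)"
    by (rule flow_continuous_compose[OF fl]) (use z in auto)
  have c2: "((\<lambda>s. (- \<theta> u - s, c (\<psi> s z))) has_vector_derivative (- 1, v)) (at 0)"
    using v by (intro has_vector_derivative_Pair) (auto intro!: derivative_eq_intros simp: z_def)
  have 2: "((\<lambda>s. g (- \<theta> u - s, c (\<psi> s z))) has_vector_derivative D (- 1, v)) (at 0)"
    by (rule has_vector_derivative_chain[OF _ c2]) (use D z flow_zero[OF fl] in simp)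
  have 3: "((\<lambda>s. e (\<psi> (- \<theta> u) z)) has_vector_derivative D (- 1, v)) (at 0)"
  proof (rule has_vector_derivative_transform_within_open[OF 2 open_preimage_curve[OF \<psi>z oU]])
    show "0 \<in> {s. \<psi> s z \<in> U}" using z flow_zero[OF fl] by simp
    fix s assume "s \<in> {s. \<psi> s z \<in> U}"
    then show "g (- \<theta> u - s, c (\<psi> s z)) = e (\<psi> (- \<theta> u) z)"
      using ginv[of "\<psi> s z" "- \<theta> u - s"] flow_add[OF fl z(2), of "- \<theta> u - s" s] by simp
  qed
  have "D (- 1, v) = 0"
    using vector_derivative_unique_at[OF 3 has_vector_derivative_const] .
  moreover have "D (- l, l *\<^sub>R v) = l *\<^sub>R D (- 1, v)"
    using linear_cmul[OF has_derivative_linear[OF D], of l "(-1, v)"] by simp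
  ultimately have 4: "((\<lambda>s. g (- \<theta> s, c (\<gamma> s))) has_vector_derivative 0) (at u)" using 1 by simp
  show ?thesis
    by (rule has_vector_derivative_transform_within_open[OF 4 open_preimage_curve[OF \<gamma> oU]])
      (use C(2) ginv in auto)
qed

text \<open>Uniqueness of integral curves, up to a change of time. It serves orbits that avoid the
  brake (\<open>\<gamma>\<close> an orbit of the suspension flow, \<open>\<theta>\<close> the time
  change) and points on the brake (\<open>\<gamma>\<close> constant). The derivative is visible in
  charts only, so the pulled back curve is constant on balls that it maps into one chart, and then
  on the connected line.\<close>

lemma C1_flow_pullback_constant:
  assumes atlas: "smooth_atlas N A" and \<psi>: "C1_flow N A \<psi>"
    and \<gamma>: "continuous_map euclideanreal N \<gamma>" and \<theta>: "\<And>u. (\<theta> has_real_derivative l u) (at u)"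
    and C: "\<And>u U c. (U, c) \<in> A \<Longrightarrow> \<gamma> u \<in> U \<Longrightarrow>
      ((\<lambda>s. c (\<gamma> s)) has_vector_derivative l u *\<^sub>R v (U, c) (\<gamma> u)) (at u)"
    and v: "\<And>u U c. (U, c) \<in> A \<Longrightarrow> \<gamma> u \<in> U \<Longrightarrow>
      ((\<lambda>s. c (\<psi> s (\<gamma> u))) has_vector_derivative v (U, c) (\<gamma> u)) (at 0)"
  shows "\<psi> (- \<theta> a) (\<gamma> a) = \<psi> (- \<theta> b) (\<gamma> b)"
proof -
  have fl: "flow N \<psi>" using \<psi> by (simp add: C1_flow_def)
  have cov: "\<exists>U c. (U, c) \<in> A \<and> p \<in> U" if "p \<in> topspace N" for p
  proof -
    have "p \<in> \<Union> (fst ` A)" using atlas that by (simp add: smooth_atlas_def)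
    then obtain UC where "UC \<in> A" "p \<in> fst UC" by blast
    then show ?thesis by (intro exI[of _ "fst UC"] exI[of _ "snd UC"]) simp
  qed
  let ?w = "\<lambda>s. \<psi> (- \<theta> s) (\<gamma> s)"
  have "continuous_on UNIV \<theta>"
    by (rule DERIV_continuous_on) (use \<theta> in \<open>auto intro: has_field_derivative_at_within\<close>)
  then have "continuous_map euclideanreal euclideanreal (\<lambda>s. - \<theta> s)"
    by (simp add: continuous_on_minus)
  then have w: "continuous_map euclideanreal N ?w"
    by (rule flow_continuous_compose[OF fl _ \<gamma>])
  have N: "?w s \<in> topspace N" "\<gamma> s \<in> topspace N" for s
    using continuous_map_image_subset_topspace[OF w] continuous_map_image_subset_topspace[OF \<gamma>]
    by (auto simp: image_subset_iff)
  have loc: "\<exists>T. openin (top_of_set UNIV) T \<and> u \<in> T \<and> (\<forall>x\<in>T. ?w x = ?w u)" for u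
  proof -
    obtain V e where E: "(V, e) \<in> A" "?w u \<in> V" using cov[OF N(1)] by blast
    have oV: "openin N V" and hom: "homeomorphic_map (subtopology N V) (top_of_set (e ` V)) e"
      using atlas E(1) unfolding smooth_atlas_def by auto
    have inj: "inj_on e V"
      using homeomorphic_imp_injective_map[OF hom] openin_subset[OF oV] by (simp add: Int_absorb1)
    have "open {s. ?w s \<in> V}" by (rule open_preimage_curve[OF w oV])
    moreover have "u \<in> {s. ?w s \<in> V}" using E(2) by simp
    ultimately obtain \<delta> where \<delta>: "\<delta> > 0" "ball u \<delta> \<subseteq> {s. ?w s \<in> V}" by (rule openE)
    have sub: "?w s \<in> V" if "s \<in> ball u \<delta>" for s using \<delta>(2) that by blast
    have der: "((\<lambda>s. e (?w s)) has_derivative (\<lambda>h. 0)) (at s within ball u \<delta>)" if s: "s \<in> ball u \<delta>" for s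
    proof -
      obtain U c where UC: "(U, c) \<in> A" "\<gamma> s \<in> U" using cov[OF N(2)] by blast
      have "((\<lambda>s. e (?w s)) has_vector_derivative 0) (at s)"
        by (rule C1_flow_pullback_derivative[OF atlas \<psi> \<gamma> \<theta> UC C[OF UC] v[OF UC] E(1) sub[OF s]])
      then have "((\<lambda>s. e (?w s)) has_derivative (\<lambda>h. 0)) (at s)"
        by (simp add: has_vector_derivative_def)
      then show ?thesis by (rule has_derivative_at_withinI)
    qed
    have u: "u \<in> ball u \<delta>" using \<delta>(1) by simp
    have const: "?w x = ?w u" if x: "x \<in> ball u \<delta>" for x
    proof -
      have "e (?w x) = e (?w u)"
        by (rule has_derivative_zero_unique[OF convex_ball der x u])
      then show ?thesis by (rule inj_onD[OF inj _ sub[OF x] E(2)])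
    qed
    show ?thesis
    proof (intro exI[of _ "ball u \<delta>"] conjI ballI)
      show "openin (top_of_set UNIV) (ball u \<delta>)" by simp
    qed (rule u, rule const)
  qed
  have "?w constant_on UNIV"
    by (rule locally_constant_imp_constant[OF connected_UNIV loc])
  then show ?thesis unfolding constant_on_def by auto
qed

lemma continuous_antiderivative:
  fixes f :: "real \<Rightarrow> real"
  assumes "continuous_on UNIV f"
  obtains T where "T 0 = 0" "\<And>u. (T has_real_derivative f u) (at u)"
proof -
  obtain F where F: "\<And>u. (F has_vector_derivative f u) (at u)"
    using einterval_antiderivative[of "-\<infinity>" "\<infinity>" f] assms
    by (auto simp: continuous_on_eq_continuous_at)
  show ?thesis
    by (rule that[of "\<lambda>u. F u - F 0"])
      (use F in \<open>auto intro!: derivative_eq_intros simp: has_real_derivative_iff_has_vector_derivative\<close>)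
qed

lemma velocity_along_flow:
  assumes fl: "flow N \<phi>" and vel: "has_velocity_field N A \<phi>" and p: "p \<in> topspace N"
    and C: "(U, c) \<in> A" "\<phi> u p \<in> U"
  shows "((\<lambda>s. c (\<phi> s p)) has_vector_derivative velocity \<phi> (U, c) (\<phi> u p)) (at u)"
proof -
  have "(\<lambda>t. c (\<phi> t (\<phi> u p))) differentiable (at 0)"
    using vel C unfolding has_velocity_field_def by blast
  then have 1: "((\<lambda>t. c (\<phi> t (\<phi> u p))) has_vector_derivative velocity \<phi> (U, c) (\<phi> u p)) (at (u - u))"
    by (simp add: velocity_def vector_derivative_works)
  have "((\<lambda>s. s - u) has_vector_derivative 1) (at u)"
    by (auto intro!: derivative_eq_intros)
  from vector_diff_chain_at[OF this 1]
  have "((\<lambda>s. c (\<phi> (s - u) (\<phi> u p))) has_vector_derivative velocity \<phi> (U, c) (\<phi> u p)) (at u)"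
    by (simp add: comp_def)
  moreover have "\<phi> (s - u) (\<phi> u p) = \<phi> s p" for s
    using flow_add[OF fl p, of "s - u" u] by simp
  ultimately show ?thesis by simp
qed

text \<open>Along the suspension orbit the velocity is \<open>1 / \<alpha>\<close> times the braked
  field, so an antiderivative \<open>T\<close> of \<open>1 / \<alpha>\<close> is the right time
  change. It exists on the whole line because the orbit never meets \<open>S\<close>.\<close>

lemma braked_flow_reparam:
  assumes atlas: "smooth_atlas N A" and \<psi>: "C1_flow N A \<psi>"
    and fl: "flow N \<phi>" and vel: "has_velocity_field N A \<phi>" and br: "brake N A S \<alpha>"
    and braked: "\<And>p t U c. p \<in> topspace N \<Longrightarrow> (U, c) \<in> A \<Longrightarrow> \<psi> t p \<in> U \<Longrightarrow>
       ((\<lambda>s. c (\<psi> s p)) has_vector_derivative \<alpha> (\<psi> t p) *\<^sub>R velocity \<phi> (U, c) (\<psi> t p)) (at t)"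
    and p: "p \<in> topspace N" "\<And>u. \<phi> u p \<notin> S"
  obtains T where "T 0 = 0" "\<And>u. (T has_real_derivative 1 / \<alpha> (\<phi> u p)) (at u)" "\<And>u. \<psi> (T u) p = \<phi> u p"
proof -
  have fl\<psi>: "flow N \<psi>" using \<psi> by (simp add: C1_flow_def)
  have \<phi>p: "continuous_map euclideanreal N (\<lambda>u. \<phi> u p)"
    by (rule flow_continuous_compose[OF fl]) (use p in auto)
  have "continuous_map N euclideanreal \<alpha>"
    using br unfolding brake_def Ck_map_def by blast
  then have "continuous_on UNIV (\<lambda>u. \<alpha> (\<phi> u p))"
    using continuous_map_compose[OF \<phi>p, of euclideanreal \<alpha>] by (simp add: comp_def)
  moreover have ne: "\<alpha> (\<phi> u p) \<noteq> 0" for u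
    using br p flow_in[OF fl p(1)] by (auto simp: brake_def)
  ultimately have "continuous_on UNIV (\<lambda>u. 1 / \<alpha> (\<phi> u p))"
    by (intro continuous_on_divide) auto
  then obtain T where T: "T 0 = 0" "\<And>u. (T has_real_derivative 1 / \<alpha> (\<phi> u p)) (at u)"
    by (rule continuous_antiderivative) blast
  have "\<psi> (- T u) (\<phi> u p) = \<psi> (- T 0) (\<phi> 0 p)" for u
  proof (rule C1_flow_pullback_constant[OF atlas \<psi> \<phi>p T(2), of "\<lambda>C z. \<alpha> z *\<^sub>R velocity \<phi> C z"])
    fix u U c assume C: "(U, c) \<in> A" "\<phi> u p \<in> U"
    show "((\<lambda>s. c (\<phi> s p)) has_vector_derivative (1 / \<alpha> (\<phi> u p)) *\<^sub>R \<alpha> (\<phi> u p) *\<^sub>R velocity \<phi> (U, c) (\<phi> u p)) (at u)"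
      using velocity_along_flow[OF fl vel p(1) C] ne[of u] by simp
    show "((\<lambda>s. c (\<psi> s (\<phi> u p))) has_vector_derivative \<alpha> (\<phi> u p) *\<^sub>R velocity \<phi> (U, c) (\<phi> u p)) (at 0)"
      using braked[OF flow_in[OF fl p(1)] C(1), of 0 u] C(2) flow_zero[OF fl\<psi> flow_in[OF fl p(1)], of u] by simp
  qed
  then have *: "\<psi> (- T u) (\<phi> u p) = p" for u
    using T(1) p flow_zero[OF fl] flow_zero[OF fl\<psi>] by simp
  have "\<psi> (T u) p = \<phi> u p" for u
  proof -
    have "\<psi> (T u + - T u) (\<phi> u p) = \<psi> (T u) (\<psi> (- T u) (\<phi> u p))"
      by (rule flow_add[OF fl\<psi> flow_in[OF fl p(1)]])
    then show ?thesis using * flow_zero[OF fl\<psi> flow_in[OF fl p(1)]] by simp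
  qed
  with T show ?thesis using that by blast
qed

text \<open>At a zero of \<open>\<alpha>\<close> the constant curve solves the braked equation, and
  pulling it back along \<open>\<psi>\<close> shows that the orbit of \<open>p\<close> does not
  move.\<close>

lemma braked_flow_fixed:
  assumes atlas: "smooth_atlas N A" and \<psi>: "C1_flow N A \<psi>" and br: "brake N A S \<alpha>"
    and braked: "\<And>p t U c. p \<in> topspace N \<Longrightarrow> (U, c) \<in> A \<Longrightarrow> \<psi> t p \<in> U \<Longrightarrow>
       ((\<lambda>s. c (\<psi> s p)) has_vector_derivative \<alpha> (\<psi> t p) *\<^sub>R velocity \<phi> (U, c) (\<psi> t p)) (at t)"
    and p: "p \<in> topspace N" "p \<in> S"
  shows "\<psi> t p = p"
proof -
  have fl: "flow N \<psi>" using \<psi> by (simp add: C1_flow_def)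
  have \<alpha>: "\<alpha> p = 0" using br p by (simp add: brake_def)
  have "\<psi> (- (- t)) p = \<psi> (- 0) p"
  proof (rule C1_flow_pullback_constant[OF atlas \<psi>, of "\<lambda>_. p" "\<lambda>u. u" "\<lambda>_. 1" "\<lambda>_ _. 0"])
    fix U c assume C: "(U, c) \<in> A" "p \<in> U"
    show "((\<lambda>s. c (\<psi> s p)) has_vector_derivative 0) (at 0)"
      using braked[OF p(1) C(1), of 0] C(2) flow_zero[OF fl p(1)] \<alpha> by simp
  qed (use p in auto)
  then show ?thesis using flow_zero[OF fl p(1)] by simp
qed

section \<open>Changes of time on the line\<close>

text \<open>Mere positivity of the derivative would yield monotonicity only; the uniform bound
  \<open>c\<close> makes \<open>T\<close> unbounded in both directions.\<close>

lemma deriv_bounded_below_strict_mono_surj: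
  fixes T :: "real \<Rightarrow> real"
  assumes T: "\<And>u. (T has_real_derivative T' u) (at u)" and c: "c > 0" "\<And>u. T' u \<ge> c"
  shows "strict_mono T" "surj T"
proof -
  show mono: "strict_mono T"
  proof (rule strict_monoI)
    fix x y :: real assume "x < y"
    then show "T x < T y"
      by (rule DERIV_pos_imp_increasing) (use T c in \<open>meson less_le_trans\<close>)
  qed
  have lower: "T v - T u \<ge> c * (v - u)" if "u \<le> v" for u v
  proof -
    have "T u - c * u \<le> T v - c * v"
    proof (rule DERIV_nonneg_imp_nondecreasing[OF that])
      fix w
      have "((\<lambda>u. T u - c * u) has_real_derivative T' w - c * 1) (at w)"
        by (intro DERIV_diff T DERIV_cmult DERIV_ident)
      then show "\<exists>y. ((\<lambda>u. T u - c * u) has_real_derivative y) (at w) \<and> 0 \<le> y"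
        using c(2)[of w] by (intro exI[of _ "T' w - c * 1"]) simp
    qed
    then show ?thesis by (simp add: algebra_simps)
  qed
  have cont: "isCont T u" for u using T by (rule DERIV_isCont)
  show "surj T"
  proof (unfold surj_def, intro allI)
    fix y
    define L where "L = \<bar>y - T 0\<bar> / c"
    have L: "L \<ge> 0" "c * L = \<bar>y - T 0\<bar>" using c by (simp_all add: L_def)
    have "T L \<ge> y" using lower[of 0 L] L by simp
    moreover have "T (- L) \<le> y" using lower[of "- L" 0] L by simp
    ultimately have "\<exists>x\<ge>- L. x \<le> L \<and> T x = y" using L cont by (intro IVT) auto
    then show "\<exists>x. y = T x" by blast
  qed
qed

text \<open>With \<open>\<rho> n\<close> the roof height over the \<open>n\<close>-th point of a
  base orbit, \<open>g\<close> turns a position counted in fibres (an integer plus a relative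
  height) into suspension time. Its values at integers are two-sided Birkhoff sums of the roof, and
  \<open>c\<close> makes them unbounded in both directions.\<close>

lemma linear_interpolation:
  fixes \<rho> :: "int \<Rightarrow> real"
  assumes c: "c > 0" "\<And>n. \<rho> n \<ge> c"
  obtains g where "strict_mono g" "surj g" "g 0 = 0"
    "\<And>n s. s \<in> {0..1} \<Longrightarrow> g (of_int n + s) = g (of_int n) + s * \<rho> n"
proof -
  \<comment> \<open>For negative \<open>n\<close> the summand with index \<open>i\<close> belongs to
    the fibre \<open>- i - 1\<close>, so that \<open>a (n + 1) = a n + \<rho> n\<close> also holds
    across 0.\<close>
  define a where "a n = (if n \<ge> 0 then (\<Sum>i<nat n. \<rho> (int i)) else - (\<Sum>i<nat (- n). \<rho> (- int i - 1)))" for n :: int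
  have a0: "a 0 = 0" by (simp add: a_def)
  have aSuc: "a (n + 1) = a n + \<rho> n" for n
  proof (cases "n \<ge> 0")
    case True
    then show ?thesis by (simp add: a_def nat_add_distrib)
  next
    case False
    then have "nat (- n) = Suc (nat (- (n + 1)))" "- int (nat (- (n + 1))) - 1 = n" by auto
    then show ?thesis using False by (auto simp: a_def)
  qed
  have pos: "\<rho> n > 0" for n using c by (meson less_le_trans)
  have mono: "a m \<le> a n" if "m \<le> n" for m n
    using that
  proof (induction rule: int_ge_induct)
    case (step i)
    then show ?case using aSuc[of i] pos[of i] by simp
  qed simp
  define g where "g w = a \<lfloor>w\<rfloor> + frac w * \<rho> \<lfloor>w\<rfloor>" for w
  have g_int: "g (of_int n) = a n" for n by (simp add: g_def)
  have g_add: "g (of_int n + s) = g (of_int n) + s * \<rho> n" if s: "s \<in> {0..1}" for n s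
  proof (cases "s = 1")
    case True
    then show ?thesis using g_int[of n] g_int[of "n + 1"] aSuc by simp
  next
    case False
    then have "\<lfloor>of_int n + s\<rfloor> = n" using s by (intro floor_unique) auto
    then show ?thesis by (simp add: g_def frac_def)
  qed
  have upper: "g w < a (\<lfloor>w\<rfloor> + 1)" for w
    using frac_lt_1[of w] pos[of "\<lfloor>w\<rfloor>"] by (simp add: g_def aSuc)
  have lower: "a \<lfloor>w\<rfloor> \<le> g w" for w
    using pos[of "\<lfloor>w\<rfloor>"] by (simp add: g_def)
  have "strict_mono g"
  proof (rule strict_monoI)
    fix x y :: real assume xy: "x < y"
    show "g x < g y"
    proof (cases "\<lfloor>x\<rfloor> = \<lfloor>y\<rfloor>")
      case True
      then have "frac x < frac y" using xy by (simp add: frac_def)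
      then show ?thesis using True pos by (simp add: g_def)
    next
      case False
      then have "\<lfloor>x\<rfloor> + 1 \<le> \<lfloor>y\<rfloor>" using floor_mono[of x y] xy by simp
      from mono[OF this] show ?thesis using upper[of x] lower[of y] by simp
    qed
  qed
  moreover have "surj g"
  proof (unfold surj_def, intro allI)
    fix y
    have up: "a (int k) \<ge> c * k" for k :: nat
    proof (induction k)
      case (Suc k)
      then show ?case using aSuc[of "int k"] c(2)[of "int k"] by (simp add: algebra_simps)
    qed (simp add: a0)
    have dn: "a (- int k) \<le> - (c * k)" for k :: nat
    proof (induction k)
      case (Suc k)
      then show ?case using aSuc[of "- int (Suc k)"] c(2)[of "- int (Suc k)"] by (simp add: algebra_simps)
    qed (simp add: a0)
    obtain L :: nat where L: "\<bar>y\<bar> / c < real L" using reals_Archimedean2 by blast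
    then have Ly: "\<bar>y\<bar> < c * L" using c(1) by (simp add: pos_divide_less_eq mult.commute)
    \<comment> \<open>The search starts at \<open>- L\<close>, where \<open>a\<close> is below
      \<open>y\<close>; the least \<open>k\<close> yields the integer \<open>n = k - L\<close> with
      \<open>a n \<le> y < a (n + 1)\<close>.\<close>
    let ?P = "\<lambda>k. y < a (- int L + int k + 1)"
    have "?P (2 * L)" using up[of "Suc L"] Ly c(1) by (simp add: algebra_simps)
    define k where "k = (LEAST k. ?P k)"
    have k: "?P k" unfolding k_def by (rule LeastI[of ?P, OF \<open>?P (2 * L)\<close>])
    have k': "a (- int L + int k) \<le> y"
    proof (cases k)
      case 0
      then show ?thesis using dn[of L] Ly by simp
    next
      case (Suc j)
      then have "\<not> ?P j" unfolding k_def using not_less_Least[of j ?P] k_def by simp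
      then show ?thesis using Suc by (simp add: algebra_simps)
    qed
    define n where "n = - int L + int k"
    define s where "s = (y - a n) / \<rho> n"
    have "0 \<le> s" using k' pos[of n] by (simp add: s_def n_def)
    moreover have "s \<le> 1" using k aSuc[of n] pos[of n] by (simp add: s_def n_def pos_divide_le_eq)
    ultimately have "g (of_int n + s) = a n + s * \<rho> n" using g_add[of s n] g_int by simp
    also have "\<dots> = y" using pos[of n] by (simp add: s_def)
    finally have "y = g (of_int n + s)" by simp
    then show "\<exists>x. y = g x" by blast
  qed
  ultimately show ?thesis using that[of g] g_int[of 0] a0 g_add by simp
qed

section \<open>Separated orbits of a braked suspension\<close>

lemma strict_mono_surj_inv:
  fixes h :: "real \<Rightarrow> real"
  assumes "strict_mono h" "surj h"
  shows "continuous_on UNIV h" "strict_mono (inv h)" "surj (inv h)" "\<And>t. h (inv h t) = t" "\<And>t. inv h (h t) = t"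
proof -
  have inj: "inj h" using assms(1) by (rule strict_mono_imp_inj_on)
  show "continuous_on UNIV h"
    by (rule continuous_onI_mono) (use assms strict_mono_mono in \<open>auto simp: mono_def\<close>)
  show 1: "h (inv h t) = t" for t using assms(2) by (rule surj_f_inv_f)
  show "inv h (h t) = t" for t using inj by simp
  show "surj (inv h)" using inj by (rule inj_imp_surj_inv)
  show "strict_mono (inv h)"
  proof (rule strict_monoI)
    fix x y :: real assume "x < y"
    then have "h (inv h x) < h (inv h y)" by (simp add: 1)
    then show "inv h x < inv h y" using assms(1) strict_mono_less by blast
  qed
qed

lemma RepI:
  assumes "strict_mono h" "surj h" "h 0 = 0"
  shows "h \<in> Rep"
proof -
  note i = strict_mono_surj_inv[OF assms(1,2)]
  have "homeomorphism UNIV UNIV h (inv h)"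
    unfolding homeomorphism_def
    using i strict_mono_surj_inv(1)[OF i(2,3)] assms(2) by simp
  then show ?thesis using assms unfolding Rep_def by blast
qed

context compact_homeo
begin

definition iter :: "int \<Rightarrow> 'k \<Rightarrow> 'k" where
  "iter n x = (if n \<ge> 0 then (F ^^ nat n) x else (G ^^ nat (- n)) x)"

lemma iter_0: "iter 0 x = x"
  and iter_nat: "iter (int n) x = (F ^^ n) x"
  and iter_neg: "iter (- int n) x = (G ^^ n) x"
  by (auto simp: iter_def)

lemma iter_in: "x \<in> K \<Longrightarrow> iter n x \<in> K"
  by (simp add: iter_def Fn_in Gn_in)

lemma iter_Suc: "x \<in> K \<Longrightarrow> iter (n + 1) x = F (iter n x)"
proof (cases "n \<ge> 0")
  case True
  then show ?thesis by (simp add: iter_def nat_add_distrib)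
next
  case False
  assume x: "x \<in> K"
  have "nat (- n) = Suc (nat (- (n + 1)))" using False by simp
  then have "iter n x = G ((G ^^ nat (- (n + 1))) x)" using False by (simp add: iter_def)
  then have "F (iter n x) = (G ^^ nat (- (n + 1))) x" using x by (simp add: FG Gn_in)
  moreover have "iter (n + 1) x = (G ^^ nat (- (n + 1))) x"
    using False by (auto simp: iter_def)
  ultimately show ?thesis by simp
qed

lemma iter_F: "x \<in> K \<Longrightarrow> iter n (F x) = iter (n + 1) x"
proof (cases "n \<ge> 0")
  case True
  then show ?thesis by (simp add: iter_def nat_add_distrib funpow_swap1)
next
  case False
  assume x: "x \<in> K"
  have "nat (- n) = Suc (nat (- (n + 1)))" using False by simp
  then have "iter n (F x) = (G ^^ nat (- (n + 1))) x"
    using False x by (simp add: iter_def funpow_swap1[of G] GF)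
  then show ?thesis using False by (auto simp: iter_def)
qed

lemma iter_G: "x \<in> K \<Longrightarrow> iter n (G x) = iter (n - 1) x"
  using iter_F[of "G x" "n - 1"] by (simp add: G_in FG)

lemma inj_on_iter: "inj_on (iter n) K"
proof (cases "n \<ge> 0")
  case True
  then show ?thesis
    by (intro inj_on_inverseI[of _ "G ^^ nat n"]) (simp add: iter_def GnFn)
next
  case False
  then show ?thesis
    by (intro inj_on_inverseI[of _ "F ^^ nat (- n)"]) (simp add: iter_def FnGn)
qed

lemma countable_orbit_preimage: "finite P \<Longrightarrow> countable {x \<in> K. \<exists>n. iter n x \<in> P}"
proof -
  assume P: "finite P"
  have "{x \<in> K. \<exists>n. iter n x \<in> P} = (\<Union>n. iter n -` P \<inter> K)" by auto
  moreover have "countable (\<Union>n. iter n -` P \<inter> K)"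
    by (intro countable_UN countableI_type countable_finite finite_vimage_IntI[OF P inj_on_iter])
  ultimately show ?thesis by simp
qed

end

text \<open>\<open>F\<close> is the base map, \<open>Q x s\<close> is the point at relative height \<open>s\<close> over \<open>x\<close>, and \<open>H x\<close> is the
  time that the flow takes to travel along the fibres over the orbit of \<open>x\<close>. The points over \<open>P\<close> are those
  that are stopped by the brake; \<open>z\<close> maps the suspension to the circle.\<close>

locale braked_suspension = compact_homeo K F G
  for K :: "'k::metric_space set" and F G +
  fixes X :: "'k set" and \<psi> :: "real \<Rightarrow> 'k \<Rightarrow> 'k" and Q :: "'k \<Rightarrow> real \<Rightarrow> 'k" and z :: "'k \<Rightarrow> complex"
    and P :: "'k set" and H :: "'k \<Rightarrow> real \<Rightarrow> real"
  assumes compact_X: "compact X"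
    and \<psi>_cont: "continuous_on (UNIV \<times> X) (\<lambda>(t, x). \<psi> t x)"
    and \<psi>_in: "x \<in> X \<Longrightarrow> \<psi> t x \<in> X" and \<psi>_0: "x \<in> X \<Longrightarrow> \<psi> 0 x = x"
    and \<psi>_add: "x \<in> X \<Longrightarrow> \<psi> (s + t) x = \<psi> s (\<psi> t x)"
    and Q_cont: "continuous_on (K \<times> {0..1}) (\<lambda>(x, s). Q x s)"
    and Q_in: "x \<in> K \<Longrightarrow> s \<in> {0..1} \<Longrightarrow> Q x s \<in> X"
    and Q_0: "x \<in> K \<Longrightarrow> Q x 0 = x" and Q_1: "x \<in> K \<Longrightarrow> Q x 1 = F x"
    and z_cont: "continuous_on X z"
    and z_Q: "x \<in> K \<Longrightarrow> s \<in> {0..1} \<Longrightarrow> z (Q x s) = cis (2 * pi * s)"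
    and finite_P: "finite P" and P_subset: "P \<subseteq> K"
    and H: "x \<in> K \<Longrightarrow> (\<And>n. iter n x \<notin> P) \<Longrightarrow> strict_mono (H x) \<and> surj (H x) \<and> H x 0 = 0"
    and \<psi>_H: "x \<in> K \<Longrightarrow> (\<And>n. iter n x \<notin> P) \<Longrightarrow> s \<in> {0..1} \<Longrightarrow> \<psi> (H x (of_int n + s)) x = Q (iter n x) s"
    and H_bound: "r > 0 \<Longrightarrow> \<exists>R. \<forall>x\<in>K. (\<forall>n. iter n x \<notin> P) \<longrightarrow>
       (\<forall>n. (\<forall>p\<in>P. dist (iter n x) p \<ge> r) \<longrightarrow> H x (of_int n + 1) - H x (of_int n) \<le> R)"
    and expansive: "\<exists>\<delta>>0. \<forall>x\<in>X. \<forall>y\<in>X. \<forall>h\<in>Rep. (\<forall>t. dist (\<psi> t x) (\<psi> (h t) y) \<le> \<delta>) \<longrightarrow> (\<exists>s t. \<psi> s y = \<psi> t x)"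
    and nondegenerate: "\<exists>C. continuum C \<and> \<not> thin 0 C"
begin

section \<open>Continuum-wise expansiveness of the base map\<close>

text \<open>The base points whose flow orbit runs through all fibres over their base orbit; the
  assumptions on \<open>H\<close> concern these points only.\<close>

definition regular :: "'k \<Rightarrow> bool" where
  "regular x \<longleftrightarrow> x \<in> K \<and> (\<forall>n. iter n x \<notin> P)"

lemma regular_in: "regular x \<Longrightarrow> x \<in> K" by (simp add: regular_def)

lemma K_subset: "K \<subseteq> X"
  using Q_in[of _ 0] Q_0 by force

lemma regular_H:
  assumes "regular x"
  shows "strict_mono (H x)" "surj (H x)" "H x 0 = 0"
  using H[of x] assms by (auto simp: regular_def)

lemma regular_\<psi>_H:
  assumes "regular x" "s \<in> {0..1}"
  shows "\<psi> (H x (of_int n + s)) x = Q (iter n x) s"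
  using \<psi>_H[of x s n] assms by (auto simp: regular_def)

lemma regular_\<psi>_floor:
  assumes "regular x"
  shows "\<psi> (H x w) x = Q (iter \<lfloor>w\<rfloor> x) (frac w)"
proof -
  have "frac w \<in> {0..1}" using frac_lt_1[of w] by (simp add: less_imp_le)
  from regular_\<psi>_H[OF assms this, of "\<lfloor>w\<rfloor>"] show ?thesis by (simp add: frac_def)
qed

lemma cis_frac: "cis (2 * pi * frac w) = cis (2 * pi * w)"
proof -
  have "2 * pi * frac w = 2 * pi * w + 2 * pi * of_int (- \<lfloor>w\<rfloor>)" by (simp add: frac_def algebra_simps)
  then have "cis (2 * pi * frac w) = cis (2 * pi * w) * cis (2 * pi * of_int (- \<lfloor>w\<rfloor>))"
    by (simp add: cis_mult)
  also have "cis (2 * pi * of_int (- \<lfloor>w\<rfloor>)) = 1" by (rule cis_multiple_2pi) (rule Ints_of_int)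
  finally show ?thesis by simp
qed

lemma z_regular:
  assumes "regular x"
  shows "z (\<psi> (H x w) x) = cis (2 * pi * w)"
proof -
  have "frac w \<in> {0..1}" using frac_lt_1[of w] by (simp add: less_imp_le)
  then show ?thesis
    using regular_in[OF assms] iter_in by (simp add: regular_\<psi>_floor[OF assms] z_Q cis_frac)
qed

lemma Q_unif:
  assumes "\<epsilon> > 0"
  shows "\<exists>\<eta>>0. \<forall>x\<in>K. \<forall>y\<in>K. \<forall>s\<in>{0..1}. \<forall>t\<in>{0..1}. dist x y < \<eta> \<longrightarrow> \<bar>s - t\<bar> < \<eta> \<longrightarrow> dist (Q x s) (Q y t) < \<epsilon>"
proof -
  have "uniformly_continuous_on (K \<times> {0..1}) (\<lambda>(x, s). Q x s)"
    by (intro compact_uniformly_continuous Q_cont compact_Times compact_K compact_Icc)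
  then obtain \<eta> where \<eta>: "\<eta> > 0" "\<And>u v. u \<in> K \<times> {0..1} \<Longrightarrow> v \<in> K \<times> {0..1} \<Longrightarrow> dist v u < \<eta> \<Longrightarrow>
      dist (case v of (x, s) \<Rightarrow> Q x s) (case u of (x, s) \<Rightarrow> Q x s) < \<epsilon>"
    using assms unfolding uniformly_continuous_on_def by meson
  show ?thesis
  proof (intro exI[of _ "\<eta>/2"] conjI ballI impI)
    fix x y s t assume *: "x \<in> K" "y \<in> K" "s \<in> {0..1::real}" "t \<in> {0..1}" "dist x y < \<eta>/2" "\<bar>s - t\<bar> < \<eta>/2"
    have "dist (x, s) (y, t) \<le> dist x y + dist s t"
      unfolding dist_Pair_Pair by (rule sqrt_sum_squares_le_sum) auto
    then have "dist (x, s) (y, t) < \<eta>" using * by (simp add: dist_real_def)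
    from \<eta>(2)[OF _ _ this] * show "dist (Q x s) (Q y t) < \<epsilon>" by simp
  qed (use \<eta> in simp)
qed

text \<open>The time change \<open>h = H y \<circ> inv (H x)\<close> lets both orbits pass the same
  relative heights simultaneously, so closeness of the base orbits becomes closeness of the flow
  orbits. The point \<open>y\<close> is also chosen off the countable base orbit of
  \<open>x\<close>. Once expansiveness puts \<open>y\<close> on the flow orbit of \<open>x\<close>,
  the value \<open>z y = 1\<close> forces a whole number of revolutions, so \<open>y\<close> would
  be an iterate of \<open>x\<close>.\<close>

lemma cw_expansive:
  "\<exists>c>0. \<forall>C. continuum C \<longrightarrow> (\<forall>n. thin c ((F ^^ n) ` C)) \<longrightarrow> (\<forall>n. thin c ((G ^^ n) ` C)) \<longrightarrow> thin 0 C"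
proof -
  obtain \<delta> where \<delta>: "\<delta> > 0" and \<delta>_exp: "\<forall>x\<in>X. \<forall>y\<in>X. \<forall>h\<in>Rep. (\<forall>t. dist (\<psi> t x) (\<psi> (h t) y) \<le> \<delta>) \<longrightarrow> (\<exists>s t. \<psi> s y = \<psi> t x)"
    using expansive by blast
  obtain \<eta> where \<eta>: "\<eta> > 0" and \<eta>_Q: "\<forall>x\<in>K. \<forall>y\<in>K. \<forall>s\<in>{0..1}. \<forall>t\<in>{0..1}. dist x y < \<eta> \<longrightarrow> \<bar>s - t\<bar> < \<eta> \<longrightarrow> dist (Q x s) (Q y t) < \<delta>"
    using Q_unif[OF \<delta>] by blast
  have "thin 0 C" if C: "continuum C" "\<And>n. thin (\<eta>/2) ((F ^^ n) ` C)" "\<And>n. thin (\<eta>/2) ((G ^^ n) ` C)" for C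
  proof (rule ccontr)
    assume "\<not> thin 0 C"
    then obtain a b where ab: "a \<in> C" "b \<in> C" "dist a b > 0" by (rule not_thinE)
    have CK: "C \<subseteq> K" "connected C" using C by (auto simp: continuum_def)
    have "a \<noteq> b" using ab(3) by auto
    then have unc: "uncountable C" using connected_uncountable[OF CK(2) ab(1,2)] by blast
    let ?D = "{x \<in> K. \<exists>n. iter n x \<in> P}"
    have D: "countable ?D" by (rule countable_orbit_preimage[OF finite_P])
    have "\<not> C \<subseteq> ?D" using unc D countable_subset by blast
    then obtain x where x: "x \<in> C" "regular x" using CK by (auto simp: regular_def)
    have "countable (range (\<lambda>n. iter n x))" by simp
    then have "countable (?D \<union> range (\<lambda>n. iter n x))" using D by blast
    then have "\<not> C \<subseteq> ?D \<union> range (\<lambda>n. iter n x)" using unc countable_subset by blast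
    then obtain y where y: "y \<in> C" "y \<notin> ?D" "y \<notin> range (\<lambda>n. iter n x)" by blast
    then have ry: "regular y" using CK by (auto simp: regular_def)
    note Hx = regular_H[OF x(2)] and Hy = regular_H[OF ry]
    note ix = strict_mono_surj_inv[OF Hx(1,2)] and iy = strict_mono_surj_inv[OF Hy(1,2)]
    have xK: "x \<in> K" and yK: "y \<in> K" using x(1) y(1) CK(1) by blast+
    define h where "h = H y \<circ> inv (H x)"
    have h: "h \<in> Rep"
    proof (rule RepI)
      show "strict_mono h" unfolding h_def by (rule strict_mono_o[OF Hy(1) ix(2)])
      show "surj h" unfolding h_def by (rule comp_surj[OF ix(3) Hy(2)])
      show "h 0 = 0" using ix(5)[of 0] Hx(3) Hy(3) by (simp add: h_def)
    qed
    have close: "dist (\<psi> t x) (\<psi> (h t) y) \<le> \<delta>" for t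
    proof -
      define w where "w = inv (H x) t"
      have t: "t = H x w" "h t = H y w" by (simp_all add: w_def h_def ix(4))
      have fr: "frac w \<in> {0..1}" using frac_lt_1[of w] by (simp add: less_imp_le)
      have "dist (iter n x) (iter n y) \<le> \<eta>/2" for n
      proof (cases "n \<ge> 0")
        case True
        then show ?thesis using C(2)[of "nat n"] x(1) y(1) unfolding thin_def iter_def by simp
      next
        case False
        then show ?thesis using C(3)[of "nat (- n)"] x(1) y(1) unfolding thin_def iter_def by simp
      qed
      from this[of "\<lfloor>w\<rfloor>"] have "dist (iter \<lfloor>w\<rfloor> x) (iter \<lfloor>w\<rfloor> y) < \<eta>" using \<eta> by linarith
      then have "dist (Q (iter \<lfloor>w\<rfloor> x) (frac w)) (Q (iter \<lfloor>w\<rfloor> y) (frac w)) < \<delta>"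
        using \<eta>_Q[rule_format, OF iter_in[OF xK] iter_in[OF yK] fr fr] \<eta> by simp
      then show ?thesis
        unfolding t(2) by (simp add: t(1) regular_\<psi>_floor[OF x(2)] regular_\<psi>_floor[OF ry])
    qed
    have xyX: "x \<in> X" "y \<in> X" using xK yK K_subset by blast+
    have "\<exists>s t. \<psi> s y = \<psi> t x"
      using bspec[OF bspec[OF bspec[OF \<delta>_exp xyX(1)] xyX(2)] h] close by simp
    then obtain s t where st: "\<psi> s y = \<psi> t x" by blast
    have "y = \<psi> (- s + s) y" using \<psi>_0[OF xyX(2)] by simp
    also have "\<dots> = \<psi> (- s) (\<psi> t x)" using \<psi>_add[OF xyX(2), of "-s" s] st by simp
    also have "\<dots> = \<psi> (- s + t) x" by (rule \<psi>_add[OF xyX(1), symmetric])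
    finally have "y = \<psi> (H x (inv (H x) (- s + t))) x" by (simp add: ix(4))
    then obtain w where w: "y = \<psi> (H x w) x" by blast
    have "z y = 1" using z_Q[OF yK, of 0] Q_0[OF yK] by simp
    then have "cis (2 * pi * w) = 1" using z_regular[OF x(2), of w] w by simp
    then have "cos (2 * pi * w) = 1" by (simp add: complex_eq_iff)
    then obtain n :: int where "2 * pi * w = of_int n * 2 * pi" by (auto simp: cos_one_2pi_int)
    then have "w = of_int n" by simp
    then have "y = iter n x"
      using w regular_\<psi>_floor[OF x(2), of w] Q_0[OF iter_in[OF regular_in[OF x(2)]]] by simp
    then show False using y(3) by blast
  qed
  moreover have "\<eta>/2 > 0" using \<eta> by simp
  ultimately show ?thesis by blast
qed

section \<open>From separated base orbits to separated flow orbits\<close>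

lemma z_unif:
  assumes "\<epsilon> > 0"
  shows "\<exists>\<eta>>0. \<forall>p\<in>X. \<forall>q\<in>X. dist p q < \<eta> \<longrightarrow> norm (z p - z q) < \<epsilon>"
proof -
  have "uniformly_continuous_on X z" by (rule compact_uniformly_continuous[OF z_cont compact_X])
  then show ?thesis using assms unfolding uniformly_continuous_on_def dist_norm by metis
qed

text \<open>Composing with \<open>z\<close> and lifting to the line shows that two orbits that stay close at equal
  times complete their revolutions in step, so that there is no need to compare return times.\<close>

lemma flow_close_imp_iter_close:
  assumes s0: "s0 > 0"
  shows "\<exists>\<epsilon>>0. \<forall>x y i. regular x \<longrightarrow> regular y \<longrightarrow>
    (\<forall>t\<in>closed_segment 0 (H x (of_int i)). dist (\<psi> t x) (\<psi> t y) \<le> \<epsilon>) \<longrightarrow> dist (iter i x) (iter i y) < s0"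
proof -
  have "s0/2 > 0" using s0 by simp
  then obtain \<eta>0 where \<eta>0: "\<eta>0 > 0" and \<eta>0_Q: "\<forall>x\<in>K. \<forall>y\<in>K. \<forall>s\<in>{0..1}. \<forall>t\<in>{0..1}. dist x y < \<eta>0 \<longrightarrow> \<bar>s - t\<bar> < \<eta>0 \<longrightarrow> dist (Q x s) (Q y t) < s0/2"
    using Q_unif by blast
  define \<eta> where "\<eta> = min (\<eta>0/2) (1/2)"
  have \<eta>: "\<eta> > 0" "\<eta> < \<eta>0" "\<eta> < 1" using \<eta>0 by (auto simp: \<eta>_def)
  \<comment> \<open>The chord of an arc of \<open>\<eta>\<close> revolutions: points of
    \<open>X\<close> closer than \<open>\<epsilon>0\<close> cannot differ by exactly
    \<open>\<eta>\<close> revolutions.\<close>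
  define \<kappa> where "\<kappa> = norm (cis (2 * pi * \<eta>) - 1)"
  have "cis (2 * pi * \<eta>) \<noteq> 1"
  proof
    assume "cis (2 * pi * \<eta>) = 1"
    then have "cos (2 * pi * \<eta>) = 1" by (simp add: complex_eq_iff)
    then obtain n :: int where "2 * pi * \<eta> = of_int n * 2 * pi" by (auto simp: cos_one_2pi_int)
    then have "\<eta> = of_int n" by simp
    then show False using \<eta> by simp
  qed
  then have \<kappa>: "\<kappa> > 0" by (simp add: \<kappa>_def)
  obtain \<epsilon>0 where \<epsilon>0: "\<epsilon>0 > 0" and \<epsilon>0_z: "\<forall>p\<in>X. \<forall>q\<in>X. dist p q < \<epsilon>0 \<longrightarrow> norm (z p - z q) < \<kappa>"
    using z_unif[OF \<kappa>] by blast
  define \<epsilon> where "\<epsilon> = min (\<epsilon>0/2) (s0/2)"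
  have \<epsilon>: "\<epsilon> > 0" "\<epsilon> < \<epsilon>0" "\<epsilon> \<le> s0/2" using \<epsilon>0 s0 by (auto simp: \<epsilon>_def)
  have "dist (iter i x) (iter i y) < s0"
    if rx: "regular x" and ry: "regular y" and close: "\<forall>t\<in>closed_segment 0 (H x (of_int i)). dist (\<psi> t x) (\<psi> t y) \<le> \<epsilon>"
    for x y i
  proof -
    have xK: "x \<in> K" and yK: "y \<in> K" using rx ry regular_in by auto
    then have xX: "x \<in> X" and yX: "y \<in> X" using K_subset by auto
    note ix = strict_mono_surj_inv[OF regular_H(1,2)[OF rx]] and iy = strict_mono_surj_inv[OF regular_H(1,2)[OF ry]]
    \<comment> \<open>The lag between the two orbits, in revolutions. It is continuous, starts at 0
      and never has absolute value \<open>\<eta>\<close>, so it stays below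
      \<open>\<eta>\<close>.\<close>
    define D where "D t = inv (H x) t - inv (H y) t" for t
    let ?S = "closed_segment 0 (H x (of_int i))"
    have contD: "continuous_on UNIV D"
      unfolding D_def by (intro continuous_on_diff strict_mono_surj_inv(1) ix iy)
    have D0: "D 0 = 0"
      using ix(5)[of 0] iy(5)[of 0] regular_H(3)[OF rx] regular_H(3)[OF ry] by (simp add: D_def)
    have no: "\<bar>D t\<bar> \<noteq> \<eta>" if t: "t \<in> ?S" for t
    proof
      assume eq: "\<bar>D t\<bar> = \<eta>"
      let ?a = "inv (H x) t" and ?b = "inv (H y) t"
      have "dist (\<psi> t x) (\<psi> t y) < \<epsilon>0" using close t \<epsilon>(2) by force
      then have "norm (z (\<psi> t x) - z (\<psi> t y)) < \<kappa>"
        using \<epsilon>0_z \<psi>_in[OF xX] \<psi>_in[OF yX] by blast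
      moreover have "z (\<psi> t x) = cis (2 * pi * ?a)" "z (\<psi> t y) = cis (2 * pi * ?b)"
        using z_regular[OF rx, of ?a] z_regular[OF ry, of ?b] by (simp_all add: ix(4) iy(4))
      moreover have "cis (2 * pi * ?a) - cis (2 * pi * ?b) = cis (2 * pi * ?b) * (cis (2 * pi * D t) - 1)"
        by (simp add: D_def cis_mult algebra_simps)
      ultimately have lt: "norm (cis (2 * pi * D t) - 1) < \<kappa>" by (simp add: norm_mult)
      have "norm (cis (2 * pi * D t) - 1) = \<kappa>"
      proof (cases "D t \<ge> 0")
        case True
        then show ?thesis using eq by (simp add: \<kappa>_def)
      next
        case False
        then have "D t = - \<eta>" using eq by simp
        then have "cis (2 * pi * D t) - 1 = cnj (cis (2 * pi * \<eta>) - 1)" by (simp add: cis_cnj)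
        then show ?thesis unfolding \<kappa>_def by (metis complex_mod_cnj)
      qed
      then show False using lt by simp
    qed
    have small: "\<bar>D t\<bar> < \<eta>" if t: "t \<in> ?S" for t
    proof (rule ccontr)
      assume ge: "\<not> \<bar>D t\<bar> < \<eta>"
      have conn: "connected ((\<lambda>t. \<bar>D t\<bar>) ` ?S)"
        by (intro connected_continuous_image continuous_on_rabs continuous_on_subset[OF contD] connected_segment) auto
      have "0 \<in> (\<lambda>t. \<bar>D t\<bar>) ` ?S" using D0 by (intro image_eqI[of _ _ 0]) auto
      moreover have "\<bar>D t\<bar> \<in> (\<lambda>t. \<bar>D t\<bar>) ` ?S" using t by blast
      ultimately have "\<eta> \<in> (\<lambda>t. \<bar>D t\<bar>) ` ?S"
        using connected_contains_Icc[OF conn] \<eta>(1) ge by force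
      then show False using no by blast
    qed
    let ?t = "H x (of_int i)"
    define v where "v = inv (H y) ?t"
    have v: "\<psi> ?t y = \<psi> (H y v) y" by (simp add: v_def iy(4))
    have "\<bar>of_int i - v\<bar> < \<eta>" using small[of ?t] by (simp add: D_def v_def ix(5))
    have xi: "\<psi> ?t x = iter i x"
      using regular_\<psi>_H[OF rx, of 0 i] Q_0[OF iter_in[OF xK]] by simp
    have near: "dist (\<psi> ?t y) (iter i y) < s0/2"
    proof (cases "v \<ge> of_int i")
      case True
      let ?s = "v - of_int i"
      have s: "?s \<in> {0..1}" "\<bar>?s - 0\<bar> < \<eta>0" using True \<open>\<bar>of_int i - v\<bar> < \<eta>\<close> \<eta> by auto
      have "\<psi> ?t y = Q (iter i y) ?s" using regular_\<psi>_H[OF ry s(1), of i] v by simp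
      moreover have "dist (Q (iter i y) ?s) (Q (iter i y) 0) < s0/2"
        using \<eta>0_Q[rule_format, OF iter_in[OF yK] iter_in[OF yK] s(1) _ _ s(2)] \<eta>0 by simp
      ultimately show ?thesis using Q_0[OF iter_in[OF yK]] by simp
    next
      case False
      \<comment> \<open>The orbit of \<open>y\<close> has not completed revolution \<open>i\<close>:
        it is near the top of the fibre over step \<open>i - 1\<close>, and that top is
        \<open>iter i y\<close>.\<close>
      let ?s = "v - of_int (i - 1)"
      have s: "?s \<in> {0..1}" "\<bar>?s - 1\<bar> < \<eta>0" using False \<open>\<bar>of_int i - v\<bar> < \<eta>\<close> \<eta> by auto
      have "\<psi> ?t y = Q (iter (i - 1) y) ?s" using regular_\<psi>_H[OF ry s(1), of "i - 1"] v by simp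
      moreover have "dist (Q (iter (i - 1) y) ?s) (Q (iter (i - 1) y) 1) < s0/2"
        using \<eta>0_Q[rule_format, OF iter_in[OF yK] iter_in[OF yK] s(1) _ _ s(2)] \<eta>0 by simp
      ultimately show ?thesis using Q_1[OF iter_in[OF yK, of "i - 1"]] iter_Suc[OF yK, of "i - 1"] by simp
    qed
    have "dist (\<psi> ?t x) (\<psi> ?t y) \<le> s0/2" using close \<epsilon>(3) by force
    then show ?thesis using near dist_triangle[of "iter i x" "iter i y" "\<psi> ?t y"] unfolding xi by simp
  qed
  then show ?thesis using \<epsilon>(1) by blast
qed

lemma F_unif:
  assumes "\<epsilon> > 0"
  shows "\<exists>\<delta>>0. \<forall>x\<in>K. \<forall>y\<in>K. dist x y < \<delta> \<longrightarrow> dist (F x) (F y) < \<epsilon>"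
proof -
  obtain \<delta> where "\<delta> > 0" "\<forall>j\<le>1. \<forall>x\<in>K. \<forall>y\<in>K. dist x y < \<delta> \<longrightarrow> dist ((F ^^ j) x) ((F ^^ j) y) < \<epsilon>"
    using unif_Fn[OF assms, of 1] by blast
  then show ?thesis by (intro exI[of _ \<delta>]) (auto dest: spec[of _ 1])
qed

lemma \<psi>_unif:
  assumes "\<epsilon> > 0"
  shows "\<exists>\<delta>>0. \<forall>x\<in>X. \<forall>y\<in>X. \<forall>t\<in>{0..1}. dist x y < \<delta> \<longrightarrow> dist (\<psi> t x) (\<psi> t y) < \<epsilon>"
proof -
  have "uniformly_continuous_on ({0..1} \<times> X) (\<lambda>(t, x). \<psi> t x)"
    by (intro compact_uniformly_continuous continuous_on_subset[OF \<psi>_cont] compact_Times compact_X compact_Icc) auto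
  then obtain \<delta> where \<delta>: "\<delta> > 0" "\<And>u v. u \<in> {0..1} \<times> X \<Longrightarrow> v \<in> {0..1} \<times> X \<Longrightarrow> dist v u < \<delta> \<Longrightarrow>
      dist (case v of (t, x) \<Rightarrow> \<psi> t x) (case u of (t, x) \<Rightarrow> \<psi> t x) < \<epsilon>"
    using assms unfolding uniformly_continuous_on_def by meson
  show ?thesis
  proof (intro exI[of _ \<delta>] conjI ballI impI \<delta>(1))
    fix x y t assume *: "x \<in> X" "y \<in> X" "t \<in> {0..1::real}" "dist x y < \<delta>"
    have "dist (t, x) (t, y) < \<delta>" using * by (simp add: dist_Pair_Pair)
    from \<delta>(2)[OF _ _ this] * show "dist (\<psi> t x) (\<psi> t y) < \<epsilon>" by simp
  qed
qed

lemma H_nat_le: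
  assumes x: "regular x" and R: "\<And>j. j < n \<Longrightarrow> H x (of_int (int j) + 1) - H x (of_int (int j)) \<le> R"
  shows "\<bar>H x (real n)\<bar> \<le> R * n"
proof -
  have "H x (real n) \<le> R * n"
    using R
  proof (induction n)
    case (Suc n)
    have "H x (real n + 1) - H x (real n) \<le> R" using Suc.prems[of n] by simp
    moreover have "H x (real n) \<le> R * n" using Suc by simp
    ultimately show ?case by (simp add: algebra_simps)
  qed (simp add: regular_H[OF x])
  moreover have "H x (real n) \<ge> 0"
    using strict_mono_less_eq[OF regular_H(1)[OF x], of 0 "real n"] regular_H(3)[OF x] by simp
  ultimately show ?thesis by simp
qed

text \<open>The backward step with index \<open>j\<close> crosses the fibre over the iterate
  \<open>- (j + 1)\<close>, whence the shift of indices against \<open>H_nat_le\<close>.\<close>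

lemma H_neg_le:
  assumes x: "regular x" and R: "\<And>j. j < n \<Longrightarrow> H x (of_int (- int (Suc j)) + 1) - H x (of_int (- int (Suc j))) \<le> R"
  shows "\<bar>H x (- real n)\<bar> \<le> R * n"
proof -
  have "- (R * n) \<le> H x (- real n)"
    using R
  proof (induction n)
    case (Suc n)
    have "H x (- real n) - H x (- real (Suc n)) \<le> R" using Suc.prems[of n] by simp
    moreover have "- (R * n) \<le> H x (- real n)" using Suc by simp
    ultimately show ?case by (simp add: algebra_simps)
  qed (simp add: regular_H[OF x])
  moreover have "H x (- real n) \<le> 0"
    using strict_mono_less_eq[OF regular_H(1)[OF x], of "- real n" 0] regular_H(3)[OF x] by simp
  ultimately show ?thesis by simp
qed

text \<open>Iterates of \<open>F\<close> are reached in positive time and those of \<open>G\<close> in negative time; \<open>a\<close> is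
  the left end of the time window in which the flow separates the points.\<close>

lemma flow_separated_window:
  "\<exists>\<epsilon>>0. \<exists>M::nat. \<forall>k. \<exists>E\<subseteq>X. \<exists>a. finite E \<and> card E = 2 ^ k \<and>
    (\<forall>x\<in>E. \<forall>y\<in>E. x \<noteq> y \<longrightarrow> (\<exists>t\<in>{a..a + real (k * M)}. dist (\<psi> t x) (\<psi> t y) > \<epsilon>))"
proof -
  obtain c where c: "c > 0" and cw: "\<forall>C. continuum C \<longrightarrow> (\<forall>n. thin c ((F ^^ n) ` C)) \<longrightarrow> (\<forall>n. thin c ((G ^^ n) ` C)) \<longrightarrow> thin 0 C"
    using cw_expansive by blast
  obtain C0 where C0: "continuum C0" "\<not> thin 0 C0" using nondegenerate by blast
  let ?D = "{x \<in> K. \<exists>n. iter n x \<in> P}"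
  \<comment> \<open>For \<open>G\<close> the fibre crossed in step \<open>j\<close> lies over the
    iterate \<open>j + 1\<close> of \<open>G\<close>, while the tree controls iterate
    \<open>j\<close> only. Iterate \<open>j\<close> being \<open>r\<close> away from the image of
    \<open>P\<close> under \<open>F\<close> keeps iterate \<open>j + 1\<close> at distance at least
    \<open>r1\<close> from \<open>P\<close>, by uniform continuity of \<open>F\<close>.\<close>
  let ?P = "P \<union> F ` P"
  have D: "countable ?D" by (rule countable_orbit_preimage[OF finite_P])
  have cw': "thin 0 C" if "continuum C" "\<And>n. thin c ((F ^^ n) ` C)" "\<And>n. thin c ((G ^^ n) ` C)" for C
    using cw that by blast
  have DG: "G x \<notin> ?D" if "x \<in> K" "x \<notin> ?D" for x using that by (simp add: iter_G)
  have DF: "F x \<notin> ?D" if "x \<in> K" "x \<notin> ?D" for x using that by (simp add: iter_F)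
  have P: "finite ?P" "?P \<subseteq> K" using finite_P P_subset F_in by auto
  obtain f s r N where f: "f \<in> {F, G}" and s: "s > 0" and r: "r > 0" and
    tree: "\<forall>k. \<exists>E\<subseteq>K - ?D. finite E \<and> card E = 2 ^ k \<and> avoiding_separated f ?P s r (k * N) E"
    using cw_expansive_tree[OF cw' c P C0 D DG DF] by blast
  obtain r1 where r1: "r1 > 0" "\<forall>x\<in>K. \<forall>y\<in>K. dist x y < r1 \<longrightarrow> dist (F x) (F y) < r"
    using F_unif[OF r] by blast
  define r' where "r' = min r r1"
  have r': "r' > 0" "r' \<le> r" "r' \<le> r1" using r r1 by (auto simp: r'_def)
  obtain R where R: "\<forall>x\<in>K. (\<forall>n. iter n x \<notin> P) \<longrightarrow>
       (\<forall>n. (\<forall>p\<in>P. dist (iter n x) p \<ge> r') \<longrightarrow> H x (of_int n + 1) - H x (of_int n) \<le> R)"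
    using H_bound[OF r'(1)] by blast
  have step: "H x (of_int n + 1) - H x (of_int n) \<le> R" if "regular x" "\<And>p. p \<in> P \<Longrightarrow> dist (iter n x) p \<ge> r'" for x n
    using R that by (simp add: regular_def)
  obtain \<epsilon> where \<epsilon>: "\<epsilon> > 0" and close: "\<forall>x y i. regular x \<longrightarrow> regular y \<longrightarrow>
    (\<forall>t\<in>closed_segment 0 (H x (of_int i)). dist (\<psi> t x) (\<psi> t y) \<le> \<epsilon>) \<longrightarrow> dist (iter i x) (iter i y) < s"
    using flow_close_imp_iter_close[OF s] by blast
  define M where "M = N * nat \<lceil>\<bar>R\<bar>\<rceil>"
  have M: "R * i \<le> real (k * M)" if "i \<le> k * N" for i k
  proof -
    have "R * i \<le> \<bar>R\<bar> * i" by (simp add: mult_right_mono)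
    also have "\<dots> \<le> real (nat \<lceil>\<bar>R\<bar>\<rceil>) * real (k * N)"
    proof (rule mult_mono)
      show "\<bar>R\<bar> \<le> real (nat \<lceil>\<bar>R\<bar>\<rceil>)" by (rule real_nat_ceiling_ge)
      show "real i \<le> real (k * N)" using that by (rule of_nat_mono)
    qed auto
    finally show ?thesis by (simp add: M_def mult.commute mult.left_commute)
  qed
  have "\<exists>E\<subseteq>X. \<exists>a. finite E \<and> card E = 2 ^ k \<and>
    (\<forall>x\<in>E. \<forall>y\<in>E. x \<noteq> y \<longrightarrow> (\<exists>t\<in>{a..a + real (k * M)}. dist (\<psi> t x) (\<psi> t y) > \<epsilon>))" for k
  proof -
    obtain E where E: "E \<subseteq> K - ?D" "finite E" "card E = 2 ^ k" and sep: "avoiding_separated f ?P s r (k * N) E"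
      using tree by blast
    have reg: "regular x" if "x \<in> E" for x using that E(1) by (auto simp: regular_def)
    define a where "a = (if f = F then 0 else - real (k * M))"
    have "\<exists>t\<in>{a..a + real (k * M)}. dist (\<psi> t x) (\<psi> t y) > \<epsilon>" if xy: "x \<in> E" "y \<in> E" "x \<noteq> y" for x y
    proof -
      have xK: "x \<in> K" using reg[OF xy(1)] regular_in by blast
      obtain i where i: "i \<le> k * N" "dist ((f ^^ i) x) ((f ^^ i) y) \<ge> s"
          "\<forall>j<i. \<forall>p\<in>?P. dist ((f ^^ j) x) p \<ge> r \<and> dist ((f ^^ j) y) p \<ge> r"
        using sep xy unfolding avoiding_separated_def by blast
      define m where "m = (if f = F then int i else - int i)"
      have "iter m = f ^^ i"
      proof (cases "f = F")
        case True
        then have "m = int i" by (simp add: m_def)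
        then show ?thesis using iter_nat[of i] True by (intro ext) simp
      next
        case False
        then have "m = - int i" "f = G" using f by (simp_all add: m_def)
        then show ?thesis using iter_neg[of i] by (intro ext) simp
      qed
      then have "\<not> dist (iter m x) (iter m y) < s" using i(2) by simp
      then obtain t where t: "t \<in> closed_segment 0 (H x (of_int m))" "dist (\<psi> t x) (\<psi> t y) > \<epsilon>"
        using close reg[OF xy(1)] reg[OF xy(2)] not_le by blast
      have "t \<in> {a..a + real (k * M)}"
      proof (cases "f = F")
        case True
        have st: "H x (of_int (int j) + 1) - H x (of_int (int j)) \<le> R" if "j < i" for j
        proof (rule step[OF reg[OF xy(1)]])
          fix p assume "p \<in> P"
          then have "r \<le> dist ((f ^^ j) x) p" using i(3) that by blast
          then show "r' \<le> dist (iter (int j) x) p" using True r'(2) by (simp add: iter_nat)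
        qed
        have "\<bar>H x (real i)\<bar> \<le> R * i" by (rule H_nat_le[OF reg[OF xy(1)] st])
        then have "\<bar>H x (real i)\<bar> \<le> real (k * M)" using M[OF i(1)] by linarith
        moreover have "H x 0 \<le> H x (real i)" using strict_mono_less_eq[OF regular_H(1)[OF reg[OF xy(1)]]] by simp
        ultimately show ?thesis
          using t(1) True regular_H(3)[OF reg[OF xy(1)]] by (auto simp: m_def a_def closed_segment_eq_real_ivl)
      next
        case False
        then have fG: "f = G" using f by simp
        have st: "H x (of_int (- int (Suc j)) + 1) - H x (of_int (- int (Suc j))) \<le> R" if j: "j < i" for j
        proof (rule step[OF reg[OF xy(1)]])
          fix p assume p: "p \<in> P"
          let ?u = "iter (- int (Suc j)) x"
          have "F ?u = (G ^^ j) x"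
            using iter_Suc[OF xK, of "- int (Suc j)"] iter_neg[of j x] by simp
          moreover have "F p \<in> ?P" using p by blast
          ultimately have "r \<le> dist (F ?u) (F p)" using i(3) j fG by metis
          then have "\<not> dist ?u p < r1" using r1(2) iter_in[OF xK] p P_subset by (meson not_le subsetD)
          then show "r' \<le> dist ?u p" using r'(3) by simp
        qed
        have "\<bar>H x (- real i)\<bar> \<le> R * i" by (rule H_neg_le[OF reg[OF xy(1)] st])
        then have "\<bar>H x (- real i)\<bar> \<le> real (k * M)" using M[OF i(1)] by linarith
        moreover have "H x (- real i) \<le> H x 0" using strict_mono_less_eq[OF regular_H(1)[OF reg[OF xy(1)]]] by simp
        ultimately show ?thesis
          using t(1) False regular_H(3)[OF reg[OF xy(1)]]
          by (auto simp: m_def a_def closed_segment_eq_real_ivl split: if_splits)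
      qed
      then show ?thesis using t(2) by blast
    qed
    moreover have "E \<subseteq> X" using E(1) K_subset by blast
    ultimately show ?thesis using E(2,3) by (intro exI[of _ E] exI[of _ a] conjI) auto
  qed
  then show ?thesis using \<epsilon> by blast
qed

text \<open>Applying \<open>\<psi> a\<close> to the points makes the time window start at 0. A
  separation at a real time is then moved to the integer below it: points
  \<open>\<delta>\<close>-close at that integer would stay \<open>\<epsilon>\<close>-close during
  the next unit of time.\<close>

lemma time_one_separated:
  "\<exists>\<epsilon>>0. \<exists>M::nat. \<forall>k. \<exists>E\<subseteq>X. finite E \<and> card E = 2 ^ k \<and>
    (\<forall>x\<in>E. \<forall>y\<in>E. x \<noteq> y \<longrightarrow> (\<exists>j\<le>k * M. dist (\<psi> (real j) x) (\<psi> (real j) y) > \<epsilon>))"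
proof -
  obtain \<epsilon> M where \<epsilon>: "\<epsilon> > 0" and win: "\<forall>k. \<exists>E\<subseteq>X. \<exists>a. finite E \<and> card E = 2 ^ k \<and>
    (\<forall>x\<in>E. \<forall>y\<in>E. x \<noteq> y \<longrightarrow> (\<exists>t\<in>{a..a + real (k * M)}. dist (\<psi> t x) (\<psi> t y) > \<epsilon>))"
    using flow_separated_window by blast
  obtain \<delta> where \<delta>: "\<delta> > 0" and \<psi>\<delta>: "\<forall>x\<in>X. \<forall>y\<in>X. \<forall>t\<in>{0..1}. dist x y < \<delta> \<longrightarrow> dist (\<psi> t x) (\<psi> t y) < \<epsilon>"
    using \<psi>_unif[OF \<epsilon>] by blast
  have "\<exists>E\<subseteq>X. finite E \<and> card E = 2 ^ k \<and>
    (\<forall>x\<in>E. \<forall>y\<in>E. x \<noteq> y \<longrightarrow> (\<exists>j\<le>k * M. dist (\<psi> (real j) x) (\<psi> (real j) y) > \<delta>/2))" for k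
  proof -
    obtain E a where E: "E \<subseteq> X" "finite E" "card E = 2 ^ k" and sep: "\<forall>x\<in>E. \<forall>y\<in>E. x \<noteq> y \<longrightarrow>
        (\<exists>t\<in>{a..a + real (k * M)}. dist (\<psi> t x) (\<psi> t y) > \<epsilon>)"
      using spec[OF win, of k] by blast
    have inverse_shift: "\<psi> (- a) (\<psi> a x) = x" if "x \<in> X" for x
      using \<psi>_add[OF that, of "- a" a] \<psi>_0[OF that] by simp
    have inj: "inj_on (\<psi> a) E" by (rule inj_on_inverseI[of _ "\<psi> (- a)"]) (use inverse_shift E(1) in blast)
    have "\<exists>j\<le>k * M. dist (\<psi> (real j) (\<psi> a x)) (\<psi> (real j) (\<psi> a y)) > \<delta>/2" if xy: "x \<in> E" "y \<in> E" "x \<noteq> y" for x y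
    proof -
      have X: "x \<in> X" "y \<in> X" using xy E(1) by auto
      obtain t where t: "t \<in> {a..a + real (k * M)}" "dist (\<psi> t x) (\<psi> t y) > \<epsilon>" using sep xy by blast
      define j where "j = nat \<lfloor>t - a\<rfloor>"
      have j: "real j \<le> t - a" "t - a < real j + 1" using t(1) by (auto simp: j_def)
      then have jk: "j \<le> k * M" using t(1) by (metis add_le_cancel_left atLeastAtMost_iff le_diff_eq add.commute of_nat_le_iff order_trans)
      let ?u = "t - a - real j"
      have u: "?u \<in> {0..1}" using j by simp
      have *: "\<psi> t w = \<psi> ?u (\<psi> (real j) (\<psi> a w))" if "w \<in> X" for w
        using \<psi>_add[OF \<psi>_in[OF that], of ?u "real j" a] \<psi>_add[OF that, of "t - a" a] by simp
      have "\<not> dist (\<psi> (real j) (\<psi> a x)) (\<psi> (real j) (\<psi> a y)) < \<delta>"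
      proof
        assume "dist (\<psi> (real j) (\<psi> a x)) (\<psi> (real j) (\<psi> a y)) < \<delta>"
        then have "dist (\<psi> t x) (\<psi> t y) < \<epsilon>"
          using \<psi>\<delta> u \<psi>_in[OF \<psi>_in[OF X(1)]] \<psi>_in[OF \<psi>_in[OF X(2)]] unfolding *[OF X(1)] *[OF X(2)] by blast
        then show False using t(2) by simp
      qed
      then show ?thesis using jk \<delta> by (intro exI[of _ j]) auto
    qed
    then have "\<forall>x\<in>\<psi> a ` E. \<forall>y\<in>\<psi> a ` E. x \<noteq> y \<longrightarrow> (\<exists>j\<le>k * M. dist (\<psi> (real j) x) (\<psi> (real j) y) > \<delta>/2)"
      by blast
    moreover have "\<psi> a ` E \<subseteq> X" using \<psi>_in E(1) by blast
    ultimately show ?thesis using E(2,3) inj by (intro exI[of _ "\<psi> a ` E"] conjI) (auto simp: card_image)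
  qed
  moreover have "\<delta>/2 > 0" using \<delta> by simp
  ultimately show ?thesis by blast
qed

end

section \<open>Growth of separated sets and entropy\<close>

text \<open>The cardinality \<open>2 ^ k\<close> is exponential in the number of steps, which is
  linear in \<open>k\<close>. A bound along a subsequence of lengths suffices for a limsup.\<close>

lemma topological_entropy_pos:
  assumes \<epsilon>: "\<epsilon> > 0" and sep: "\<And>k. \<exists>E\<subseteq>N. finite E \<and> card E = 2 ^ k \<and>
    (\<forall>x\<in>E. \<forall>y\<in>E. x \<noteq> y \<longrightarrow> (\<exists>j\<le>k * M. \<epsilon> < d ((T ^^ j) x) ((T ^^ j) y)))"
  shows "topological_entropy N d T > 0"
proof -
  define f where "f n = (SUP E\<in>{E. finite E \<and> E \<noteq> {} \<and> separated_set N d T n \<epsilon> E}. ereal (ln (real (card E)) / real n))" for n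
  \<comment> \<open>\<open>Suc M\<close> keeps the lengths strictly increasing even if
    \<open>M = 0\<close>. The rate \<open>c\<close> comes from
    \<open>r k \<le> Suc k * (M + 2)\<close>.\<close>
  define r where "r k = Suc k * Suc M + 1" for k
  have r: "strict_mono r" unfolding strict_mono_Suc_iff r_def by simp
  define c where "c = ln 2 / real (M + 2)"
  have c: "c > 0" by (simp add: c_def)
  have "ereal c \<le> f (r k)" for k
  proof -
    obtain E where E: "E \<subseteq> N" "finite E" "card E = 2 ^ Suc k"
      "\<forall>x\<in>E. \<forall>y\<in>E. x \<noteq> y \<longrightarrow> (\<exists>j\<le>Suc k * M. \<epsilon> < d ((T ^^ j) x) ((T ^^ j) y))"
      using sep[of "Suc k"] by blast
    have "j < r k" if "j \<le> Suc k * M" for j using that by (simp add: r_def)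
    then have "separated_set N d T (r k) \<epsilon> E"
      unfolding separated_set_def using E(1,4) by blast
    moreover have "E \<noteq> {}" using E(3) by auto
    ultimately have "ereal (ln (real (card E)) / real (r k)) \<le> f (r k)"
      unfolding f_def using E(2) by (intro SUP_upper) simp
    moreover have "c \<le> ln (real (card E)) / real (r k)"
    proof -
      have "c = (real (Suc k) * ln 2) / (real (Suc k) * real (M + 2))" by (simp add: c_def)
      also have "\<dots> \<le> (real (Suc k) * ln 2) / real (r k)"
        by (intro divide_left_mono) (auto simp: r_def algebra_simps intro!: mult_pos_pos add_pos_nonneg)
      also have "real (Suc k) * ln 2 = ln (real (card E))" by (simp add: E(3) ln_realpow del: power_Suc of_nat_Suc)
      finally show ?thesis .
    qed
    ultimately show ?thesis using order_trans by (metis ereal_less_eq(3))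
  qed
  then have "ereal c \<le> limsup (f \<circ> r)" by (intro le_Limsup) auto
  also have "\<dots> \<le> limsup f" by (rule limsup_subseq_mono[OF r])
  also have "\<dots> \<le> topological_entropy N d T"
    unfolding topological_entropy_def f_def using \<epsilon> by (intro SUP_upper) simp
  finally show ?thesis using c by (metis ereal_less(2) less_le_trans)
qed

section \<open>Singular suspensions\<close>

text \<open>Points are sent to their distance functions; these are bounded, and continuous because
  their domain is a discrete copy of the type. The supremum distance of the images of
  \<open>x\<close> and \<open>y\<close> is attained at \<open>y\<close>. This moves a metric given
  by a function on a set to a type of class \<open>metric_space\<close>, where the general results
  above apply.\<close>

lemma kuratowski_embedding:
  assumes "Metric_space S d" and B: "\<And>x y. x \<in> S \<Longrightarrow> y \<in> S \<Longrightarrow> d x y \<le> B"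
  obtains \<kappa> :: "'p \<Rightarrow> ('p discrete \<Rightarrow>\<^sub>C real)" where "\<And>x y. x \<in> S \<Longrightarrow> y \<in> S \<Longrightarrow> dist (\<kappa> x) (\<kappa> y) = d x y"
proof -
  interpret Metric_space S d by (rule assms(1))
  define u where "u x w = (if x \<in> S \<and> of_discrete w \<in> S then d x (of_discrete w) else 0)" for x and w :: "'p discrete"
  have "u x \<in> bcontfun" for x
  proof -
    have "continuous_on UNIV (u x)"
      unfolding continuous_on_open_invariant using open_discrete by blast
    moreover have "\<bar>u x w\<bar> \<le> \<bar>B\<bar>" for w using B[of x "of_discrete w"] by (auto simp: u_def)
    then have "bounded (range (u x))" by (intro boundedI[of _ "\<bar>B\<bar>"]) auto
    ultimately show ?thesis by (simp add: bcontfun_def)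
  qed
  then have ap: "apply_bcontfun (Bcontfun (u x)) = u x" for x by (rule Bcontfun_inverse)
  show ?thesis
  proof (rule that[of "\<lambda>x. Bcontfun (u x)"])
    fix x y assume xy: "x \<in> S" "y \<in> S"
    show "dist (Bcontfun (u x)) (Bcontfun (u y)) = d x y"
    proof (rule antisym)
      show "dist (Bcontfun (u x)) (Bcontfun (u y)) \<le> d x y"
      proof (rule dist_bound)
        fix w
        show "dist (apply_bcontfun (Bcontfun (u x)) w) (apply_bcontfun (Bcontfun (u y)) w) \<le> d x y"
        proof (cases "of_discrete w \<in> S")
          case True
          then show ?thesis
            using triangle[of x y "of_discrete w"] triangle[of y x "of_discrete w"] commute[of x y] xy
            by (simp add: ap u_def dist_real_def abs_le_iff)
        qed (simp add: ap u_def xy)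
      qed
      have "d x y = dist (apply_bcontfun (Bcontfun (u x)) (discrete y)) (apply_bcontfun (Bcontfun (u y)) (discrete y))"
        using xy by (simp add: ap u_def discrete_inverse dist_real_def)
      also have "\<dots> \<le> dist (Bcontfun (u x)) (Bcontfun (u y))" by (rule dist_bounded)
      finally show "d x y \<le> dist (Bcontfun (u x)) (Bcontfun (u y))" .
    qed
  qed
qed

section \<open>The suspension space and its orbits\<close>

locale brake_setup =
  fixes M :: "'a topology" and f :: "'a \<Rightarrow> 'a" and \<rho> :: "'a \<Rightarrow> real"
    and N :: "'p topology" and A :: "('p, 'e::euclidean_space) chart set" and q :: "'a \<times> real \<Rightarrow> 'p"
    and \<phi> \<psi> :: "real \<Rightarrow> 'p \<Rightarrow> 'p" and S :: "'p set" and \<alpha> :: "'p \<Rightarrow> real"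
  assumes compact_M: "compact_space M"
    and f_bij: "bij_betw f (topspace M) (topspace M)"
    and f_cont: "continuous_map M M f" and f_inv_cont: "continuous_map M M (inv_into (topspace M) f)"
    and \<rho>_cont: "continuous_map M euclideanreal \<rho>" and \<rho>_pos: "x \<in> topspace M \<Longrightarrow> \<rho> x > 0"
    and space: "suspension_space M f \<rho> N q" and sflow: "suspension_flow (topspace M) \<rho> N q \<phi>"
    and vel: "has_velocity_field N A \<phi>"
    and atlas: "smooth_atlas N A" and compact_N: "compact_space N"
    and brake: "brake N A S \<alpha>" and C1: "C1_flow N A \<psi>"
    and braked: "p \<in> topspace N \<Longrightarrow> (U, c) \<in> A \<Longrightarrow> \<psi> t p \<in> U \<Longrightarrow>
       ((\<lambda>s. c (\<psi> s p)) has_vector_derivative \<alpha> (\<psi> t p) *\<^sub>R velocity \<phi> (U, c) (\<psi> t p)) (at t)"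
begin

abbreviation strip_top :: "('a \<times> real) topology" where
  "strip_top \<equiv> subtopology (prod_topology M euclideanreal) (strip (topspace M) \<rho>)"

lemma topspace_strip: "topspace strip_top = strip (topspace M) \<rho>"
  by (auto simp: strip_def)

lemma in_strip: "(x, s) \<in> strip (topspace M) \<rho> \<longleftrightarrow> x \<in> topspace M \<and> 0 \<le> s \<and> s \<le> \<rho> x"
  by (simp add: strip_def)

lemma q_quotient: "quotient_map strip_top N q"
  using space by (simp add: suspension_space_def)

lemma q_cont: "continuous_map strip_top N q"
  using q_quotient by (rule quotient_imp_continuous_map)

lemma q_image: "q ` strip (topspace M) \<rho> = topspace N"
  using quotient_imp_surjective_map[OF q_quotient] by (simp only: topspace_strip)

lemma f_in: "x \<in> topspace M \<Longrightarrow> f x \<in> topspace M"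
  using f_bij by (rule bij_betwE[THEN bspec])

text \<open>A normal form for the identification: as \<open>\<rho>\<close> is positive, each class
  has exactly one point below the roof.\<close>

definition glue :: "'a \<times> real \<Rightarrow> 'a \<times> real" where
  "glue u = (if snd u = \<rho> (fst u) then (f (fst u), 0) else u)"

lemma q_eq_iff:
  assumes "u \<in> strip (topspace M) \<rho>" "v \<in> strip (topspace M) \<rho>"
  shows "q u = q v \<longleftrightarrow> equivclp (\<lambda>a b. \<exists>x\<in>topspace M. a = (x, \<rho> x) \<and> b = (f x, 0)) u v"
  using space assms unfolding suspension_space_def by blast

lemma q_roof:
  assumes x: "x \<in> topspace M"
  shows "q (x, \<rho> x) = q (f x, 0)"
proof -
  have "(x, \<rho> x) \<in> strip (topspace M) \<rho>" "(f x, 0) \<in> strip (topspace M) \<rho>"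
    using x f_in[OF x] \<rho>_pos[of x] \<rho>_pos[of "f x"] by (auto simp: in_strip)
  moreover have "equivclp (\<lambda>a b. \<exists>x\<in>topspace M. a = (x, \<rho> x) \<and> b = (f x, 0)) (x, \<rho> x) (f x, 0)"
    using x by (intro r_into_equivclp) blast
  ultimately show ?thesis using q_eq_iff by blast
qed

lemma q_eq_imp_glue_eq:
  assumes "u \<in> strip (topspace M) \<rho>" "v \<in> strip (topspace M) \<rho>" "q u = q v"
  shows "glue u = glue v"
proof -
  have "equivclp (\<lambda>a b. \<exists>x\<in>topspace M. a = (x, \<rho> x) \<and> b = (f x, 0)) u v"
    using q_eq_iff assms by blast
  then show ?thesis
  proof induction
    case (step y z)
    have "glue (x, \<rho> x) = glue (f x, 0)" if "x \<in> topspace M" for x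
      using \<rho>_pos[OF f_in[OF that]] by (simp add: glue_def)
    then have "glue y = glue z" using step(2) by fastforce
    then show ?case using step(3) by simp
  qed simp
qed

lemma base_in_strip: "x \<in> topspace M \<Longrightarrow> (x, 0) \<in> strip (topspace M) \<rho>"
  using \<rho>_pos[of x] by (simp add: in_strip)

lemma height_in_strip: "x \<in> topspace M \<Longrightarrow> s \<in> {0..1} \<Longrightarrow> (x, s * \<rho> x) \<in> strip (topspace M) \<rho>"
  using \<rho>_pos[of x] by (simp add: in_strip mult_le_cancel_right1)

lemma q_base_inj: "x \<in> topspace M \<Longrightarrow> y \<in> topspace M \<Longrightarrow> q (x, 0) = q (y, 0) \<Longrightarrow> x = y"
  using q_eq_imp_glue_eq[of "(x, 0)" "(y, 0)"] \<rho>_pos[of x] \<rho>_pos[of y] base_in_strip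
  by (simp add: glue_def)

lemma q_in: "u \<in> strip (topspace M) \<rho> \<Longrightarrow> q u \<in> topspace N"
  using q_image by blast

text \<open>Relative height modulo 1 descends to the quotient, because roof and base have the same
  value on the circle.\<close>

lemma circle_map:
  obtains z where "continuous_map N euclidean z"
    "\<And>x s. (x, s) \<in> strip (topspace M) \<rho> \<Longrightarrow> z (q (x, s)) = cis (2 * pi * (s / \<rho> x))"
proof -
  let ?h = "\<lambda>u. snd u / \<rho> (fst u)"
  let ?g = "\<lambda>u. cis (2 * pi * ?h u)"
  have fst: "continuous_map strip_top M fst" and snd: "continuous_map strip_top euclideanreal snd"
    by (intro continuous_map_from_subtopology continuous_map_fst continuous_map_snd)+
  have "continuous_map strip_top euclideanreal (\<rho> \<circ> fst)"
    by (rule continuous_map_compose[OF fst \<rho>_cont])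
  then have "continuous_map strip_top euclideanreal ?h"
    using \<rho>_pos by (intro continuous_map_real_divide snd) (auto simp: comp_def strip_def less_le)
  moreover have "continuous_map euclideanreal euclidean (\<lambda>s::real. cis (2 * pi * s))"
    by (simp add: continuous_intros)
  ultimately have "continuous_map strip_top euclidean ((\<lambda>s. cis (2 * pi * s)) \<circ> ?h)"
    by (rule continuous_map_compose)
  then have cont: "continuous_map strip_top euclidean ?g" by (simp add: comp_def)
  have "?g u = ?g (glue u)" if u: "u \<in> strip (topspace M) \<rho>" for u
  proof (cases "snd u = \<rho> (fst u)")
    case True
    have "fst u \<in> topspace M" using u by (auto simp: strip_def)
    then have "\<rho> (fst u) \<noteq> 0" using \<rho>_pos by (simp add: less_le)
    then show ?thesis using True by (simp add: glue_def)
  qed (simp add: glue_def)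
  then have inv: "?g u = ?g v" if "u \<in> strip (topspace M) \<rho>" "v \<in> strip (topspace M) \<rho>" "q u = q v" for u v
    using q_eq_imp_glue_eq[OF that] that(1,2) by metis
  show ?thesis
  proof (rule quotient_map_lift_exists[OF q_quotient cont, unfolded topspace_strip])
    show "?g u = ?g v" if "u \<in> strip (topspace M) \<rho>" "v \<in> strip (topspace M) \<rho>" "q u = q v" for u v
      by (rule inv[OF that])
    fix z assume z: "continuous_map N euclidean z" "\<And>u. u \<in> strip (topspace M) \<rho> \<Longrightarrow> z (q u) = ?g u"
    show ?thesis
    proof (rule that[of z])
      show "z (q (x, s)) = cis (2 * pi * (s / \<rho> x))" if "(x, s) \<in> strip (topspace M) \<rho>" for x s
        using z(2)[OF that] by simp
    qed (rule z(1))
  qed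
qed

text \<open>Below the roof \<open>q\<close> is injective, so each point of \<open>S\<close> lies
  over a single base point. If the fibre of \<open>x\<close> meets \<open>S\<close> at the roof,
  that base point is \<open>f x\<close>, which accounts for the preimage under
  \<open>f\<close>.\<close>

lemma finite_base_points_over:
  assumes "finite S"
  shows "finite {x \<in> topspace M. \<exists>s. 0 \<le> s \<and> s \<le> \<rho> x \<and> q (x, s) \<in> S}"
proof -
  let ?strip = "strip (topspace M) \<rho>"
  let ?B = "(\<lambda>p. fst (glue (inv_into ?strip q p))) ` (S \<inter> topspace N)"
  have fB: "finite ?B" using assms by simp
  have "{x \<in> topspace M. \<exists>s. 0 \<le> s \<and> s \<le> \<rho> x \<and> q (x, s) \<in> S} \<subseteq> ?B \<union> (f -` ?B \<inter> topspace M)"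
  proof
    fix x assume "x \<in> {x \<in> topspace M. \<exists>s. 0 \<le> s \<and> s \<le> \<rho> x \<and> q (x, s) \<in> S}"
    then obtain s where x: "x \<in> topspace M" "(x, s) \<in> ?strip" "q (x, s) \<in> S" by (auto simp: in_strip)
    let ?u = "inv_into ?strip q (q (x, s))"
    have "q (x, s) \<in> q ` ?strip" using x(2) by blast
    then have "?u \<in> ?strip" "q ?u = q (x, s)" by (auto intro: inv_into_into f_inv_into_f)
    then have "glue ?u = glue (x, s)" using q_eq_imp_glue_eq x(2) by blast
    then have "fst (glue (x, s)) \<in> ?B" using x(3) q_in[OF x(2)] by force
    then show "x \<in> ?B \<union> (f -` ?B \<inter> topspace M)"
      using x(1) by (cases "s = \<rho> x") (simp_all add: glue_def)
  qed
  moreover have "inj_on f (topspace M)" using f_bij by (rule bij_betw_imp_inj_on)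
  ultimately show ?thesis using fB by (meson finite_Un finite_subset finite_vimage_IntI)
qed

lemma \<phi>_flow: "flow N \<phi>" using sflow by (simp add: suspension_flow_def)

lemma \<psi>_flow: "flow N \<psi>" using C1 by (simp add: C1_flow_def)

lemma \<phi>_q: "x \<in> topspace M \<Longrightarrow> 0 \<le> s \<Longrightarrow> s \<le> \<rho> x \<Longrightarrow> 0 \<le> s + t \<Longrightarrow> s + t \<le> \<rho> x \<Longrightarrow> \<phi> t (q (x, s)) = q (x, s + t)"
  using sflow unfolding suspension_flow_def by blast

lemma compact_continuous_bounded:
  assumes "compact_space Z" "continuous_map Z euclideanreal h"
  shows "\<exists>B. \<forall>x\<in>topspace Z. \<bar>h x\<bar> \<le> B"
proof -
  have "compactin euclideanreal (h ` topspace Z)"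
    using assms by (intro image_compactin[of Z]) (auto simp: compact_space_def)
  then have "bounded (h ` topspace Z)" by (simp add: compact_imp_bounded)
  then show ?thesis unfolding bounded_real by simp
qed

lemma \<rho>_bounds: "\<exists>c C. c > 0 \<and> (\<forall>x\<in>topspace M. c \<le> \<rho> x \<and> \<rho> x \<le> C)"
proof -
  obtain C where C: "\<forall>x\<in>topspace M. \<bar>\<rho> x\<bar> \<le> C"
    using compact_continuous_bounded[OF compact_M \<rho>_cont] by blast
  have "continuous_map M euclideanreal (\<lambda>x. 1 / \<rho> x)"
    using \<rho>_pos \<rho>_cont by (intro continuous_map_real_divide) (auto simp: less_le)
  from compact_continuous_bounded[OF compact_M this]
  obtain c where c: "\<forall>x\<in>topspace M. \<bar>1 / \<rho> x\<bar> \<le> c" by blast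
  have "1 / (\<bar>c\<bar> + 1) \<le> \<rho> x" if x: "x \<in> topspace M" for x
  proof -
    have "\<bar>1 / \<rho> x\<bar> \<le> c" using c x by blast
    then have "1 / \<rho> x \<le> \<bar>c\<bar> + 1" by linarith
    then show ?thesis using \<rho>_pos[OF x] by (simp add: field_simps)
  qed
  then show ?thesis using C by (intro exI[of _ "1 / (\<bar>c\<bar> + 1)"] exI[of _ C]) (auto simp: abs_le_iff)
qed

lemma \<alpha>_cont: "continuous_map N euclideanreal \<alpha>"
  using brake unfolding brake_def Ck_map_def by blast

lemma \<alpha>_pos: "p \<in> topspace N \<Longrightarrow> p \<notin> S \<Longrightarrow> \<alpha> p > 0"
  using brake unfolding brake_def by (metis less_le)

lemma stopped_fixed: "p \<in> topspace N \<Longrightarrow> p \<in> S \<Longrightarrow> \<psi> t p = p"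
  by (rule braked_flow_fixed[OF atlas C1 brake braked])

text \<open>\<open>h\<close> composes two time changes: \<open>g\<close> leads from the count of
  fibres to suspension time, and \<open>T\<close> from there to \<open>\<psi>\<close>-time. By the
  mean value theorem, crossing a fibre takes its height times a value of \<open>1 / \<alpha>\<close>
  on it, whence the bound for fibres on which \<open>\<alpha>\<close> is at least
  \<open>m\<close>.\<close>

lemma section_time:
  assumes b: "\<And>n::int. b n \<in> topspace M" "\<And>n. b (n + 1) = f (b n)"
    and free: "\<And>n s. s \<in> {0..1} \<Longrightarrow> q (b n, s * \<rho> (b n)) \<notin> S"
  obtains h where "strict_mono h" "surj h" "h 0 = 0"
    "\<And>n s. s \<in> {0..1} \<Longrightarrow> \<psi> (h (of_int n + s)) (q (b 0, 0)) = q (b n, s * \<rho> (b n))"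
    "\<And>n m. m > 0 \<Longrightarrow> (\<And>s. s \<in> {0..1} \<Longrightarrow> \<alpha> (q (b n, s * \<rho> (b n))) \<ge> m) \<Longrightarrow>
       h (of_int n + 1) - h (of_int n) \<le> \<rho> (b n) / m"
proof -
  define p where "p = q (b 0, 0)"
  have p: "p \<in> topspace N" unfolding p_def by (intro q_in base_in_strip b)
  obtain c C where c: "c > 0" "\<forall>x\<in>topspace M. c \<le> \<rho> x \<and> \<rho> x \<le> C" using \<rho>_bounds by blast
  obtain g where g: "strict_mono g" "surj g" "g 0 = 0"
    and g_add: "\<And>n s. s \<in> {0..1} \<Longrightarrow> g (of_int n + s) = g (of_int n) + s * \<rho> (b n)"
    using linear_interpolation[OF c(1), of "\<lambda>n. \<rho> (b n)"] c(2) b(1) by auto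
  have pos: "\<rho> (b n) > 0" for n using \<rho>_pos b by blast
  have g_Suc: "g (of_int (n + 1)) = g (of_int n) + \<rho> (b n)" for n
    using g_add[of 1 n] by simp
  have orbit: "\<phi> (g (of_int n)) p = q (b n, 0)" for n
  proof (induction n rule: int_induct[where k = 0])
    case base
    then show ?case using g(3) flow_zero[OF \<phi>_flow p] by (simp add: p_def)
  next
    case (step1 n)
    have "\<phi> (\<rho> (b n) + g (of_int n)) p = \<phi> (\<rho> (b n)) (q (b n, 0))"
      unfolding step1(2)[symmetric] by (rule flow_add[OF \<phi>_flow p])
    also have "\<dots> = q (b n, \<rho> (b n))" using \<phi>_q[OF b(1), of 0 n "\<rho> (b n)"] pos[of n] by simp
    also have "\<dots> = q (b (n + 1), 0)" using q_roof b by simp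
    finally show ?case by (simp only: g_Suc add.commute[of "\<rho> (b n)"])
  next
    case (step2 n)
    have eq: "g (of_int n) = g (of_int (n - 1)) + \<rho> (b (n - 1))" using g_Suc[of "n - 1"] by simp
    have "q (b n, 0) = q (b (n - 1), \<rho> (b (n - 1)))" using q_roof[OF b(1), of "n - 1"] b(2)[of "n - 1"] by simp
    then have "\<phi> (- \<rho> (b (n - 1))) (q (b n, 0)) = q (b (n - 1), 0)"
      using \<phi>_q[OF b(1), of "\<rho> (b (n - 1))" "n - 1" "- \<rho> (b (n - 1))"] pos[of "n - 1"] by simp
    moreover have "\<phi> (- \<rho> (b (n - 1)) + g (of_int n)) p = \<phi> (- \<rho> (b (n - 1))) (q (b n, 0))"
      unfolding step2(2)[symmetric] by (rule flow_add[OF \<phi>_flow p])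
    moreover have "- \<rho> (b (n - 1)) + g (of_int n) = g (of_int (n - 1))" using eq by simp
    ultimately show ?case by simp
  qed
  have orbit_s: "\<phi> (g (of_int n) + s * \<rho> (b n)) p = q (b n, s * \<rho> (b n))" if s: "s \<in> {0..1}" for n s
  proof -
    have "\<phi> (s * \<rho> (b n) + g (of_int n)) p = \<phi> (s * \<rho> (b n)) (q (b n, 0))"
      unfolding orbit[symmetric] by (rule flow_add[OF \<phi>_flow p])
    also have "\<dots> = q (b n, s * \<rho> (b n))"
      using \<phi>_q[OF b(1), of 0 n "s * \<rho> (b n)"] pos[of n] s by (simp add: mult_le_cancel_right1)
    finally show ?thesis by (simp only: add.commute[of "s * \<rho> (b n)"])
  qed
  have free': "\<phi> u p \<notin> S" for u
  proof -
    obtain w where w: "u = g w" using g(2) by (metis surjD)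
    have "frac w \<in> {0..1}" using frac_lt_1[of w] by (simp add: less_imp_le)
    moreover from this have "u = g (of_int \<lfloor>w\<rfloor>) + frac w * \<rho> (b \<lfloor>w\<rfloor>)"
      using g_add[of "frac w" "\<lfloor>w\<rfloor>"] by (simp add: w frac_def)
    ultimately show ?thesis using orbit_s free by simp
  qed
  obtain T where T: "T 0 = 0" "\<And>u. (T has_real_derivative 1 / \<alpha> (\<phi> u p)) (at u)" "\<And>u. \<psi> (T u) p = \<phi> u p"
    using braked_flow_reparam[OF atlas C1 \<phi>_flow vel brake braked p] free' by blast
  obtain B where B: "\<forall>x\<in>topspace N. \<bar>\<alpha> x\<bar> \<le> B"
    using compact_continuous_bounded[OF compact_N \<alpha>_cont] by blast
  \<comment> \<open>\<open>\<alpha>\<close> is bounded on the compact space, so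
    \<open>1 / \<alpha>\<close> stays away from 0 and \<open>T\<close> is onto.\<close>
  have lower: "1 / (\<bar>B\<bar> + 1) \<le> 1 / \<alpha> (\<phi> u p)" for u
  proof -
    have "\<alpha> (\<phi> u p) > 0" by (rule \<alpha>_pos[OF flow_in[OF \<phi>_flow p] free'])
    moreover have "\<bar>\<alpha> (\<phi> u p)\<bar> \<le> B" using B flow_in[OF \<phi>_flow p] by blast
    ultimately show ?thesis by (intro frac_le) auto
  qed
  have Tm: "strict_mono T" "surj T"
    using deriv_bounded_below_strict_mono_surj[OF T(2) _ lower] by simp_all
  show ?thesis
  proof (rule that[of "T \<circ> g"])
    show "strict_mono (T \<circ> g)" by (rule strict_mono_o[OF Tm(1) g(1)])
    show "surj (T \<circ> g)" by (rule comp_surj[OF g(2) Tm(2)])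
    show "(T \<circ> g) 0 = 0" using g(3) T(1) by simp
    show "\<psi> ((T \<circ> g) (of_int n + s)) (q (b 0, 0)) = q (b n, s * \<rho> (b n))" if "s \<in> {0..1}" for n s
      using T(3) orbit_s[OF that] g_add[OF that] by (simp add: p_def)
    fix n m assume m: "m > 0" "\<And>s. s \<in> {0..1} \<Longrightarrow> \<alpha> (q (b n, s * \<rho> (b n))) \<ge> m"
    let ?u = "g (of_int n)"
    have "?u < ?u + \<rho> (b n)" using pos by simp
    from MVT2[OF this, of T "\<lambda>u. 1 / \<alpha> (\<phi> u p)"] T(2)
    obtain \<xi> where \<xi>: "?u < \<xi>" "\<xi> < ?u + \<rho> (b n)" "T (?u + \<rho> (b n)) - T ?u = (?u + \<rho> (b n) - ?u) * (1 / \<alpha> (\<phi> \<xi> p))"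
      by blast
    define s where "s = (\<xi> - ?u) / \<rho> (b n)"
    have s: "s \<in> {0..1}" "\<xi> = ?u + s * \<rho> (b n)"
      using \<xi>(1,2) pos[of n] by (auto simp: s_def pos_divide_le_eq)
    have "\<alpha> (\<phi> \<xi> p) \<ge> m" using m(2)[OF s(1)] orbit_s[OF s(1), of n] s(2) by simp
    then have "\<rho> (b n) * (1 / \<alpha> (\<phi> \<xi> p)) \<le> \<rho> (b n) * (1 / m)"
      using m(1) pos[of n] by (intro mult_left_mono frac_le) auto
    then show "(T \<circ> g) (of_int n + 1) - (T \<circ> g) (of_int n) \<le> \<rho> (b n) / m"
      using \<xi>(3) g_Suc[of n] by simp
  qed
qed

end
lemma compact_embedding_inverse:
  fixes j :: "'z \<Rightarrow> 'k::metric_space"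
  assumes j: "continuous_map Z euclidean j" "compact_space Z" "inj_on j (topspace Z)"
  shows "compact (j ` topspace Z)"
    and "continuous_map (top_of_set (j ` topspace Z)) Z (inv_into (topspace Z) j)"
proof -
  show "compact (j ` topspace Z)"
    using image_compactin[OF _ j(1), of "topspace Z"] j(2) by (simp add: compact_space_def)
  have "continuous_map Z (top_of_set (j ` topspace Z)) j"
    using j(1) by (simp add: continuous_map_in_subtopology)
  then have "homeomorphic_map Z (top_of_set (j ` topspace Z)) j"
    using j by (intro continuous_imp_homeomorphic_map) (auto simp: Hausdorff_space_subtopology)
  then obtain g where g: "homeomorphic_maps Z (top_of_set (j ` topspace Z)) j g"
    unfolding homeomorphic_map_maps by blast
  show "continuous_map (top_of_set (j ` topspace Z)) Z (inv_into (topspace Z) j)"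
  proof (rule continuous_map_eq)
    show "continuous_map (top_of_set (j ` topspace Z)) Z g"
      using g by (simp add: homeomorphic_maps_def)
    fix y assume "y \<in> topspace (top_of_set (j ` topspace Z))"
    then obtain x where x: "x \<in> topspace Z" "y = j x" by auto
    have "g (j x) = x" using g x(1) by (simp add: homeomorphic_maps_def)
    then show "g y = inv_into (topspace Z) j y" using x j(3) by simp
  qed
qed

lemma flow_iterate:
  assumes "flow X \<psi>" "p \<in> topspace X"
  shows "((\<psi> 1) ^^ j) p = \<psi> (real j) p"
proof (induction j)
  case 0
  then show ?case using flow_zero[OF assms] by simp
next
  case (Suc j)
  then show ?case using flow_add[OF assms, of 1 "real j"] by simp
qed

section \<open>Transport of the braked flow to a metric type\<close>

locale expansive_brake_setup = brake_setup M f \<rho> N A q \<phi> \<psi> S \<alpha>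
  for M :: "'a topology" and f :: "'a \<Rightarrow> 'a" and \<rho> :: "'a \<Rightarrow> real"
    and N :: "'p topology" and A :: "('p, 'e::euclidean_space) chart set" and q :: "'a \<times> real \<Rightarrow> 'p"
    and \<phi> \<psi> :: "real \<Rightarrow> 'p \<Rightarrow> 'p" and S :: "'p set" and \<alpha> :: "'p \<Rightarrow> real" +
  fixes d :: "'p \<Rightarrow> 'p \<Rightarrow> real" and \<kappa> :: "'p \<Rightarrow> 'k::metric_space"
  assumes metric: "Metric_space (topspace N) d" and mtop: "Metric_space.mtopology (topspace N) d = N"
    and isometry: "x \<in> topspace N \<Longrightarrow> y \<in> topspace N \<Longrightarrow> dist (\<kappa> x) (\<kappa> y) = d x y"
    and exp: "expansive_flow (topspace N) d \<psi>" and S_subset: "S \<subseteq> topspace N"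
    and nondegenerate_M: "\<exists>C a b. compactin M C \<and> connectedin M C \<and> a \<in> C \<and> b \<in> C \<and> a \<noteq> b"
begin

lemma \<kappa>_inj: "inj_on \<kappa> (topspace N)"
proof (rule inj_onI)
  fix x y assume xy: "x \<in> topspace N" "y \<in> topspace N" "\<kappa> x = \<kappa> y"
  then have "d x y = 0" using isometry[of x y] by simp
  then show "x = y" using Metric_space.zero[OF metric xy(1,2)] by simp
qed

lemma \<kappa>_cont: "continuous_map N euclidean \<kappa>"
proof -
  interpret Metric_space "topspace N" d by (rule metric)
  have "continuous_map mtopology Met_TC.mtopology \<kappa>"
    unfolding metric_continuous_map[OF Met_TC.Metric_space_axioms]
    using isometry by auto
  then show ?thesis by (simp add: mtop)
qed

definition X :: "'k set" where "X = \<kappa> ` topspace N"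

definition \<kappa>i :: "'k \<Rightarrow> 'p" where "\<kappa>i = inv_into (topspace N) \<kappa>"

lemma compact_phase_space: "compact X"
  unfolding X_def by (rule compact_embedding_inverse[OF \<kappa>_cont compact_N \<kappa>_inj])

lemma \<kappa>i_cont: "continuous_map (top_of_set X) N \<kappa>i"
  unfolding X_def \<kappa>i_def by (rule compact_embedding_inverse[OF \<kappa>_cont compact_N \<kappa>_inj])

lemma \<kappa>i_\<kappa>: "p \<in> topspace N \<Longrightarrow> \<kappa>i (\<kappa> p) = p"
  unfolding \<kappa>i_def using \<kappa>_inj by simp

lemma \<kappa>i_in: "x \<in> X \<Longrightarrow> \<kappa>i x \<in> topspace N" and \<kappa>_\<kappa>i: "x \<in> X \<Longrightarrow> \<kappa> (\<kappa>i x) = x"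
  unfolding \<kappa>i_def X_def by (auto intro: inv_into_into f_inv_into_f)

lemma \<kappa>_in: "p \<in> topspace N \<Longrightarrow> \<kappa> p \<in> X" by (simp add: X_def)

text \<open>Two stopped points at distance at most \<open>\<delta>\<close> shadow each other under
  the identity time change, and expansiveness puts one on the one-point orbit of the other. So
  \<open>S\<close> is uniformly discrete in a compact space.\<close>

lemma finite_S: "finite S"
proof -
  have "\<forall>\<epsilon>>0. \<exists>\<delta>>0. \<forall>x\<in>topspace N. \<forall>y\<in>topspace N. \<forall>h\<in>Rep.
        (\<forall>t. d (\<psi> t x) (\<psi> (h t) y) \<le> \<delta>) \<longrightarrow>
        (\<exists>t0. \<psi> (h t0) y \<in> (\<lambda>s. \<psi> s x) ` {t0 - \<epsilon>..t0 + \<epsilon>})"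
    using exp by (simp add: expansive_flow_def)
  from this[rule_format, OF zero_less_one]
  obtain \<delta> where \<delta>: "\<delta> > 0" and ex: "\<forall>x\<in>topspace N. \<forall>y\<in>topspace N. \<forall>h\<in>Rep.
        (\<forall>t. d (\<psi> t x) (\<psi> (h t) y) \<le> \<delta>) \<longrightarrow>
        (\<exists>t0. \<psi> (h t0) y \<in> (\<lambda>s. \<psi> s x) ` {t0 - 1..t0 + 1})"
    by (elim exE conjE)
  have id: "(\<lambda>t. t) \<in> Rep" by (intro RepI) (auto simp: strict_mono_def)
  have sep: "x = y" if x: "x \<in> S" and y: "y \<in> S" and xy: "dist (\<kappa> x) (\<kappa> y) \<le> \<delta>" for x y
  proof -
    have xyN: "x \<in> topspace N" "y \<in> topspace N" using x y S_subset by auto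
    have fixed: "\<psi> t x = x" "\<psi> t y = y" for t using stopped_fixed xyN x y by auto
    have "\<forall>t. d (\<psi> t x) (\<psi> t y) \<le> \<delta>" using xy isometry[OF xyN] by (simp add: fixed)
    then have "\<exists>t0. \<psi> t0 y \<in> (\<lambda>s. \<psi> s x) ` {t0 - 1..t0 + 1}"
      using bspec[OF bspec[OF bspec[OF ex xyN(1)] xyN(2)] id] by blast
    then show ?thesis by (auto simp: fixed)
  qed
  have "finite (\<kappa> ` S)"
  proof (rule ccontr)
    assume inf: "infinite (\<kappa> ` S)"
    have "\<kappa> ` S \<subseteq> X" using S_subset by (auto simp: X_def)
    then obtain l where "l islimpt (\<kappa> ` S)"
      using compact_phase_space inf unfolding compact_eq_Bolzano_Weierstrass by blast
    then have "infinite (\<kappa> ` S \<inter> ball l (\<delta>/2))"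
      using \<delta> by (simp add: islimpt_eq_infinite_ball)
    then obtain u v where uv: "u \<in> \<kappa> ` S \<inter> ball l (\<delta>/2)" "v \<in> \<kappa> ` S \<inter> ball l (\<delta>/2)" "u \<noteq> v"
      by (metis finite.emptyI finite_insert insertI1 subsetI finite_subset singletonD singletonI)
    then obtain x y where xy: "x \<in> S" "y \<in> S" "u = \<kappa> x" "v = \<kappa> y" by blast
    have "dist u v \<le> \<delta>" using uv(1,2) dist_triangle3[of u v l] by simp
    then show False using sep xy uv(3) by blast
  qed
  moreover have "inj_on \<kappa> S" using \<kappa>_inj S_subset by (rule inj_on_subset)
  ultimately show ?thesis by (rule finite_imageD)
qed

text \<open>The base is realised in the phase space as the section at height 0, so that base map and
  flow act on subsets of the same metric space.\<close>

definition J :: "'a \<Rightarrow> 'k" where "J a = \<kappa> (q (a, 0))"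

definition K :: "'k set" where "K = J ` topspace M"

definition Ji :: "'k \<Rightarrow> 'a" where "Ji = inv_into (topspace M) J"

lemma J_cont: "continuous_map M euclidean J"
proof -
  have "continuous_map M strip_top (\<lambda>a. (a, 0))"
    using \<rho>_pos by (auto simp: continuous_map_in_subtopology continuous_map_pairwise comp_def strip_def intro: less_imp_le)
  from continuous_map_compose[OF continuous_map_compose[OF this q_cont] \<kappa>_cont]
  show ?thesis by (simp add: J_def[abs_def] comp_def)
qed

lemma J_inj: "inj_on J (topspace M)"
  using \<kappa>_inj q_in[OF base_in_strip] q_base_inj unfolding J_def inj_on_def by metis

lemma compact_section: "compact K"
  unfolding K_def by (rule compact_embedding_inverse[OF J_cont compact_M J_inj])

lemma Ji_cont: "continuous_map (top_of_set K) M Ji"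
  unfolding K_def Ji_def by (rule compact_embedding_inverse[OF J_cont compact_M J_inj])

lemma Ji_J: "a \<in> topspace M \<Longrightarrow> Ji (J a) = a"
  unfolding Ji_def using J_inj by simp

lemma Ji_in: "x \<in> K \<Longrightarrow> Ji x \<in> topspace M" and J_Ji: "x \<in> K \<Longrightarrow> J (Ji x) = x"
  unfolding Ji_def K_def by (auto intro: inv_into_into f_inv_into_f)

lemma J_in: "a \<in> topspace M \<Longrightarrow> J a \<in> K" by (simp add: K_def)

definition F :: "'k \<Rightarrow> 'k" where "F = J \<circ> (f \<circ> Ji)"

definition G :: "'k \<Rightarrow> 'k" where "G = J \<circ> (inv_into (topspace M) f \<circ> Ji)"

lemma F_homeo: "homeomorphism K K F G"
proof -
  have finv: "inv_into (topspace M) f a \<in> topspace M" "f (inv_into (topspace M) f a) = a"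
      "inv_into (topspace M) f (f a) = a" if "a \<in> topspace M" for a
    using f_bij that by (auto simp: bij_betw_def intro: inv_into_into f_inv_into_f inv_into_f_f)
  have FK: "F x \<in> K" "G x \<in> K" "G (F x) = x" "F (G x) = x" if "x \<in> K" for x
    using Ji_in[OF that] f_in finv J_in Ji_J J_Ji[OF that] by (simp_all add: F_def G_def)
  have "continuous_map (top_of_set K) euclidean F" "continuous_map (top_of_set K) euclidean G"
    unfolding F_def G_def by (intro continuous_map_compose[OF _ J_cont] continuous_map_compose[OF Ji_cont] f_cont f_inv_cont)+
  then have "continuous_on K F" "continuous_on K G" by simp_all
  moreover have "F ` K = K"
  proof
    show "K \<subseteq> F ` K"
    proof
      fix x assume x: "x \<in> K"
      show "x \<in> F ` K" by (rule rev_image_eqI[OF FK(2)[OF x]]) (simp add: FK(4)[OF x])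
    qed
  qed (use FK(1) in blast)
  moreover have "G ` K = K"
  proof
    show "K \<subseteq> G ` K"
    proof
      fix x assume x: "x \<in> K"
      show "x \<in> G ` K" by (rule rev_image_eqI[OF FK(1)[OF x]]) (simp add: FK(3)[OF x])
    qed
  qed (use FK(2) in blast)
  ultimately show ?thesis using FK by (simp add: homeomorphism_def)
qed

sublocale dyn: compact_homeo K F G
  using compact_section F_homeo by (rule compact_homeo.intro)

lemma Ji_F: "x \<in> K \<Longrightarrow> Ji (F x) = f (Ji x)"
  by (simp add: F_def Ji_J f_in Ji_in)

text \<open>Heights are rescaled to \<open>{0..1}\<close>, which makes the domain a compact product
  although the roof varies.\<close>

definition fibre :: "'k \<times> real \<Rightarrow> 'p" where "fibre u = q (Ji (fst u), snd u * \<rho> (Ji (fst u)))"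

lemma fibre_cont: "continuous_map (top_of_set (K \<times> {0..1})) N fibre"
proof -
  let ?T = "top_of_set (K \<times> {0..1::real})"
  have fst: "continuous_map ?T (top_of_set K) fst"
    by (auto simp: continuous_map_in_subtopology continuous_on_fst)
  have 1: "continuous_map ?T M (\<lambda>u. Ji (fst u))"
    using continuous_map_compose[OF fst Ji_cont] unfolding comp_def .
  have "continuous_map ?T euclideanreal (\<lambda>u. \<rho> (Ji (fst u)))"
    using continuous_map_compose[OF 1 \<rho>_cont] unfolding comp_def .
  moreover have "continuous_map ?T euclideanreal snd" by (simp add: continuous_on_snd)
  ultimately have 2: "continuous_map ?T euclideanreal (\<lambda>u. snd u * \<rho> (Ji (fst u)))"
    by (intro continuous_map_real_mult)
  have "continuous_map ?T strip_top (\<lambda>u. (Ji (fst u), snd u * \<rho> (Ji (fst u))))"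
    using 1 2 height_in_strip Ji_in
    by (auto simp: continuous_map_in_subtopology continuous_map_pairwise comp_def)
  from continuous_map_compose[OF this q_cont]
  show ?thesis by (simp add: fibre_def[abs_def] comp_def)
qed

lemma fibre_in: "x \<in> K \<Longrightarrow> s \<in> {0..1} \<Longrightarrow> fibre (x, s) \<in> topspace N"
  unfolding fibre_def using q_in height_in_strip Ji_in by simp

text \<open>Closed fibres are meant: a point of \<open>S\<close> on the base section stops its own
  base point and also the preimage of that point under \<open>f\<close>, whose fibre ends
  there.\<close>

definition stopped :: "'k set" where
  "stopped = J ` {x \<in> topspace M. \<exists>s. 0 \<le> s \<and> s \<le> \<rho> x \<and> q (x, s) \<in> S}"

lemma fibre_free: "x \<in> K \<Longrightarrow> x \<notin> stopped \<Longrightarrow> s \<in> {0..1} \<Longrightarrow> fibre (x, s) \<notin> S"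
proof
  assume x: "x \<in> K" "x \<notin> stopped" "s \<in> {0..1}" and "fibre (x, s) \<in> S"
  then have "q (Ji x, s * \<rho> (Ji x)) \<in> S" by (simp add: fibre_def)
  moreover have "0 \<le> s * \<rho> (Ji x)" "s * \<rho> (Ji x) \<le> \<rho> (Ji x)"
    using height_in_strip[OF Ji_in[OF x(1)] x(3)] by (simp_all add: in_strip)
  ultimately have "J (Ji x) \<in> stopped" unfolding stopped_def using Ji_in[OF x(1)] by blast
  then show False using x J_Ji by simp
qed

definition \<Psi> :: "real \<Rightarrow> 'k \<Rightarrow> 'k" where "\<Psi> t x = \<kappa> (\<psi> t (\<kappa>i x))"

definition travel_time :: "'k \<Rightarrow> (real \<Rightarrow> real) \<Rightarrow> bool" where
  "travel_time x h \<longleftrightarrow> strict_mono h \<and> surj h \<and> h 0 = 0 \<and>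
    (\<forall>n. \<forall>s\<in>{0..1}. \<Psi> (h (of_int n + s)) x = \<kappa> (fibre (dyn.iter n x, s))) \<and>
    (\<forall>n. \<forall>m>0. (\<forall>s\<in>{0..1}. \<alpha> (fibre (dyn.iter n x, s)) \<ge> m) \<longrightarrow>
       h (of_int n + 1) - h (of_int n) \<le> \<rho> (Ji (dyn.iter n x)) / m)"

lemma travel_time_exists:
  assumes x: "x \<in> K" "\<And>n. dyn.iter n x \<notin> stopped"
  shows "\<exists>h. travel_time x h"
proof -
  define b where "b n = Ji (dyn.iter n x)" for n
  have bM: "b n \<in> topspace M" for n unfolding b_def by (intro Ji_in dyn.iter_in x)
  have bS: "b (n + 1) = f (b n)" for n
    unfolding b_def dyn.iter_Suc[OF x(1)] by (rule Ji_F[OF dyn.iter_in[OF x(1)]])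
  have fib: "fibre (dyn.iter n x, s) = q (b n, s * \<rho> (b n))" for n s by (simp add: fibre_def b_def)
  have free: "q (b n, s * \<rho> (b n)) \<notin> S" if "s \<in> {0..1}" for n s
    using fibre_free[OF dyn.iter_in[OF x(1)] x(2) that] by (simp add: fib)
  have b0: "\<kappa>i x = q (b 0, 0)"
    using J_Ji[OF x(1)] \<kappa>i_\<kappa>[OF q_in[OF base_in_strip[OF bM[of 0]]]] by (simp add: b_def dyn.iter_0 J_def)
  obtain h where h: "strict_mono h" "surj h" "h 0 = 0"
    "\<And>n s. s \<in> {0..1} \<Longrightarrow> \<psi> (h (of_int n + s)) (q (b 0, 0)) = q (b n, s * \<rho> (b n))"
    "\<And>n m. m > 0 \<Longrightarrow> (\<And>s. s \<in> {0..1} \<Longrightarrow> \<alpha> (q (b n, s * \<rho> (b n))) \<ge> m) \<Longrightarrow>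
       h (of_int n + 1) - h (of_int n) \<le> \<rho> (b n) / m"
    using section_time[of b, OF bM bS free] by blast
  have "travel_time x h"
    unfolding travel_time_def \<Psi>_def fib b0 b_def[symmetric]
    using h by simp
  then show ?thesis by blast
qed

definition H :: "'k \<Rightarrow> real \<Rightarrow> real" where "H x = (SOME h. travel_time x h)"

lemma travel_time_H: "x \<in> K \<Longrightarrow> (\<And>n. dyn.iter n x \<notin> stopped) \<Longrightarrow> travel_time x (H x)"
  unfolding H_def using travel_time_exists by (rule someI_ex)

text \<open>Removing the open \<open>r\<close>-balls around the stopped points from \<open>K\<close>
  leaves a compact set. The closed fibres over it avoid \<open>S\<close>, so \<open>\<alpha>\<close>
  has a positive minimum \<open>m\<close> on them; together with an upper bound \<open>C\<close> of
  the roof this gives \<open>C / m\<close>.\<close>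

lemma travel_time_bound:
  assumes r: "r > 0"
  shows "\<exists>R. \<forall>x\<in>K. (\<forall>n. dyn.iter n x \<notin> stopped) \<longrightarrow>
       (\<forall>n. (\<forall>p\<in>stopped. dist (dyn.iter n x) p \<ge> r) \<longrightarrow> H x (of_int n + 1) - H x (of_int n) \<le> R)"
proof -
  let ?K' = "K - (\<Union>p\<in>stopped. ball p r)"
  have cK': "compact ?K'" by (intro compact_diff compact_section open_UN ballI open_ball)
  have cont: "continuous_on (?K' \<times> {0..1}) (\<lambda>u. \<alpha> (fibre u))"
  proof (rule continuous_on_subset)
    show "continuous_on (K \<times> {0..1}) (\<lambda>u. \<alpha> (fibre u))"
      using continuous_map_compose[OF fibre_cont \<alpha>_cont] by (simp add: comp_def)
  qed auto
  have pos: "\<alpha> (fibre u) > 0" if u_in: "u \<in> ?K' \<times> {0..1}" for u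
  proof -
    obtain x s where u: "u = (x, s)" "x \<in> ?K'" "s \<in> {0..1}" using u_in by blast
    then have "x \<notin> stopped" using r by auto
    then show ?thesis using u fibre_free fibre_in \<alpha>_pos by blast
  qed
  have "\<exists>m>0. \<forall>u\<in>?K' \<times> {0..1}. \<alpha> (fibre u) \<ge> m"
  proof (cases "?K' \<times> {0..1::real} = {}")
    case True
    show ?thesis by (rule exI[of _ 1]) (simp only: True ball_simps zero_less_one simp_thms)
  next
    case False
    obtain u where u: "u \<in> ?K' \<times> {0..1::real}" "\<forall>v\<in>?K' \<times> {0..1}. \<alpha> (fibre u) \<le> \<alpha> (fibre v)"
      using continuous_attains_inf[OF compact_Times[OF cK' compact_Icc] False cont] by (elim bexE)
    show ?thesis by (rule exI[of _ "\<alpha> (fibre u)"], rule conjI[OF pos[OF u(1)] u(2)])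
  qed
  then obtain m where m: "m > 0" "\<forall>u\<in>?K' \<times> {0..1}. \<alpha> (fibre u) \<ge> m" by (elim exE conjE)
  obtain c C where C: "\<forall>x\<in>topspace M. c \<le> \<rho> x \<and> \<rho> x \<le> C" using \<rho>_bounds by blast
  have "H x (of_int n + 1) - H x (of_int n) \<le> C / m"
    if x: "x \<in> K" "\<forall>n. dyn.iter n x \<notin> stopped" and far: "\<forall>p\<in>stopped. dist (dyn.iter n x) p \<ge> r" for x n
  proof -
    have it: "dyn.iter n x \<in> K" using dyn.iter_in[OF x(1)] .
    moreover have "dyn.iter n x \<notin> ball p r" if "p \<in> stopped" for p
      using bspec[OF far that] by (simp add: dist_commute)
    ultimately have in_K': "dyn.iter n x \<in> ?K'" by blast
    have "\<forall>s\<in>{0..1}. \<alpha> (fibre (dyn.iter n x, s)) \<ge> m"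
      by (intro ballI bspec[OF m(2)] SigmaI in_K')
    moreover have "travel_time x (H x)" using travel_time_H x by blast
    ultimately have "H x (of_int n + 1) - H x (of_int n) \<le> \<rho> (Ji (dyn.iter n x)) / m"
      using m(1) unfolding travel_time_def by blast
    also have "\<dots> \<le> C / m" using C Ji_in[OF it] m(1) by (simp add: divide_right_mono)
    finally show ?thesis .
  qed
  then show ?thesis by blast
qed

lemma finite_stopped: "finite stopped"
  unfolding stopped_def using finite_base_points_over[OF finite_S] by simp

lemma \<Psi>_cont: "continuous_on (UNIV \<times> X) (\<lambda>(t, x). \<Psi> t x)"
proof -
  let ?T = "top_of_set (UNIV \<times> X) :: (real \<times> 'k) topology"
  have snd: "continuous_map ?T (top_of_set X) snd"
    by (auto simp: continuous_map_in_subtopology continuous_on_snd)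
  have 1: "continuous_map ?T N (\<lambda>u. \<kappa>i (snd u))"
    using continuous_map_compose[OF snd \<kappa>i_cont] unfolding comp_def .
  have "continuous_map ?T euclideanreal fst" by (simp add: continuous_on_fst)
  from continuous_map_compose[OF flow_continuous_compose[OF \<psi>_flow this 1] \<kappa>_cont]
  have "continuous_map ?T euclidean (\<lambda>u. \<kappa> (\<psi> (fst u) (\<kappa>i (snd u))))"
    unfolding comp_def .
  then show ?thesis by (simp add: \<Psi>_def case_prod_beta)
qed

lemma \<Psi>_in: "x \<in> X \<Longrightarrow> \<Psi> t x \<in> X"
  unfolding \<Psi>_def by (intro \<kappa>_in flow_in[OF \<psi>_flow] \<kappa>i_in)

lemma \<Psi>_add: "x \<in> X \<Longrightarrow> \<Psi> (s + t) x = \<Psi> s (\<Psi> t x)"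
  unfolding \<Psi>_def
  using flow_add[OF \<psi>_flow \<kappa>i_in, of x s t] \<kappa>i_\<kappa>[OF flow_in[OF \<psi>_flow \<kappa>i_in], of x t] by simp

lemma expansive_\<Psi>:
  "\<exists>\<delta>>0. \<forall>x\<in>X. \<forall>y\<in>X. \<forall>h\<in>Rep. (\<forall>t. dist (\<Psi> t x) (\<Psi> (h t) y) \<le> \<delta>) \<longrightarrow> (\<exists>s t. \<Psi> s y = \<Psi> t x)"
proof -
  have "\<forall>\<epsilon>>0. \<exists>\<delta>>0. \<forall>x\<in>topspace N. \<forall>y\<in>topspace N. \<forall>h\<in>Rep.
        (\<forall>t. d (\<psi> t x) (\<psi> (h t) y) \<le> \<delta>) \<longrightarrow>
        (\<exists>t0. \<psi> (h t0) y \<in> (\<lambda>s. \<psi> s x) ` {t0 - \<epsilon>..t0 + \<epsilon>})"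
    using exp by (simp add: expansive_flow_def)
  from this[rule_format, OF zero_less_one]
  obtain \<delta> where \<delta>: "\<delta> > 0" and ex: "\<forall>x\<in>topspace N. \<forall>y\<in>topspace N. \<forall>h\<in>Rep.
        (\<forall>t. d (\<psi> t x) (\<psi> (h t) y) \<le> \<delta>) \<longrightarrow>
        (\<exists>t0. \<psi> (h t0) y \<in> (\<lambda>s. \<psi> s x) ` {t0 - 1..t0 + 1})"
    by (elim exE conjE)
  have "\<exists>s t. \<Psi> s y = \<Psi> t x"
    if x: "x \<in> X" and y: "y \<in> X" and h: "h \<in> Rep" and close: "\<forall>t. dist (\<Psi> t x) (\<Psi> (h t) y) \<le> \<delta>" for x y h
  proof -
    have close_d: "d (\<psi> t (\<kappa>i x)) (\<psi> (h t) (\<kappa>i y)) \<le> \<delta>" for t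
      using spec[OF close, of t] isometry[OF flow_in[OF \<psi>_flow \<kappa>i_in[OF x]] flow_in[OF \<psi>_flow \<kappa>i_in[OF y]], of t "h t"]
      by (simp add: \<Psi>_def)
    obtain t0 where "\<psi> (h t0) (\<kappa>i y) \<in> (\<lambda>s. \<psi> s (\<kappa>i x)) ` {t0 - 1..t0 + 1}"
      using mp[OF bspec[OF bspec[OF bspec[OF ex \<kappa>i_in[OF x]] \<kappa>i_in[OF y]] h] allI[OF close_d]] by (elim exE)
    then obtain t where "\<psi> (h t0) (\<kappa>i y) = \<psi> t (\<kappa>i x)" by blast
    then show ?thesis unfolding \<Psi>_def by metis
  qed
  then show ?thesis using \<delta> by blast
qed

lemma nondegenerate_continuum: "\<exists>C. dyn.continuum C \<and> \<not> thin 0 C"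
proof -
  obtain C a b where C: "compactin M C" "connectedin M C" "a \<in> C" "b \<in> C" "a \<noteq> b"
    using nondegenerate_M by blast
  have CM: "C \<subseteq> topspace M" by (rule compactin_subset_topspace[OF C(1)])
  have "compact (J ` C)" using image_compactin[OF C(1) J_cont] by simp
  moreover have "connected (J ` C)" using connectedin_continuous_map_image[OF J_cont C(2)] by simp
  ultimately have "dyn.continuum (J ` C)" using CM J_in by (auto simp: dyn.continuum_def)
  moreover have "J a \<noteq> J b" using C(3-5) CM J_inj by (auto simp: inj_on_def)
  then have "\<not> thin 0 (J ` C)" using C(3,4) by (intro not_thinI[of "J a" _ "J b"]) auto
  ultimately show ?thesis by blast
qed

text \<open>\<open>\<kappa>\<close> is an isometry onto \<open>X\<close> that conjugates
  \<open>\<psi>\<close> to \<open>\<Psi>\<close>, so separated sets found in \<open>X\<close> pull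
  back through \<open>\<kappa>i\<close> with the same distances.\<close>

theorem flow_entropy_pos: "flow_entropy (topspace N) d \<psi> > 0"
proof -
  obtain z where z: "continuous_map N euclidean z"
    "\<And>x s. (x, s) \<in> strip (topspace M) \<rho> \<Longrightarrow> z (q (x, s)) = cis (2 * pi * (s / \<rho> x))"
    using circle_map by blast
  have tt: "travel_time x (H x)" if "x \<in> K" "\<And>n. dyn.iter n x \<notin> stopped" for x
    by (rule travel_time_H[OF that])
  interpret braked_suspension K F G X \<Psi> "\<lambda>x s. \<kappa> (fibre (x, s))" "\<lambda>x. z (\<kappa>i x)" stopped H
  proof unfold_locales
    show "compact X" by (rule compact_phase_space)
    show "continuous_on (UNIV \<times> X) (\<lambda>(t, x). \<Psi> t x)" by (rule \<Psi>_cont)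
    show "\<Psi> t x \<in> X" if "x \<in> X" for t x by (rule \<Psi>_in[OF that])
    show "\<Psi> 0 x = x" if "x \<in> X" for x
      using that by (simp add: \<Psi>_def flow_zero[OF \<psi>_flow \<kappa>i_in] \<kappa>_\<kappa>i)
    show "\<Psi> (s + t) x = \<Psi> s (\<Psi> t x)" if "x \<in> X" for s t x by (rule \<Psi>_add[OF that])
    show "continuous_on (K \<times> {0..1}) (\<lambda>(x, s). \<kappa> (fibre (x, s)))"
      using continuous_map_compose[OF fibre_cont \<kappa>_cont] by (simp add: comp_def case_prod_beta)
    show "\<kappa> (fibre (x, s)) \<in> X" if "x \<in> K" "s \<in> {0..1}" for x s
      by (rule \<kappa>_in[OF fibre_in[OF that]])
    show "\<kappa> (fibre (x, 0)) = x" if "x \<in> K" for x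
      using J_Ji[OF that] by (simp add: fibre_def J_def)
    show "\<kappa> (fibre (x, 1)) = F x" if "x \<in> K" for x
      using q_roof[OF Ji_in[OF that]] by (simp add: fibre_def F_def J_def)
    show "continuous_on X (\<lambda>x. z (\<kappa>i x))"
      using continuous_map_compose[OF \<kappa>i_cont z(1)] by (simp add: comp_def)
    show "z (\<kappa>i (\<kappa> (fibre (x, s)))) = cis (2 * pi * s)" if "x \<in> K" "s \<in> {0..1}" for x s
      using z(2)[OF height_in_strip[OF Ji_in[OF that(1)] that(2)]] \<rho>_pos[OF Ji_in[OF that(1)]]
        \<kappa>i_\<kappa>[OF fibre_in[OF that]] by (simp add: fibre_def)
    show "finite stopped" by (rule finite_stopped)
    show "stopped \<subseteq> K" unfolding stopped_def K_def by blast
    show "strict_mono (H x) \<and> surj (H x) \<and> H x 0 = 0" if "x \<in> K" "\<And>n. dyn.iter n x \<notin> stopped" for x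
      using tt[OF that] by (simp add: travel_time_def)
    show "\<Psi> (H x (of_int n + s)) x = \<kappa> (fibre (dyn.iter n x, s))"
      if "x \<in> K" "\<And>n. dyn.iter n x \<notin> stopped" "s \<in> {0..1}" for x n s
      using tt[OF that(1,2)] that(3) by (simp add: travel_time_def)
    show "\<exists>R. \<forall>x\<in>K. (\<forall>n. dyn.iter n x \<notin> stopped) \<longrightarrow>
       (\<forall>n. (\<forall>p\<in>stopped. r \<le> dist (dyn.iter n x) p) \<longrightarrow> H x (of_int n + 1) - H x (of_int n) \<le> R)"
      if "r > 0" for r by (rule travel_time_bound[OF that])
  qed (rule expansive_\<Psi>, rule nondegenerate_continuum)
  obtain \<epsilon> m where \<epsilon>: "\<epsilon> > 0" and sep: "\<forall>k. \<exists>E\<subseteq>X. finite E \<and> card E = 2 ^ k \<and>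
    (\<forall>x\<in>E. \<forall>y\<in>E. x \<noteq> y \<longrightarrow> (\<exists>j\<le>k * m. dist (\<Psi> (real j) x) (\<Psi> (real j) y) > \<epsilon>))"
    using time_one_separated by blast
  show ?thesis unfolding flow_entropy_def
  proof (rule topological_entropy_pos[OF \<epsilon>])
    fix k
    obtain E where E: "E \<subseteq> X" "finite E" "card E = 2 ^ k"
      and Es: "\<forall>x\<in>E. \<forall>y\<in>E. x \<noteq> y \<longrightarrow> (\<exists>j\<le>k * m. dist (\<Psi> (real j) x) (\<Psi> (real j) y) > \<epsilon>)"
      using spec[OF sep, of k] by blast
    have inj: "inj_on \<kappa>i E" by (rule inj_on_inverseI[of _ \<kappa>]) (use E(1) \<kappa>_\<kappa>i in blast)
    have "\<exists>j\<le>k * m. \<epsilon> < d ((\<psi> 1 ^^ j) (\<kappa>i x)) ((\<psi> 1 ^^ j) (\<kappa>i y))" if xy: "x \<in> E" "y \<in> E" "x \<noteq> y" for x y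
    proof -
      obtain j where j: "j \<le> k * m" "dist (\<Psi> (real j) x) (\<Psi> (real j) y) > \<epsilon>" using Es xy by blast
      have N: "\<kappa>i x \<in> topspace N" "\<kappa>i y \<in> topspace N" using xy E(1) \<kappa>i_in by auto
      have "dist (\<Psi> (real j) x) (\<Psi> (real j) y) = d (\<psi> (real j) (\<kappa>i x)) (\<psi> (real j) (\<kappa>i y))"
        unfolding \<Psi>_def by (rule isometry[OF flow_in[OF \<psi>_flow N(1)] flow_in[OF \<psi>_flow N(2)]])
      then show ?thesis using j by (intro exI[of _ j]) (simp add: flow_iterate[OF \<psi>_flow] N)
    qed
    then have "\<forall>x\<in>\<kappa>i ` E. \<forall>y\<in>\<kappa>i ` E. x \<noteq> y \<longrightarrow> (\<exists>j\<le>k * m. \<epsilon> < d ((\<psi> 1 ^^ j) x) ((\<psi> 1 ^^ j) y))"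
      by blast
    moreover have "\<kappa>i ` E \<subseteq> topspace N" using E(1) \<kappa>i_in by blast
    moreover have "finite (\<kappa>i ` E)" "card (\<kappa>i ` E) = 2 ^ k" using E(2,3) inj by (simp_all add: card_image)
    ultimately show "\<exists>E\<subseteq>topspace N. finite E \<and> card E = 2 ^ k \<and>
      (\<forall>x\<in>E. \<forall>y\<in>E. x \<noteq> y \<longrightarrow> (\<exists>j\<le>k * m. \<epsilon> < d ((\<psi> 1 ^^ j) x) ((\<psi> 1 ^^ j) y)))"
      by (intro exI[of _ "\<kappa>i ` E"] conjI)
  qed
qed

end

section \<open>Application to manifolds\<close>

text \<open>A segment in the image of a chart is carried back to the manifold; it is nondegenerate
  because a Euclidean model space has a basis vector.\<close>

lemma manifold_nondegenerate_continuum: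
  fixes B :: "('a, 'm::euclidean_space) chart set"
  assumes "smooth_atlas M B" "topspace M \<noteq> {}"
  shows "\<exists>C a b. compactin M C \<and> connectedin M C \<and> a \<in> C \<and> b \<in> C \<and> a \<noteq> b"
proof -
  obtain x where x: "x \<in> topspace M" using assms(2) by blast
  have "x \<in> \<Union> (fst ` B)" using assms(1) x by (simp add: smooth_atlas_def)
  then obtain Uc where "Uc \<in> B" "x \<in> fst Uc" by blast
  then obtain U c where U: "(U, c) \<in> B" "x \<in> U" by (metis prod.collapse)
  have "openin M U" and op: "open (c ` U)" and hom: "homeomorphic_map (subtopology M U) (top_of_set (c ` U)) c"
    using assms(1) U(1) unfolding smooth_atlas_def by auto
  obtain g where g: "homeomorphic_maps (subtopology M U) (top_of_set (c ` U)) c g"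
    using hom unfolding homeomorphic_map_maps by blast
  obtain \<delta> where \<delta>: "\<delta> > 0" "cball (c x) \<delta> \<subseteq> c ` U" using op U(2) open_contains_cball by blast
  obtain i :: 'm where i: "i \<in> Basis" using nonempty_Basis by blast
  define y where "y = c x + \<delta> *\<^sub>R i"
  have "dist (c x) y = \<delta>" using \<delta>(1) i by (simp add: y_def dist_norm)
  then have y: "y \<in> cball (c x) \<delta>" "c x \<noteq> y" using \<delta>(1) by auto
  let ?L = "closed_segment (c x) y"
  have "c x \<in> cball (c x) \<delta>" using \<delta>(1) by simp
  then have "?L \<subseteq> cball (c x) \<delta>" using y(1) by (intro closed_segment_subset convex_cball)
  then have L: "?L \<subseteq> c ` U" using \<delta>(2) by blast
  have gc: "continuous_map (top_of_set (c ` U)) (subtopology M U) g"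
    using g by (simp add: homeomorphic_maps_def)
  then have gM: "continuous_map (top_of_set (c ` U)) M g" by (simp add: continuous_map_in_subtopology)
  have "compactin (top_of_set (c ` U)) ?L" "connectedin (top_of_set (c ` U)) ?L"
    using L by (simp_all add: compactin_subtopology connectedin_subtopology)
  then have "compactin M (g ` ?L)" "connectedin M (g ` ?L)"
    using image_compactin[OF _ gM] connectedin_continuous_map_image[OF gM] by blast+
  moreover have "g (c x) \<noteq> g y"
  proof
    assume eq: "g (c x) = g y"
    have cg: "c (g z) = z" if "z \<in> c ` U" for z
      using g that by (auto simp: homeomorphic_maps_def)
    have in_cU: "c x \<in> c ` U" "y \<in> c ` U" using L by auto
    have "c x = c (g (c x))" by (rule cg[OF in_cU(1), symmetric])
    also have "\<dots> = c (g y)" by (simp only: eq)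
    also have "\<dots> = y" by (rule cg[OF in_cU(2)])
    finally show False by (rule notE[OF y(2)])
  qed
  moreover have "g (c x) \<in> g ` ?L" "g y \<in> g ` ?L" by auto
  ultimately show ?thesis by (intro exI conjI)
qed

theorem theorem4:
  fixes M :: "'a topology" and B :: "('a, 'm::euclidean_space) chart set" and f :: "'a \<Rightarrow> 'a"
    and N :: "'p topology" and A :: "('p, real ^ 3) chart set"
    and g :: "('p, real ^ 3) chart \<Rightarrow> 'p \<Rightarrow> real ^ 3 \<Rightarrow> real ^ 3 \<Rightarrow> real"
    and d :: "'p \<Rightarrow> 'p \<Rightarrow> real" and \<psi> :: "real \<Rightarrow> 'p \<Rightarrow> 'p"
  assumes "closed_manifold N A"
    and "riemannian_metric A g"
    and "riemannian_distance_function N A g d"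
    and "C1_flow N A \<psi>"
    and "expansive_flow (topspace N) d \<psi>"
    and "closed_manifold M B"
    and "C1_diffeo M B f"
    and "singular_suspension M B f N A \<psi>"
  shows "flow_entropy (topspace N) d \<psi> > 0"
proof -
  obtain \<rho> q \<phi> S \<alpha> where \<rho>: "continuous_map M euclideanreal \<rho>" "\<forall>x\<in>topspace M. 0 < \<rho> x"
    and susp: "suspension_manifold M B f \<rho> N A q \<phi>" and S: "compactin N S" and br: "brake N A S \<alpha>"
    and braked: "\<forall>p\<in>topspace N. \<forall>t. \<forall>(U, c)\<in>A. \<psi> t p \<in> U \<longrightarrow>
           ((\<lambda>s. c (\<psi> s p)) has_vector_derivative
              \<alpha> (\<psi> t p) *\<^sub>R velocity \<phi> (U, c) (\<psi> t p)) (at t)"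
    using assms(8) unfolding singular_suspension_def by blast
  have metric: "Metric_space (topspace N) d" and mtop: "Metric_space.mtopology (topspace N) d = N"
    using assms(3) by (simp_all add: riemannian_distance_function_def)
  interpret Metric_space "topspace N" d by (rule metric)
  have atlas: "smooth_atlas N A" "compact_space N" using assms(1) by (simp_all add: closed_manifold_def)
  \<comment> \<open>Compactness supplies the bound on distances that the embedding into bounded
    functions requires.\<close>
  have "mbounded (topspace N)"
    using atlas(2) by (intro compactin_imp_mbounded) (simp add: mtop compact_space_def)
  then obtain b where b: "\<forall>x\<in>topspace N. \<forall>y\<in>topspace N. d x y \<le> b" unfolding mbounded_alt by blast
  obtain \<kappa> :: "'p \<Rightarrow> ('p discrete \<Rightarrow>\<^sub>C real)" where \<kappa>: "\<And>x y. x \<in> topspace N \<Longrightarrow> y \<in> topspace N \<Longrightarrow> dist (\<kappa> x) (\<kappa> y) = d x y"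
    using kuratowski_embedding[OF metric, of b] b by blast
  interpret expansive_brake_setup M f \<rho> N A q \<phi> \<psi> S \<alpha> d \<kappa>
  proof unfold_locales
    show "compact_space M" using assms(6) by (simp add: closed_manifold_def)
    show "bij_betw f (topspace M) (topspace M)" "continuous_map M M f" "continuous_map M M (inv_into (topspace M) f)"
      using assms(7) by (simp_all add: C1_diffeo_def Ck_map_def)
    show "continuous_map M euclideanreal \<rho>" by (rule \<rho>(1))
    show "0 < \<rho> x" if "x \<in> topspace M" for x using \<rho>(2) that by blast
    show "suspension_space M f \<rho> N q" "suspension_flow (topspace M) \<rho> N q \<phi>" "has_velocity_field N A \<phi>"
      using susp by (simp_all add: suspension_manifold_def)
    show "smooth_atlas N A" "compact_space N" by (rule atlas)+
    show "brake N A S \<alpha>" by (rule br)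
    show "C1_flow N A \<psi>" by (rule assms(4))
    show "((\<lambda>s. c (\<psi> s p)) has_vector_derivative \<alpha> (\<psi> t p) *\<^sub>R velocity \<phi> (U, c) (\<psi> t p)) (at t)"
      if "p \<in> topspace N" "(U, c) \<in> A" "\<psi> t p \<in> U" for p t U c
      using braked that by blast
    show "Metric_space.mtopology (topspace N) d = N" by (rule mtop)
    show "dist (\<kappa> x) (\<kappa> y) = d x y" if "x \<in> topspace N" "y \<in> topspace N" for x y by (rule \<kappa>[OF that])
    show "expansive_flow (topspace N) d \<psi>" by (rule assms(5))
    show "S \<subseteq> topspace N" by (rule compactin_subset_topspace[OF S])
    show "\<exists>C a b. compactin M C \<and> connectedin M C \<and> a \<in> C \<and> b \<in> C \<and> a \<noteq> b"
      using assms(6) by (intro manifold_nondegenerate_continuum[of M B]) (simp_all add: closed_manifold_def)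
  qed
  show ?thesis by (rule flow_entropy_pos)
qed

end
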